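(* Let $s\in\mathbb{N}$. There is a constant $C_s>0$ depending only on $s$ such that for every integer $N\ge2$ the explicitly constructed set $\mathcal{P}_{N,s}\subset[0,1)^s$ defined in the context consists of $N$ elements and satisfies $$\mathcal{L}_{2,N}(\mathcal{P}_{N,s})\le C_s\,\frac{(\log N)^{(s-1)/2}}{N}.$$
   Context: **Discrepancy.** For a finite set $\mathcal{P}=\{\boldsymbol{x}_0,\ldots,\boldsymbol{x}_{N-1}\}$ of points in $[0,1)^s$, let $A_N([\boldsymbol{0},\boldsymbol{t}),\mathcal{P})$ be the number of indices $n$ with $\boldsymbol{x}_n\in[0,t_1)\times\cdots\times[0,t_s)$, and let $$\mathcal{L}_{2,N}(\mathcal{P})=\left(\int_{[0,1]^s}\left|\frac{A_N([\boldsymbol{0},\boldsymbol{t}),\mathcal{P})}{N}-t_1\cdots t_s\right|^2\,d\boldsymbol{t}\right)^{1/2}.$$ **Digital sequences over $\mathbb{F}_2$.** Identify $\mathbb{F}_2$ with $\{0,1\}$. Let $C_1,\ldots,C_d\in\mathbb{F}_2^{\mathbb{N}\times\mathbb{N}}$, each column of which has only finitely many nonzero entries. For $n\in\mathbb{N}_0$ with binary expansion $n=n_0+n_1 2+\cdots+n_{m-1}2^{m-1}$ put $\vec n=(n_0,\ldots,n_{m-1},0,0,\ldots)^\top$, compute $C_j\vec n=(x_{j,n,1},x_{j,n,2},\ldots)^\top$ over $\mathbb{F}_2$, and put $x_{j,n}=\sum_{i\ge1}x_{j,n,i}2^{-i}$. The digital sequence with these generating matrices is $(\boldsymbol{x}_0,\boldsymbol{x}_1,\ldots)$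 with $\boldsymbol{x}_n=(x_{1,n},\ldots,x_{d,n})$. **Sobol'-type generating matrices in dimension $d$.** Let $p_1=x$ and, for $j=2,\ldots,d$, let $p_j\in\mathbb{F}_2[x]$ be the $(j-1)$th primitive polynomial in a list of all primitive polynomials over $\mathbb{F}_2$ sorted by increasing degree (the order among polynomials of equal degree is irrelevant); in particular $p_2=1+x$. Let $e_j=\deg p_j$. For $k\in\mathbb{N}$ write $k-1=(i-1)e_j+z$ with integers $i\ge1$, $0\le z<e_j$, expand $\frac{x^{e_j-z-1}}{p_j(x)^i}=\sum_{\ell\ge1}a_\ell(i,j,z)x^{-\ell}\in\mathbb{F}_2((x^{-1}))$, and put $c_{j,k,\ell}=a_\ell(i,j,z)$, $C_j=(c_{j,k,\ell})_{k,\ell\ge1}$. **Digit interlacing.** For $x_1,x_2,x_3\in[0,1)$ with dyadic expansions $x_r=\xi_{r,1}2^{-1}+\xi_{r,2}2^{-2}+\cdots$ (finite expansions for dyadic rationals), $\mathscr{D}_3(x_1,x_2,x_3)=\sum_{a=1}^\infty\sum_{r=1}^3\xi_{r,a}2^{-r-3(a-1)}$, and for $\boldsymbol{x}\in[0,1)^{3s}$, $\mathscr{D}_3^s(\boldsymbol{x})=(\mathscr{D}_3(x_1,x_2,x_3),\ldots,\mathscr{D}_3(x_{3s-2},x_{3s-1},x_{3s}))\in[0,1)^s$. **The set $\mathcal{P}_{N,s}$.** Let $m\in\mathbb{N}$ with $2^{m-1}<N\le2^m$. Let $\boldsymbol{x}_0,\ldots,\boldsymbol{x}_{2^m-1}$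 be the first $2^m$ points of the digital sequence over $\mathbb{F}_2$ whose generating matrices are the Sobol'-type matrices $C_1,\ldots,C_{3s-1}$, $C_j=(c_{j,k,\ell})_{k,\ell\ge1}$ with $c_{j,k,\ell}=a_\ell(i,j,z)$, constructed from the polynomials $p_1,\ldots,p_{3s-1}$ in dimension $d=3s-1$, $\boldsymbol{x}_n=(x_{1,n},\ldots,x_{3s-1,n})$. Put $\boldsymbol{y}_n=(n2^{-m},x_{1,n},\ldots,x_{3s-1,n})\in[0,1)^{3s}$, $\mathcal{P}_{2^m,s}=\{\mathscr{D}_3^s(\boldsymbol{y}_n):0\le n<2^m\}$, $\widetilde{\mathcal{P}}_{N,s}=\mathcal{P}_{2^m,s}\cap\left([0,N2^{-m})\times[0,1)^{s-1}\right)$, and $$\mathcal{P}_{N,s}=\left\{\left(\tfrac{2^m}{N}x_1,x_2,\ldots,x_s\right):(x_1,\ldots,x_s)\in\widetilde{\mathcal{P}}_{N,s}\right\}.$$ *)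

theory Defs
  imports
    "HOL-Analysis.Analysis"
    "HOL-Library.Z2"
    "HOL-Computational_Algebra.Polynomial"
    "HOL-Computational_Algebra.Formal_Laurent_Series"
begin

text \<open>
  The type \<open>bit\<close> is the field with two elements. Points of \<open>\<real>\<^sup>s\<close> are extensional functions on
  \<open>{1..s}\<close>, so that the unit cube is \<open>{1..s} \<rightarrow>\<^sub>E {0..<1}\<close> and Lebesgue measure is the product
  measure of \<open>s\<close> copies of \<open>lborel\<close>. Matrices are functions of a row and a column index,
  both of which start at 1.
\<close>

section \<open>Discrepancy\<close>

definition box_count :: "nat \<Rightarrow> (nat \<Rightarrow> real) set \<Rightarrow> (nat \<Rightarrow> real) \<Rightarrow> nat" where
  "box_count s P t = card {x \<in> P. \<forall>j\<in>{1..s}. 0 \<le> x j \<and> x j < t j}"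

definition L2_discrepancy :: "nat \<Rightarrow> nat \<Rightarrow> (nat \<Rightarrow> real) set \<Rightarrow> real" where
  "L2_discrepancy s N P =
     sqrt (LINT t : ({1..s} \<rightarrow>\<^sub>E {0..1}) | (\<Pi>\<^sub>M j\<in>{1..s}. lborel).
       \<bar>real (box_count s P t) / real N - (\<Prod>j=1..s. t j)\<bar>\<^sup>2)"

section \<open>Digital sequences\<close>

text \<open>The binary digits of \<open>n\<close> at positions \<open>l - 1 \<ge> n\<close> vanish, so the sum is the full
  matrix-vector product; \<open>of_nat\<close> reduces modulo 2.\<close>

definition digital_digit :: "(nat \<Rightarrow> nat \<Rightarrow> bit) \<Rightarrow> nat \<Rightarrow> nat \<Rightarrow> bit" where
  "digital_digit C n k = (\<Sum>l=1..n. C k l * of_nat (n div 2 ^ (l - 1)))"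

definition digital_coord :: "(nat \<Rightarrow> nat \<Rightarrow> bit) \<Rightarrow> nat \<Rightarrow> real" where
  "digital_coord C n = (\<Sum>i. of_bit (digital_digit C n (Suc i)) / 2 ^ Suc i)"

section \<open>Sobol'-type generating matrices\<close>

text \<open>Primitive in the sense of finite fields: the residue class of \<open>x\<close> is a root of \<open>f\<close> in the
  field \<open>\<F>\<^sub>2[x]/(f)\<close>, and it has to generate the multiplicative group of this field.\<close>

definition primitive_poly :: "bit poly \<Rightarrow> bool" where
  "primitive_poly f \<longleftrightarrow> irreducible f \<and> \<not> f dvd [:0, 1:] \<and>
     (\<forall>g. \<not> f dvd g \<longrightarrow> (\<exists>n. f dvd g - [:0, 1:] ^ n))"

definition primitive_listing :: "(nat \<Rightarrow> bit poly) \<Rightarrow> bool" where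
  "primitive_listing q \<longleftrightarrow>
     bij_betw q {1..} {f. primitive_poly f} \<and> mono_on {1..} (\<lambda>j. degree (q j))"

definition sobol_poly :: "(nat \<Rightarrow> bit poly) \<Rightarrow> nat \<Rightarrow> bit poly" where
  "sobol_poly q j = (if j = 1 then [:0, 1:] else q (j - 1))"

text \<open>The type \<open>bit fls\<close> serves as \<open>\<F>\<^sub>2((x\<^sup>-\<^sup>1))\<close>: its formal variable is \<open>x\<^sup>-\<^sup>1\<close>, hence
  \<open>x\<close> is \<open>fls_X_inv\<close> and the coefficient of \<open>x\<^sup>-\<^sup>l\<close> has index \<open>l\<close>.\<close>

definition laurent_of_poly :: "bit poly \<Rightarrow> bit fls" where
  "laurent_of_poly p = poly (map_poly fls_const p) fls_X_inv"

definition sobol_coeff :: "bit poly \<Rightarrow> nat \<Rightarrow> nat \<Rightarrow> nat \<Rightarrow> bit" where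
  "sobol_coeff p i z l =
     fls_nth (fls_X_inv ^ (degree p - z - 1) / laurent_of_poly p ^ i) (int l)"

definition sobol_matrix :: "bit poly \<Rightarrow> nat \<Rightarrow> nat \<Rightarrow> bit" where
  "sobol_matrix p k l =
     sobol_coeff p ((k - 1) div degree p + 1) ((k - 1) mod degree p) l"

section \<open>Digit interlacing\<close>

text \<open>For dyadic rationals the floor yields the digits of the finite expansion.\<close>

definition dyadic_digit :: "real \<Rightarrow> nat \<Rightarrow> int" where
  "dyadic_digit x a = \<lfloor>2 ^ a * x\<rfloor> mod 2"

definition interlace3 :: "(nat \<Rightarrow> real) \<Rightarrow> real" where
  "interlace3 x = (\<Sum>a. \<Sum>r=1..3. of_int (dyadic_digit (x r) (Suc a)) / 2 ^ (r + 3 * a))"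

definition interlace3_vec :: "nat \<Rightarrow> (nat \<Rightarrow> real) \<Rightarrow> nat \<Rightarrow> real" where
  "interlace3_vec s x = (\<lambda>i\<in>{1..s}. interlace3 (\<lambda>r. x (3 * (i - 1) + r)))"

section \<open>The point set\<close>

text \<open>Throughout, \<open>q\<close> is a listing of the primitive polynomials, and \<open>m\<close> is meant to satisfy
  \<open>2 ^ (m - 1) < N \<le> 2 ^ m\<close>.\<close>

definition sobol_point :: "(nat \<Rightarrow> bit poly) \<Rightarrow> nat \<Rightarrow> nat \<Rightarrow> nat \<Rightarrow> nat \<Rightarrow> real" where
  "sobol_point q s m n =
     (\<lambda>j\<in>{1..3 * s}. if j = 1 then real n / 2 ^ m
        else digital_coord (sobol_matrix (sobol_poly q (j - 1))) n)"

definition interlaced_net :: "(nat \<Rightarrow> bit poly) \<Rightarrow> nat \<Rightarrow> nat \<Rightarrow> (nat \<Rightarrow> real) set" where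
  "interlaced_net q s m = {interlace3_vec s (sobol_point q s m n) |n. n < 2 ^ m}"

definition truncated_net :: "(nat \<Rightarrow> bit poly) \<Rightarrow> nat \<Rightarrow> nat \<Rightarrow> nat \<Rightarrow> (nat \<Rightarrow> real) set" where
  "truncated_net q s m N = interlaced_net q s m \<inter>
     (\<Pi>\<^sub>E j\<in>{1..s}. if j = 1 then {0..<real N / 2 ^ m} else {0..<1})"

definition point_set :: "(nat \<Rightarrow> bit poly) \<Rightarrow> nat \<Rightarrow> nat \<Rightarrow> nat \<Rightarrow> (nat \<Rightarrow> real) set" where
  "point_set q s m N = (\<lambda>x. x(1 := 2 ^ m / real N * x 1)) ` truncated_net q s m N"

end

theory Submission
  imports
    Defs
    "HOL-Computational_Algebra.Polynomial_Factorial"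
begin

text \<open>
  The stretched and truncated net has, up to a factor at most 2, the mean square discrepancy of the
  full net of \<open>2 ^ m\<close> points, all of which have \<open>3 * m\<close> binary digits; hence it is enough to average over a
  finite grid. There the discrepancy splits orthogonally into Haar components of levels
  \<open>(b\<^sub>1, \<dots>, b\<^sub>s)\<close>. In each coordinate the Haar coefficient of \<open>k \<mapsto> [x \<le> k]\<close> is a combination of Walsh
  functions that, apart from the prefix, involve only the two digits \<open>b\<close> and \<open>b + c\<close> of \<open>x\<close>, with
  weight \<open>2\<^sup>-\<^sup>c\<close>. Interlacing three components makes all characters of the net with
  \<open>\<Sum>b\<^sub>i + \<Sum>c\<^sub>i/3 \<le> m - t\<close> vanish, so a level with \<open>|b| = m - t - R\<close> contributes
  \<open>O(16\<^sup>-\<^sup>R)\<close> up to polynomial factors, while levels with \<open>|b| > m - t\<close> are controlled by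
  counting points in boxes. The sum is dominated by the \<open>O(m\<^sup>s\<^sup>-\<^sup>1)\<close> levels near \<open>|b| = m - t\<close>.
\<close>

text \<open>The obstacle is the number of levels: about m^s of them have |b| <= m, but the claim
  leaves room for only m^(s-1) contributions of constant size. On a level of deficit R = m - t - |b|
  the relevant boxes hold about 2^R points. Without interlacing the largest surviving weight would
  be about 2^-R, which merely cancels this, so that every level would count. Spreading the digits of
  a coordinate over three components means that a digit c places behind the prefix uses up only
  about c/3 of the independence of the matrix rows. Survivors then need a total offset of about 3R,
  their weight falls to 8^-R, and the square of 2^R * 8^-R is the rate 16^-R.

  The component n / 2^m turns a sequence in 3s - 1 dimensions into a net in 3s dimensions. Its
  quality parameter t is the sum of the numbers e_j - 1 and thus depends on the degrees only. All
  listings of the primitive polynomials have the same degrees, which makes the constant depend on s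
  alone.\<close>

declare add_bit_eq_xor [simp del] mult_bit_eq_and [simp del] minus_bit_def [simp del]
  uminus_bit_def [simp del] divide_bit_def [simp del] inverse_bit_def [simp del]
  power_bit_unfold [simp del]

section \<open>Sobol' matrices\<close>

lemma laurent_of_poly_0 [simp]: "laurent_of_poly 0 = 0"
  by (simp add: laurent_of_poly_def)

lemma laurent_of_poly_pCons:
  "laurent_of_poly (pCons a p) = fls_const a + fls_X_inv * laurent_of_poly p"
  by (simp add: laurent_of_poly_def map_poly_pCons)

lemma laurent_of_poly_1 [simp]: "laurent_of_poly 1 = 1"
  by (simp add: one_pCons laurent_of_poly_pCons)

lemma laurent_of_poly_add: "laurent_of_poly (p + q) = laurent_of_poly p + laurent_of_poly q"
proof (induction p arbitrary: q)
  case (pCons a p)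
  obtain b r where "q = pCons b r" by (cases q)
  then show ?case using pCons.IH[of r]
    by (simp add: laurent_of_poly_pCons distrib_left add_ac flip: fls_plus_const)
qed simp

lemma laurent_of_poly_smult: "laurent_of_poly (smult a p) = fls_const a * laurent_of_poly p"
  by (induction p) (simp_all add: laurent_of_poly_pCons algebra_simps fls_const_mult_const)

lemma laurent_of_poly_mult: "laurent_of_poly (p * q) = laurent_of_poly p * laurent_of_poly q"
  by (induction p)
    (simp_all add: laurent_of_poly_pCons laurent_of_poly_add laurent_of_poly_smult algebra_simps)

lemma laurent_of_poly_sum: "laurent_of_poly (sum f S) = (\<Sum>x\<in>S. laurent_of_poly (f x))"
  by (induction S rule: infinite_finite_induct) (simp_all add: laurent_of_poly_add)

lemma laurent_of_poly_prod: "laurent_of_poly (prod f S) = (\<Prod>x\<in>S. laurent_of_poly (f x))"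
  by (induction S rule: infinite_finite_induct) (simp_all add: laurent_of_poly_mult)

lemma laurent_of_poly_power: "laurent_of_poly (p ^ n) = laurent_of_poly p ^ n"
  by (induction n) (simp_all add: laurent_of_poly_mult)

lemma laurent_of_poly_X_power: "laurent_of_poly ([:0, 1:] ^ n) = fls_X_inv ^ n"
  by (simp add: laurent_of_poly_power laurent_of_poly_pCons)

lemma fls_nth_laurent_of_poly:
  "fls_nth (laurent_of_poly p) n = (if n \<le> 0 then coeff p (nat (- n)) else 0)"
proof (induction p arbitrary: n)
  case (pCons a p)
  have "nat (- n) = Suc (nat (- n - 1))" if "n < 0" using that by simp
  then show ?case using pCons.IH
    by (auto simp: laurent_of_poly_pCons fls_X_inv_times_conv_shift coeff_pCons split: nat.split)
qed simp

lemma laurent_of_poly_eq_0_iff [simp]: "laurent_of_poly p = 0 \<longleftrightarrow> p = 0"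
proof
  assume "laurent_of_poly p = 0"
  then have "coeff p n = 0" for n
    using fls_nth_laurent_of_poly[of p "- int n"] by simp
  then show "p = 0" by (simp add: poly_eq_iff)
qed simp

lemma fls_subdegree_laurent_of_poly: "fls_subdegree (laurent_of_poly p) = - int (degree p)"
proof (cases "p = 0")
  case False
  show ?thesis
    by (rule fls_subdegree_eqI) (use False in \<open>auto simp: fls_nth_laurent_of_poly coeff_eq_0\<close>)
qed simp

text \<open>One Laurent series per row: linear combinations of matrix rows become rational
  functions, to which degree and divisibility arguments apply.\<close>

definition sobol_row :: "bit poly \<Rightarrow> nat \<Rightarrow> bit fls" where
  "sobol_row p k =
     fls_X_inv ^ (degree p - (k - 1) mod degree p - 1) / laurent_of_poly p ^ ((k - 1) div degree p + 1)"

lemma sobol_matrix_eq_nth: "sobol_matrix p k l = fls_nth (sobol_row p k) (int l)"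
  by (simp add: sobol_matrix_def sobol_coeff_def sobol_row_def)

text \<open>The numerator has degree e - z - 1 and the denominator degree i e, so the order in 1/x
  is (i - 1) e + z + 1 = k. Hence the generating matrix is upper triangular with nonzero
  diagonal.\<close>

lemma sobol_row_subdegree:
  assumes "degree p \<ge> 1" "k \<ge> 1"
  shows "sobol_row p k \<noteq> 0" "fls_subdegree (sobol_row p k) = int k"
proof -
  let ?e = "degree p" and ?i = "(k - 1) div degree p" and ?z = "(k - 1) mod degree p"
  have p: "laurent_of_poly p \<noteq> 0" using assms by auto
  have X: "(fls_X_inv :: bit fls) \<noteq> 0" by simp
  show "sobol_row p k \<noteq> 0" using p X by (simp add: sobol_row_def)
  have z: "?z < ?e" using assms by simp
  have "fls_subdegree (sobol_row p k) = - int (?e - ?z - 1) + int ((?i + 1) * ?e)"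
    using p X by (simp add: sobol_row_def fls_divide_subdegree fls_subdegree_pow
        fls_subdegree_laurent_of_poly algebra_simps del: power_Suc)
  also have "int (?e - ?z - 1) = int ?e - int ?z - 1" using z by linarith
  also have "- (int ?e - int ?z - 1) + int ((?i + 1) * ?e) = int (?i * ?e + ?z + 1)"
    unfolding of_nat_add of_nat_mult by (simp add: algebra_simps del: One_nat_def)
  also have "?i * ?e + ?z + 1 = k" using assms by simp
  finally show "fls_subdegree (sobol_row p k) = int k" .
qed

lemma sobol_matrix_upper_triangular:
  assumes "degree p \<ge> 1" "l < k"
  shows "sobol_matrix p k l = 0"
  using assms sobol_row_subdegree[of p k]
  by (simp add: sobol_matrix_eq_nth)

lemma fls_nth_sum: "fls_nth (sum f S) n = (\<Sum>x\<in>S. fls_nth (f x) n)"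
  by (induction S rule: infinite_finite_induct) simp_all

text \<open>The orders of the rows are pairwise distinct, so nothing cancels the leading coefficient
  of row \<open>Min K\<close>.\<close>

lemma sum_sobol_row_nonzero:
  assumes "degree p \<ge> 1" "finite K" "K \<noteq> {}" "K \<subseteq> {1..}"
  shows "(\<Sum>k\<in>K. sobol_row p k) \<noteq> 0"
proof -
  let ?k = "Min K"
  have k: "?k \<in> K" using assms by simp
  have "fls_nth (\<Sum>k\<in>K. sobol_row p k) (int ?k) = (\<Sum>k\<in>K. sobol_matrix p k ?k)"
    by (simp add: fls_nth_sum sobol_matrix_eq_nth)
  also have "\<dots> = sobol_matrix p ?k ?k + (\<Sum>k\<in>K-{?k}. sobol_matrix p k ?k)"
    using assms(2) k by (rule sum.remove)
  also have "(\<Sum>k\<in>K-{?k}. sobol_matrix p k ?k) = 0"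
  proof (rule sum.neutral, rule ballI)
    fix k assume "k \<in> K - {?k}"
    then have "?k < k" using assms by (metis DiffD1 DiffD2 Min_le insertI1 le_neq_implies_less)
    then show "sobol_matrix p k ?k = 0" using assms by (simp add: sobol_matrix_upper_triangular)
  qed
  finally have "fls_nth (\<Sum>k\<in>K. sobol_row p k) (int ?k) = sobol_matrix p ?k ?k" by simp
  moreover have "sobol_matrix p ?k ?k \<noteq> 0"
  proof -
    have "?k \<ge> 1" using k assms by auto
    then show ?thesis
      using sobol_row_subdegree[OF assms(1), of ?k] nth_fls_subdegree_nonzero
      by (metis sobol_matrix_eq_nth)
  qed
  ultimately show ?thesis by auto
qed


section \<open>Irreducible polynomials over F_2 and independence of rows\<close>

lemma irreducible_bit_poly_degree: "irreducible (p :: bit poly) \<Longrightarrow> degree p \<ge> 1"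
  by (metis One_nat_def Suc_leI gr0I irreducible_def is_unit_iff_degree)

text \<open>The only unit is 1, so associated polynomials coincide.\<close>

lemma irreducible_bit_poly_dvd_imp_eq:
  fixes p q :: "bit poly"
  assumes "irreducible p" "irreducible q" "p dvd q"
  shows "p = q"
proof -
  obtain c where c: "q = p * c" using assms by blast
  with assms have "is_unit c" by (meson irreducible_def)
  then obtain a where "c = [:a:]" "a \<noteq> 0"
    by (metis is_unit_poly_iff not_is_unit_0)
  then have "c = 1" by (simp add: one_pCons)
  with c show ?thesis by simp
qed

lemma prime_elem_dvd_prodD:
  assumes "prime_elem p" "finite S" "p dvd (\<Prod>x\<in>S. f x)"
  shows "\<exists>x\<in>S. p dvd f x"
  using assms(2,3)
proof (induction S)
  case empty
  then show ?case using assms(1) by (simp add: prime_elem_def)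
qed (use assms(1) in \<open>auto simp: prime_elem_dvd_mult_iff\<close>)

text \<open>Over the common denominator \<open>\<Prod>j. p j ^ I j\<close> a sum of rows has a nonzero numerator by partial
  fractions, so its order in \<open>x\<^sup>-\<^sup>1\<close> is at most the degree of the denominator.\<close>

theorem sobol_rows_independent:
  fixes p :: "'i \<Rightarrow> bit poly"
  assumes "finite J" and irr: "\<And>j. j \<in> J \<Longrightarrow> irreducible (p j)" and inj: "inj_on p J"
    and K: "\<And>j. j \<in> J \<Longrightarrow> K j \<subseteq> {1..d j}" and ne: "j0 \<in> J" "K j0 \<noteq> {}"
  shows "\<exists>l\<in>{1..(\<Sum>j\<in>J. d j + degree (p j) - 1)}. (\<Sum>j\<in>J. \<Sum>k\<in>K j. sobol_matrix (p j) k l) \<noteq> 0"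
proof -
  define e where "e = (\<lambda>j. degree (p j))"
  \<comment> \<open>\<open>I j\<close> is \<open>d j / e j\<close> rounded up, a bound for the
    powers of \<open>p j\<close> in the denominators of its first \<open>d j\<close> rows. The
    rounding costs at most \<open>e j - 1\<close>.\<close>
  define I where "I = (\<lambda>j. (d j + e j - 1) div e j)"
  \<comment> \<open>Numerator of the selected rows of \<open>p j\<close> over the denominator
    \<open>p j ^ I j\<close>.\<close>
  define A where "A = (\<lambda>j. \<Sum>k\<in>K j. [:0, 1:] ^ (e j - (k - 1) mod e j - 1) * p j ^ (I j - ((k - 1) div e j + 1)))"
  define Num where "Num = (\<Sum>j\<in>J. A j * (\<Prod>l\<in>J-{j}. p l ^ I l))"
  define G where "G = (\<Sum>j\<in>J. \<Sum>k\<in>K j. sobol_row (p j) k)"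
  define L where "L = laurent_of_poly"
  have e1: "e j \<ge> 1" if "j \<in> J" for j
    using irreducible_bit_poly_degree[OF irr[OF that]] by (simp add: e_def)
  have p0: "p j \<noteq> 0" if "j \<in> J" for j using irr[OF that] by auto
  have finK: "finite (K j)" if "j \<in> J" for j using K[OF that] finite_subset by blast
  have iI: "(k - 1) div e j + 1 \<le> I j" if "j \<in> J" "k \<in> K j" for j k
  proof -
    have "(k - 1) div e j + 1 = (k - 1 + e j) div e j" using e1[OF that(1)] by simp
    also have "\<dots> \<le> (d j + e j - 1) div e j"
      using subsetD[OF K[OF that(1)] that(2)] by (intro div_le_mono) auto
    finally show ?thesis by (simp add: I_def)
  qed
  have LA: "L (A j) = (\<Sum>k\<in>K j. sobol_row (p j) k) * L (p j) ^ I j" if j: "j \<in> J" for j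
  proof -
    have "L ([:0, 1:] ^ (e j - (k - 1) mod e j - 1) * p j ^ (I j - ((k - 1) div e j + 1)))
       = sobol_row (p j) k * L (p j) ^ I j" if k: "k \<in> K j" for k
    proof -
      have "L (p j) ^ I j = L (p j) ^ (I j - ((k - 1) div e j + 1)) * L (p j) ^ ((k - 1) div e j + 1)"
        using iI[OF j k] by (metis le_add_diff_inverse2 power_add)
      moreover have "L (p j) \<noteq> 0" using p0[OF j] by (simp add: L_def)
      ultimately show ?thesis
        unfolding sobol_row_def L_def laurent_of_poly_mult laurent_of_poly_X_power laurent_of_poly_power
        by (simp add: e_def laurent_of_poly_pCons)
    qed
    then show ?thesis
      unfolding A_def by (simp add: L_def laurent_of_poly_sum sum_distrib_right)
  qed
  have A0: "A j \<noteq> 0" if "j \<in> J" "K j \<noteq> {}" for j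
  proof -
    have "(\<Sum>k\<in>K j. sobol_row (p j) k) \<noteq> 0"
      using K[OF that(1)] finK[OF that(1)] that e1[OF that(1)]
      by (intro sum_sobol_row_nonzero) (auto simp: e_def)
    then have "L (A j) \<noteq> 0" using LA[OF that(1)] p0[OF that(1)] by (simp add: L_def)
    then show ?thesis by (auto simp: L_def)
  qed
  have degA: "degree (A j) < e j * I j" if j: "j \<in> J" "K j \<noteq> {}" for j
    unfolding A_def
  proof (rule degree_sum_less)
    obtain k where "k \<in> K j" using j by blast
    then have "I j \<ge> 1" using iI[OF j(1), of k] by linarith
    then show "0 < e j * I j" using e1[OF j(1)] by simp
    fix k assume k: "k \<in> K j"
    let ?i = "(k - 1) div e j" and ?z = "(k - 1) mod e j"
    have z: "?z < e j" using e1[OF j(1)] by simp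
    have "degree ([:0, 1:] ^ (e j - ?z - 1) * p j ^ (I j - (?i + 1)))
       \<le> degree ([:0, 1:] ^ (e j - ?z - 1) :: bit poly) + degree (p j ^ (I j - (?i + 1)))"
      by (rule degree_mult_le)
    also have "\<dots> = (e j - ?z - 1) + (I j - (?i + 1)) * e j"
      using p0[OF j(1)] by (simp add: degree_power_eq e_def)
    also have "\<dots> < e j + (I j - (?i + 1)) * e j" using z by linarith
    also have "\<dots> = (I j - ?i) * e j" using iI[OF j(1) k]
      by (metis Suc_diff_Suc Suc_eq_plus1 Suc_le_lessD mult_Suc)
    also have "\<dots> \<le> e j * I j" by simp
    finally show "degree ([:0, 1:] ^ (e j - ?z - 1) * p j ^ (I j - (?i + 1))) < e j * I j" .
  qed
  \<comment> \<open>Modulo \<open>p j0 ^ I j0\<close> only the term of \<open>j0\<close> remains,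
    and its cofactor is prime to \<open>p j0\<close>. So the full power would divide
    \<open>A j0\<close>, whose degree is too small.\<close>
  have "Num \<noteq> 0"
  proof
    assume N0: "Num = 0"
    have pr: "prime_elem (p j0)" using irr[OF ne(1)] by (rule field_poly_irreducible_imp_prime)
    have D: "p j0 ^ I j0 dvd (\<Sum>j\<in>J-{j0}. A j * (\<Prod>l\<in>J-{j}. p l ^ I l))"
    proof (rule dvd_sum)
      fix j assume "j \<in> J - {j0}"
      then have "p j0 ^ I j0 dvd (\<Prod>l\<in>J-{j}. p l ^ I l)"
        using \<open>finite J\<close> ne by (intro dvd_prodI) auto
      then show "p j0 ^ I j0 dvd A j * (\<Prod>l\<in>J-{j}. p l ^ I l)" by (rule dvd_mult)
    qed
    have E: "Num = A j0 * (\<Prod>l\<in>J-{j0}. p l ^ I l) + (\<Sum>j\<in>J-{j0}. A j * (\<Prod>l\<in>J-{j}. p l ^ I l))"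
      unfolding Num_def using \<open>finite J\<close> ne(1) by (rule sum.remove)
    have "p j0 ^ I j0 dvd A j0 * (\<Prod>l\<in>J-{j0}. p l ^ I l)"
    proof -
      have "p j0 ^ I j0 dvd A j0 * (\<Prod>l\<in>J-{j0}. p l ^ I l) + (\<Sum>j\<in>J-{j0}. A j * (\<Prod>l\<in>J-{j}. p l ^ I l))"
        unfolding E[symmetric] N0 by (rule dvd_0_right)
      then show ?thesis using dvd_add_left_iff[OF D] by blast
    qed
    then consider "p j0 ^ I j0 dvd A j0" | "p j0 dvd (\<Prod>l\<in>J-{j0}. p l ^ I l)"
      using prime_elem_power_dvd_cases[OF _ _ pr, of "I j0" "A j0" _ "I j0" 1] by (auto simp del: power_Suc)
    then show False
    proof cases
      case 1
      then have "degree (p j0 ^ I j0) \<le> degree (A j0)"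
        using A0 ne by (intro dvd_imp_degree_le) auto
      then show False using degA[OF ne] p0[OF ne(1)] by (simp add: degree_power_eq e_def mult.commute)
    next
      case 2
      then obtain l where l: "l \<in> J - {j0}" "p j0 dvd p l ^ I l"
        using prime_elem_dvd_prodD[OF pr, of "J - {j0}" "\<lambda>l. p l ^ I l"] \<open>finite J\<close> by auto
      then have "p j0 dvd p l" using pr prime_elem_dvd_power by blast
      then have "p j0 = p l" using irr ne l irreducible_bit_poly_dvd_imp_eq by blast
      then show False using inj ne l by (auto dest: inj_onD)
    qed
  qed
  have "G * L (\<Prod>l\<in>J. p l ^ I l) = L Num"
  proof -
    have "L Num = (\<Sum>j\<in>J. L (A j) * (\<Prod>l\<in>J-{j}. L (p l) ^ I l))"
      by (simp add: Num_def L_def laurent_of_poly_sum laurent_of_poly_mult laurent_of_poly_prod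
          laurent_of_poly_power)
    also have "\<dots> = (\<Sum>j\<in>J. (\<Sum>k\<in>K j. sobol_row (p j) k) * (\<Prod>l\<in>J. L (p l) ^ I l))"
    proof (rule sum.cong[OF refl])
      fix j assume j: "j \<in> J"
      show "L (A j) * (\<Prod>l\<in>J-{j}. L (p l) ^ I l)
          = (\<Sum>k\<in>K j. sobol_row (p j) k) * (\<Prod>l\<in>J. L (p l) ^ I l)"
        unfolding LA[OF j] prod.remove[OF \<open>finite J\<close> j] by (rule mult.assoc)
    qed
    finally show ?thesis
      by (simp add: G_def L_def sum_distrib_right laurent_of_poly_prod laurent_of_poly_power)
  qed
  moreover have Pi0: "(\<Prod>l\<in>J. p l ^ I l) \<noteq> 0" using p0 \<open>finite J\<close> by simp
  ultimately have G0: "G \<noteq> 0"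
    and sub: "fls_subdegree G + - int (degree (\<Prod>l\<in>J. p l ^ I l)) = - int (degree Num)"
  proof -
    assume a: "G * L (\<Prod>l\<in>J. p l ^ I l) = L Num"
    show G0: "G \<noteq> 0" using a \<open>Num \<noteq> 0\<close> by (auto simp: L_def)
    have "fls_subdegree (G * L (\<Prod>l\<in>J. p l ^ I l)) = fls_subdegree G + fls_subdegree (L (\<Prod>l\<in>J. p l ^ I l))"
      using G0 Pi0 by (intro fls_subdegree_mult) (auto simp: L_def)
    with a show "fls_subdegree G + - int (degree (\<Prod>l\<in>J. p l ^ I l)) = - int (degree Num)"
      by (simp add: L_def fls_subdegree_laurent_of_poly)
  qed
  have "degree (\<Prod>l\<in>J. p l ^ I l) = (\<Sum>l\<in>J. I l * e l)"
    using p0 by (subst degree_prod_eq_sum_degree) (auto simp: degree_power_eq e_def)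
  also have "\<dots> \<le> (\<Sum>j\<in>J. d j + e j - 1)"
    by (intro sum_mono) (simp add: I_def)
  finally have le: "fls_subdegree G \<le> int (\<Sum>j\<in>J. d j + e j - 1)" using sub by linarith
  have nth0: "fls_nth G (fls_subdegree G) \<noteq> 0" using G0 by (rule nth_fls_subdegree_nonzero)
  \<comment> \<open>Every row starts at a positive power of 1/x, so the leading index of
    \<open>G\<close> is an actual column.\<close>
  have ge: "fls_subdegree G \<ge> 1"
  proof (rule ccontr)
    assume neg: "\<not> fls_subdegree G \<ge> 1"
    have "fls_nth (sobol_row (p j) k) (fls_subdegree G) = 0" if "j \<in> J" "k \<in> K j" for j k
    proof (rule fls_eq0_below_subdegree)
      have "k \<ge> 1" using K that by force
      then show "fls_subdegree G < fls_subdegree (sobol_row (p j) k)"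
        using neg sobol_row_subdegree[of "p j" k] e1[OF that(1)] by (simp add: e_def)
    qed
    then show False using nth0 by (simp add: G_def fls_nth_sum)
  qed
  show ?thesis
  proof (rule bexI)
    show "nat (fls_subdegree G) \<in> {1..(\<Sum>j\<in>J. d j + degree (p j) - 1)}"
      using ge le unfolding e_def atLeastAtMost_iff by linarith
    show "(\<Sum>j\<in>J. \<Sum>k\<in>K j. sobol_matrix (p j) k (nat (fls_subdegree G))) \<noteq> 0"
      using nth0 ge by (simp add: G_def fls_nth_sum sobol_matrix_eq_nth)
  qed
qed

section \<open>Haar and Walsh functions\<close>

text \<open>
  Digits are counted from the most significant of \<open>M\<close> binary digits, so \<open>psi M u\<close> is the sign of the
  digit \<open>u\<close>. Below, \<open>haar M b x\<close> is the Haar component of level \<open>b\<close> of \<open>k \<mapsto> [x \<le> k]\<close>: the mean for \<open>b = 0\<close>,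
  where the prefix length \<open>b - 1\<close> truncates to 0, and for \<open>b > 0\<close> a function supported on the numbers
  that share the first \<open>b - 1\<close> digits of \<open>x\<close>.
\<close>

definition psi :: "nat \<Rightarrow> nat \<Rightarrow> nat \<Rightarrow> real" where
  "psi M u x = (if odd (x div 2 ^ (M - u)) then - 1 else 1)"

definition walsh :: "nat \<Rightarrow> nat set \<Rightarrow> nat \<Rightarrow> real" where
  "walsh M F x = (\<Prod>u\<in>F. psi M u x)"

definition haar_weight :: "nat \<Rightarrow> nat \<Rightarrow> nat \<Rightarrow> real" where
  "haar_weight M b x =
     (if b = 0 then 1 - x / 2 ^ M
      else let y = real (x mod 2 ^ (M - b)) / 2 ^ (M - b)
           in if even (x div 2 ^ (M - b)) then y / 2 else (1 - y) / 2)"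

definition same_prefix :: "nat \<Rightarrow> nat \<Rightarrow> nat \<Rightarrow> nat \<Rightarrow> real" where
  "same_prefix M a x k = of_bool (x div 2 ^ (M - a) = k div 2 ^ (M - a))"

definition haar_sign :: "nat \<Rightarrow> nat \<Rightarrow> nat \<Rightarrow> real" where
  "haar_sign M b k = (if b = 0 then 1 else - psi M b k)"

definition haar :: "nat \<Rightarrow> nat \<Rightarrow> nat \<Rightarrow> nat \<Rightarrow> real" where
  "haar M b x k = same_prefix M (b - 1) x k * haar_sign M b k * haar_weight M b x"

lemma psi_sq [simp]: "psi M u x * psi M u x = 1"
  by (simp add: psi_def)

lemma abs_psi [simp]: "\<bar>psi M u x\<bar> = 1"
  by (simp add: psi_def)

lemma walsh_empty [simp]: "walsh M {} x = 1"
  by (simp add: walsh_def)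

lemma abs_walsh [simp]: "\<bar>walsh M F x\<bar> = 1"
  by (simp add: walsh_def abs_prod)

lemma abs_haar_sign [simp]: "\<bar>haar_sign M b k\<bar> = 1"
  by (simp add: haar_sign_def)

lemma walsh_mult:
  assumes "finite F" "finite G"
  shows "walsh M F x * walsh M G x = walsh M ((F - G) \<union> (G - F)) x"
proof -
  have F: "walsh M F x = walsh M (F \<inter> G) x * walsh M (F - G) x"
    unfolding walsh_def using assms(1) by (rule prod.Int_Diff)
  have G: "walsh M G x = walsh M (F \<inter> G) x * walsh M (G - F) x"
    unfolding walsh_def Int_commute[of F] using assms(2) by (rule prod.Int_Diff)
  have "walsh M (F \<inter> G) x * walsh M (F \<inter> G) x = 1"
    by (simp add: walsh_def flip: prod.distrib)
  moreover have "walsh M ((F - G) \<union> (G - F)) x = walsh M (F - G) x * walsh M (G - F) x"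
    unfolding walsh_def using assms by (intro prod.union_disjoint) auto
  ultimately show ?thesis unfolding F G by (simp add: mult_ac flip: mult.assoc)
qed

text \<open>Telescoping over the averages of \<open>k \<mapsto> [x \<le> k]\<close> over dyadic intervals.\<close>

lemma sum_haar:
  assumes "x < 2 ^ M" "k < 2 ^ M"
  shows "(\<Sum>b\<le>M. haar M b x k) = of_bool (x \<le> k)"
proof -
  \<comment> \<open>\<open>E a\<close> is the mean of k' -> [x <= k'] over the dyadic interval of
    length \<open>2 ^ (M - a)\<close> that contains \<open>k\<close>. So \<open>E M\<close> is the
    indicator itself and \<open>E 0\<close> its overall mean.\<close>
  define E :: "nat \<Rightarrow> real" where
    "E = (\<lambda>a. if x div 2 ^ (M - a) < k div 2 ^ (M - a) then 1
              else if x div 2 ^ (M - a) > k div 2 ^ (M - a) then 0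
              else 1 - real (x mod 2 ^ (M - a)) / 2 ^ (M - a))"
  have step: "haar M (Suc a) x k = E (Suc a) - E a" if "a < M" for a
  proof -
    define L where "L = M - Suc a"
    have L: "M - a = Suc L" "M - Suc a = L" using that by (auto simp: L_def)
    define X K where "X = x div 2 ^ L" and "K = k div 2 ^ L"
    define r where "r = real (x mod 2 ^ L) / 2 ^ L"
    have XX: "x div 2 ^ Suc L = X div 2" "k div 2 ^ Suc L = K div 2"
      by (simp_all only: X_def K_def div_mult2_eq power_Suc2)
    have "x mod 2 ^ Suc L = 2 ^ L * (X mod 2) + x mod 2 ^ L"
      unfolding X_def power_Suc2 by (rule mod_mult2_eq)
    then have rr: "real (x mod 2 ^ Suc L) / 2 ^ Suc L = (real (X mod 2) + r) / 2"
      by (simp add: r_def field_simps)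
    have Ea: "E a = (if X div 2 < K div 2 then 1 else if X div 2 > K div 2 then 0
        else 1 - (real (X mod 2) + r) / 2)"
      unfolding E_def L XX rr ..
    have ESa: "E (Suc a) = (if X < K then 1 else if X > K then 0 else 1 - r)"
      by (simp add: E_def L X_def K_def r_def)
    have hw: "haar M (Suc a) x k = of_bool (X div 2 = K div 2) *
        (if odd K then 1 else - 1) * (if even X then r / 2 else (1 - r) / 2)"
      by (simp add: haar_def same_prefix_def haar_sign_def psi_def haar_weight_def L XX r_def
          Let_def del: power_Suc flip: X_def K_def)
    consider "X div 2 < K div 2" | "X div 2 > K div 2" | "X div 2 = K div 2" "even X = even K"
      | "X div 2 = K div 2" "even X" "odd K" | "X div 2 = K div 2" "odd X" "even K"
      by linarith
    then show ?thesis
    proof cases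
      case 1
      then have "X < K" by (metis div_le_mono leD leI)
      then show ?thesis using 1 by (simp add: Ea ESa hw)
    next
      case 2
      then have "K < X" by (metis div_le_mono leD leI)
      then show ?thesis using 2 by (simp add: Ea ESa hw)
    next
      case 3
      then have "X = K" by (metis bit_eq_rec)
      then show ?thesis by (cases "even K") (simp_all add: Ea ESa hw field_simps mod_2_eq_odd)
    next
      case 4
      then have "X < K" by presburger
      then show ?thesis using 4 by (simp add: Ea ESa hw field_simps mod_2_eq_odd)
    next
      case 5
      then have "K < X" by presburger
      then show ?thesis using 5 by (simp add: Ea ESa hw field_simps mod_2_eq_odd)
    qed
  qed
  have "(\<Sum>b\<le>M. haar M b x k) = haar M 0 x k + (\<Sum>a<M. haar M (Suc a) x k)"
    by (rule sum.atMost_shift)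
  also have "(\<Sum>a<M. haar M (Suc a) x k) = (\<Sum>a<M. E (Suc a) - E a)"
    by (intro sum.cong) (auto simp: step)
  also have "\<dots> = E M - E 0" by (rule sum_lessThan_telescope)
  also have "haar M 0 x k = E 0"
    using assms by (simp add: haar_def same_prefix_def haar_sign_def haar_weight_def E_def)
  also have "E 0 + (E M - E 0) = of_bool (x \<le> k)" by (simp add: E_def)
  finally show ?thesis .
qed

text \<open>Flipping the digit \<open>u\<close> preserves all shorter prefixes.\<close>

lemma sum_psi_flip:
  assumes "1 \<le> u" "u \<le> M" and f: "\<And>k k'. k div 2 ^ Suc (M - u) = k' div 2 ^ Suc (M - u) \<Longrightarrow> f k = f k'"
  shows "(\<Sum>k<2 ^ M. f k * psi M u k) = 0"
proof -
  let ?t = "\<lambda>k::nat. flip_bit (M - u) k"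
  have lt: "?t k < 2 ^ M" if "k < 2 ^ M" for k
  proof -
    have "take_bit M (?t k) = ?t k"
      using that assms take_bit_nat_eq_self_iff[of M k] by (auto simp: take_bit_flip_bit_eq)
    then show ?thesis by (simp add: take_bit_nat_eq_self_iff)
  qed
  have invol: "?t (?t k) = k" for k by (rule bit_eqI) (auto simp: bit_flip_bit_iff)
  have psi: "psi M u (?t k) = - psi M u k" for k
    by (simp add: psi_def bit_iff_odd[symmetric] bit_flip_bit_iff)
  have "?t k div 2 ^ Suc (M - u) = k div 2 ^ Suc (M - u)" for k
    unfolding drop_bit_eq_div[symmetric]
    by (rule bit_eqI) (auto simp: bit_drop_bit_eq bit_flip_bit_iff)
  then have ff: "f (?t k) = f k" for k by (rule f)
  have "(\<Sum>k<2 ^ M. f k * psi M u k) = (\<Sum>k<2 ^ M. f (?t k) * psi M u (?t k))"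
    by (rule sum.reindex_bij_witness[of _ ?t ?t]) (auto simp: invol lt)
  also have "\<dots> = - (\<Sum>k<2 ^ M. f k * psi M u k)"
    by (simp add: ff psi sum_negf)
  finally show ?thesis by simp
qed

lemma div_power2_eq_mono:
  fixes k k' :: nat
  assumes "k div 2 ^ e = k' div 2 ^ e" "e \<le> e'"
  shows "k div 2 ^ e' = k' div 2 ^ e'"
proof -
  have "2 ^ e' = 2 ^ e * (2 ^ (e' - e) :: nat)" using assms(2) by (simp flip: power_add)
  then show ?thesis using assms(1) by (simp add: div_mult2_eq)
qed

lemma psi_cong:
  assumes "k div 2 ^ e = k' div 2 ^ e" "e \<le> M - u"
  shows "psi M u k = psi M u k'"
  using div_power2_eq_mono[OF assms] by (simp add: psi_def)

text \<open>For b < b' everything except the sign of digit b' is determined by the digits of k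
  before b', so flipping that digit reverses the sign of the product. This works for different
  points x and x'.\<close>

lemma haar_orthogonal:
  assumes "b \<le> M" "b' \<le> M" "b \<noteq> b'"
  shows "(\<Sum>k<2 ^ M. haar M b x k * haar M b' x' k) = 0"
proof -
  have *: "(\<Sum>k<2 ^ M. haar M b x k * haar M b' x' k) = 0" if "b < b'" "b' \<le> M" for b b' x x'
  proof -
    define f where "f = (\<lambda>k. - haar M b x k * same_prefix M (b' - 1) x' k * haar_weight M b' x')"
    have "(\<Sum>k<2 ^ M. haar M b x k * haar M b' x' k) = (\<Sum>k<2 ^ M. f k * psi M b' k)"
      using that by (intro sum.cong) (auto simp: f_def haar_def[of M b'] haar_sign_def)
    also have "\<dots> = 0"
    proof (rule sum_psi_flip)
      fix k k' :: nat assume k: "k div 2 ^ Suc (M - b') = k' div 2 ^ Suc (M - b')"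
      have "same_prefix M a y k = same_prefix M a y k'" if "a \<le> b' - 1" for a y
        using div_power2_eq_mono[OF k, of "M - a"] that \<open>b < b'\<close> \<open>b' \<le> M\<close>
        by (simp add: same_prefix_def)
      moreover have "haar_sign M b k = haar_sign M b k'"
        using psi_cong[OF k, of M b] that by (simp add: haar_sign_def)
      ultimately show "f k = f k'"
        using that by (simp add: f_def haar_def)
    qed (use that in auto)
    finally show ?thesis .
  qed
  show ?thesis
  proof (cases "b < b'")
    case False
    then have "(\<Sum>k<2 ^ M. haar M b' x' k * haar M b x k) = 0"
      using assms by (intro *) auto
    then show ?thesis by (simp add: mult.commute)
  qed (use assms * in auto)
qed

section \<open>Walsh expansions of prefix indicators and Haar weights\<close>

lemma same_prefix_Suc:
  assumes "a < M"
  shows "same_prefix M (Suc a) x k = same_prefix M a x k * ((1 + psi M (Suc a) x * psi M (Suc a) k) / 2)"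
proof -
  define L where "L = M - Suc a"
  have L: "M - a = Suc L" "M - Suc a = L" using assms by (auto simp: L_def)
  define X K where "X = x div 2 ^ L" and "K = k div 2 ^ L"
  have XX: "x div 2 ^ Suc L = X div 2" "k div 2 ^ Suc L = K div 2"
    by (simp_all only: X_def K_def div_mult2_eq power_Suc2)
  have "X = K \<longleftrightarrow> X div 2 = K div 2 \<and> (odd X \<longleftrightarrow> odd K)"
    by (metis bit_eq_rec)
  then show ?thesis
    unfolding same_prefix_def psi_def L XX by (simp flip: X_def K_def)
qed

text \<open>Agreement in digit u is \<open>(1 + psi M u x * psi M u k) / 2\<close>; multiplying out
  over u <= a yields one Walsh function per subset.\<close>

lemma same_prefix_walsh:
  assumes "a \<le> M" "x < 2 ^ M" "k < 2 ^ M"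
  shows "same_prefix M a x k = (\<Sum>F\<in>Pow {1..a}. walsh M F x * (walsh M F k / 2 ^ a))"
proof -
  have "same_prefix M a x k = (\<Prod>u\<in>{1..a}. (1 + psi M u x * psi M u k) / 2)" using assms(1)
  proof (induction a)
    case 0
    then show ?case using assms by (simp add: same_prefix_def)
  next
    case (Suc a)
    then show ?case by (simp add: same_prefix_Suc)
  qed
  also have "\<dots> = (\<Prod>u\<in>{1..a}. psi M u x * psi M u k + 1) / 2 ^ a"
    by (simp add: prod_dividef add.commute)
  also have "(\<Prod>u\<in>{1..a}. psi M u x * psi M u k + 1) = (\<Sum>F\<in>Pow {1..a}. walsh M F x * walsh M F k)"
    by (simp add: prod_add walsh_def prod.distrib)
  finally show ?thesis by (simp add: sum_divide_distrib)
qed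

text \<open>The least significant digit in F, at position \<open>Max F\<close>, can be flipped
  without affecting the others.\<close>

lemma sum_walsh:
  assumes "F \<subseteq> {1..M}" "F \<noteq> {}"
  shows "(\<Sum>x<2 ^ M. walsh M F x) = 0"
proof -
  define u where "u = Max F"
  have fin: "finite F" using assms finite_subset by blast
  have u: "u \<in> F" "\<And>v. v \<in> F \<Longrightarrow> v \<le> u" using assms fin by (auto simp: u_def)
  have "(\<Sum>x<2 ^ M. walsh M F x) = (\<Sum>x<2 ^ M. walsh M (F - {u}) x * psi M u x)"
    using fin u by (simp add: walsh_def prod.remove mult.commute)
  also have "\<dots> = 0"
  proof (rule sum_psi_flip)
    fix k k' :: nat assume k: "k div 2 ^ Suc (M - u) = k' div 2 ^ Suc (M - u)"
    show "walsh M (F - {u}) k = walsh M (F - {u}) k'"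
      unfolding walsh_def
    proof (rule prod.cong[OF refl])
      fix v assume "v \<in> F - {u}"
      then have "v < u" "u \<le> M" using u assms by (auto simp: le_neq_implies_less)
      then show "psi M v k = psi M v k'" by (intro psi_cong[OF k]) auto
    qed
  qed (use u assms in auto)
  finally show ?thesis .
qed

lemma sum_same_prefix:
  assumes "a \<le> M" "k < 2 ^ M"
  shows "(\<Sum>x<2 ^ M. same_prefix M a x k) = 2 ^ M / 2 ^ a"
proof -
  have "(\<Sum>x<2 ^ M. same_prefix M a x k) = (\<Sum>x<2^M. \<Sum>F\<in>Pow {1..a}. walsh M F x * (walsh M F k / 2 ^ a))"
    using assms by (intro sum.cong) (auto simp: same_prefix_walsh)
  also have "\<dots> = (\<Sum>F\<in>Pow {1..a}. (\<Sum>x<2^M. walsh M F x) * (walsh M F k / 2 ^ a))"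
    by (subst sum.swap) (simp only: sum_distrib_right)
  also have "\<dots> = (\<Sum>F\<in>{{}}. (\<Sum>x<2^M. walsh M F x) * (walsh M F k / 2 ^ a))"
  proof (rule sum.mono_neutral_right)
    show "\<forall>F\<in>Pow {1..a} - {{}}. (\<Sum>x<2 ^ M. walsh M F x) * (walsh M F k / 2 ^ a) = 0"
    proof
      fix F assume "F \<in> Pow {1..a} - {{}}"
      then have "F \<subseteq> {1..M}" "F \<noteq> {}" using assms by auto
      then show "(\<Sum>x<2 ^ M. walsh M F x) * (walsh M F k / 2 ^ a) = 0" by (simp add: sum_walsh)
    qed
  qed auto
  finally show ?thesis by simp
qed

lemma same_prefix_commute: "same_prefix M a x k = same_prefix M a k x"
  by (auto simp: same_prefix_def)

lemma same_prefix_nonneg [simp]: "same_prefix M a x k \<ge> 0"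
  by (simp add: same_prefix_def)

lemma same_prefix_mono: "a \<le> a' \<Longrightarrow> same_prefix M a' x k \<le> same_prefix M a x k"
  using div_power2_eq_mono[of x "M - a'" k "M - a"] by (auto simp: same_prefix_def)

lemma haar_weight_bounds:
  assumes "x < 2 ^ M"
  shows "0 \<le> haar_weight M b x" "haar_weight M b x \<le> 1"
proof -
  define y where "y = real (x mod 2 ^ (M - b)) / 2 ^ (M - b)"
  have "real (x mod 2 ^ (M - b)) < 2 ^ (M - b)"
    by (metis mod_less_divisor of_nat_less_numeral_power_cancel_iff pos2 zero_less_power)
  then have "0 \<le> y" "y \<le> 1" by (simp_all add: y_def del: of_nat_mod)
  moreover have "real x < 2 ^ M" using assms by (metis of_nat_less_numeral_power_cancel_iff)
  ultimately show "0 \<le> haar_weight M b x" "haar_weight M b x \<le> 1"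
    by (auto simp: haar_weight_def Let_def simp flip: y_def)
qed

text \<open>The digits of \<open>x\<close> satisfy \<open>\<xi> = (1 - psi) / 2\<close>.\<close>

lemma mod_power2_psi:
  assumes "L \<le> M"
  shows "real (x mod 2 ^ L) / 2 ^ L =
    1 / 2 - (1 / 2) * (\<Sum>c=1..L. (1 / 2) ^ c * psi M (M - L + c) x) - (1 / 2) * (1 / 2) ^ L"
proof -
  have *: "real (x mod 2 ^ L) = (2 ^ L - 1 - (\<Sum>e<L. 2 ^ e * psi M (M - e) x)) / 2" using assms
  proof (induction L)
    case (Suc L)
    have "x mod 2 ^ Suc L = 2 ^ L * (x div 2 ^ L mod 2) + x mod 2 ^ L"
      unfolding power_Suc2 by (rule mod_mult2_eq)
    moreover have "real (x div 2 ^ L mod 2) = (1 - psi M (M - L) x) / 2"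
      using Suc.prems by (simp add: psi_def odd_iff_mod_2_eq_one)
    ultimately have "real (x mod 2 ^ Suc L) = 2 ^ L * ((1 - psi M (M - L) x) / 2) + real (x mod 2 ^ L)"
      by simp
    then show ?case using Suc by (simp add: field_simps)
  qed simp
  have "(\<Sum>c=1..L. (1 / 2) ^ c * psi M (M - L + c) x) = (\<Sum>e<L. (1 / 2) ^ (L - e) * psi M (M - e) x)"
    by (rule sum.reindex_bij_witness[of _ "\<lambda>e. L - e" "\<lambda>c. L - c"]) (use assms in auto)
  also have "\<dots> = (\<Sum>e<L. 2 ^ e * psi M (M - e) x) / 2 ^ L"
    by (simp add: sum_divide_distrib power_diff field_simps power_one_over)
  finally show ?thesis unfolding * by (simp add: field_simps power_one_over)
qed

text \<open>The weight is affine in the fractional part behind digit b, with a slope whose sign is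
  governed by digit b. Expanding the fractional part pairs b with a single later digit b + c at a
  time; this sparsity is what the interlacing exploits.\<close>

lemma haar_weight_walsh:
  assumes "b \<le> M"
  obtains coef :: "nat \<Rightarrow> real" and Fr :: "nat \<Rightarrow> nat set" where
    "\<And>c. \<bar>coef c\<bar> \<le> (1 / 2) ^ c"
    "\<And>c. Fr c \<subseteq> {1..M} \<inter> ({1..b} \<union> {b + c})"
    "\<And>x. x < 2 ^ M \<Longrightarrow> haar_weight M b x = (\<Sum>c\<le>Suc M. coef c * walsh M (Fr c) x)"
proof -
  define L where "L = M - b"
  \<comment> \<open>Index L + 1 carries the rounding term 2^-L of the finite expansion. Removing 0
    covers b = 0, where there is no digit b.\<close>
  define Fr where "Fr = (\<lambda>c. (if c = 0 then {} else if c \<le> L then {b, b + c}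
    else if c = Suc L then {b} else {}) - {0})"
  \<comment> \<open>With y = 1/2 - S/2 - 2^-L/2 the weight 1 - y has slope 1/2 in S, while y/2 and
    (1 - y)/2 have slopes -1/4 and 1/4, which is -1/4 times the sign of digit b.\<close>
  define s where "s = (if b = 0 then 1 / 2 else - 1 / 4 :: real)"
  define coef where "coef = (\<lambda>c. if c = 0 then \<bar>s\<bar> else if c \<le> L then s * (1 / 2) ^ c
    else if c = Suc L then s * (1 / 2) ^ L else 0)"
  have c1: "\<bar>coef c\<bar> \<le> (1 / 2) ^ c" for c
    by (auto simp: coef_def s_def abs_mult)
  have c2: "Fr c \<subseteq> {1..M} \<inter> ({1..b} \<union> {b + c})" for c
    using assms by (auto simp: Fr_def L_def)
  have c3: "haar_weight M b x = (\<Sum>c\<le>Suc M. coef c * walsh M (Fr c) x)" if x: "x < 2 ^ M" for x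
  proof -
    define p where "p = (if b = 0 then 1 else psi M b x)"
    define S where "S = (\<Sum>c=1..L. (1 / 2) ^ c * psi M (b + c) x)"
    have w1: "walsh M (Fr c) x = p * psi M (b + c) x" if "c \<in> {1..L}" for c
      using that by (simp add: Fr_def p_def walsh_def)
    have "(\<Sum>c\<le>Suc M. coef c * walsh M (Fr c) x) = (\<Sum>c\<le>Suc L. coef c * walsh M (Fr c) x)"
      by (rule sum.mono_neutral_right) (auto simp: coef_def L_def)
    also have "\<dots> = coef 0 * walsh M (Fr 0) x + (\<Sum>c=1..L. coef c * walsh M (Fr c) x)
        + coef (Suc L) * walsh M (Fr (Suc L)) x"
      by (simp add: atMost_atLeast0 sum.atLeast_Suc_atMost)
    also have "(\<Sum>c=1..L. coef c * walsh M (Fr c) x) = (\<Sum>c=1..L. s * p * ((1 / 2) ^ c * psi M (b + c) x))"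
      by (rule sum.cong) (auto simp: w1 coef_def)
    also have "\<dots> = s * p * S" by (simp add: S_def sum_distrib_left)
    also have "coef 0 * walsh M (Fr 0) x = \<bar>s\<bar>" by (simp add: coef_def Fr_def)
    also have "coef (Suc L) * walsh M (Fr (Suc L)) x = s * p * (1 / 2) ^ L"
      by (auto simp: coef_def Fr_def p_def walsh_def)
    finally have sum: "(\<Sum>c\<le>Suc M. coef c * walsh M (Fr c) x) = \<bar>s\<bar> + s * p * S + s * p * (1 / 2) ^ L" .
    have y: "real (x mod 2 ^ L) / 2 ^ L = 1 / 2 - (1 / 2) * S - (1 / 2) * (1 / 2) ^ L"
      using mod_power2_psi[of L M x] assms by (simp add: S_def L_def)
    show ?thesis
    proof (cases "b = 0")
      case True
      then have "L = M" by (simp add: L_def)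
      then show ?thesis using y x True unfolding sum
        by (simp add: haar_weight_def s_def p_def)
    next
      case False
      then show ?thesis unfolding sum haar_weight_def Let_def L_def[symmetric] y
        by (simp add: s_def p_def psi_def algebra_simps diff_divide_distrib flip: L_def)
    qed
  qed
  show ?thesis by (rule that[OF c1 c2 c3])
qed

section \<open>Mean square discrepancy of digital nets\<close>

text \<open>A level is determined by its sum J and all but one of its coordinates, each at most J.
  The exponent \<open>card I - 1\<close> is the source of the power s - 1 of the logarithm.\<close>

lemma card_fixed_sum_le:
  assumes "finite I" "I \<noteq> {}"
  shows "card {b \<in> I \<rightarrow>\<^sub>E {..M}. sum b I = J} \<le> (J + 1) ^ (card I - 1)"
proof -
  obtain i0 where i0: "i0 \<in> I" using assms by blast
  let ?B = "{b \<in> I \<rightarrow>\<^sub>E {..M}. sum b I = J}"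
  let ?r = "\<lambda>b::'a \<Rightarrow> nat. restrict b (I - {i0})"
  have split: "sum b I = b i0 + sum b (I - {i0})" for b :: "'a \<Rightarrow> nat"
    using assms(1) i0 by (rule sum.remove)
  have "card ?B \<le> card ((I - {i0}) \<rightarrow>\<^sub>E {..J})"
  proof (rule card_inj_on_le)
    show "inj_on ?r ?B"
    proof (rule inj_onI)
      fix b b' assume b: "b \<in> ?B" "b' \<in> ?B" and eq: "?r b = ?r b'"
      have same: "b i = b' i" if "i \<in> I - {i0}" for i
        using fun_cong[OF eq, of i] that by simp
      then have "sum b (I - {i0}) = sum b' (I - {i0})" by (rule sum.cong[OF refl])
      then have "b i0 = b' i0" using b split[of b] split[of b'] by auto
      with same have "b i = b' i" if "i \<in> I" for i using that by blast
      then show "b = b'" using b by (auto intro: PiE_ext)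
    qed
    show "?r ` ?B \<subseteq> (I - {i0}) \<rightarrow>\<^sub>E {..J}"
    proof
      fix r assume "r \<in> ?r ` ?B"
      then obtain b where b: "b \<in> ?B" "r = ?r b" by blast
      have "b i \<le> J" if "i \<in> I - {i0}" for i
        using b that assms(1) member_le_sum[of i I b] by auto
      then show "r \<in> (I - {i0}) \<rightarrow>\<^sub>E {..J}" using b by auto
    qed
    show "finite ((I - {i0}) \<rightarrow>\<^sub>E {..J})" using assms by (intro finite_PiE) auto
  qed
  also have "\<dots> = (J + 1) ^ (card I - 1)" using assms i0 by (simp add: card_PiE)
  finally show ?thesis .
qed

text \<open>The 2 covers the geometric sum over levels with |b| < R, the series those with |b| >= R;
  see the split in \<open>sum_levels_le\<close>.\<close>

definition level_const :: "nat \<Rightarrow> real" where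
  "level_const s = 2 + (\<Sum>k. real (k + 1) ^ (s - 1) * (1 / 2) ^ k)"

lemma summable_poly_geometric: "summable (\<lambda>k. real (k + 1) ^ p * (1 / 2) ^ k)"
proof -
  have "(\<lambda>k. (1 + inverse (real (Suc k))) ^ p / 2) \<longlonglongrightarrow> (1 + 0) ^ p / 2"
    by (intro tendsto_intros LIMSEQ_inverse_real_of_nat) auto
  then have "eventually (\<lambda>k. (1 + inverse (real (Suc k))) ^ p / 2 < 3 / 4) sequentially"
    by (rule order_tendstoD) simp
  then obtain N where N: "\<And>k. k \<ge> N \<Longrightarrow> (1 + inverse (real (Suc k))) ^ p / 2 < 3 / 4"
    by (auto simp: eventually_sequentially)
  show ?thesis
  proof (rule summable_ratio_test[of "3 / 4" N])
    fix k assume "N \<le> k"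
    have "real (Suc k + 1) = (1 + inverse (real (Suc k))) * real (k + 1)"
      by (simp add: field_simps)
    then have "real (Suc k + 1) ^ p * (1 / 2) ^ Suc k
       = ((1 + inverse (real (Suc k))) ^ p / 2) * (real (k + 1) ^ p * (1 / 2) ^ k)"
      by (simp only: power_mult_distrib power_Suc)
    also have "\<dots> \<le> 3 / 4 * (real (k + 1) ^ p * (1 / 2) ^ k)"
      using N[OF \<open>N \<le> k\<close>] by (intro mult_right_mono) auto
    finally show "norm (real (Suc k + 1) ^ p * (1 / 2) ^ Suc k) \<le> 3 / 4 * norm (real (k + 1) ^ p * (1 / 2) ^ k)"
      by (simp add: abs_mult del: of_nat_add of_nat_Suc power_Suc)
  qed simp
qed

text \<open>One of the two truncated differences is 0, so the exponent is the distance of |b| from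
  R. At height k above R there are at most ((R + 1) (k + 1))^p levels, where p is
  \<open>card I - 1\<close>, and the geometric decay absorbs the factor (k + 1)^p.\<close>

lemma sum_levels_le:
  assumes "finite I" "I \<noteq> {}"
  shows "(\<Sum>b\<in>I \<rightarrow>\<^sub>E {..M}. (1 / 2) ^ ((R - sum b I) + (sum b I - R)))
    \<le> level_const (card I) * real (R + 1) ^ (card I - 1)"
proof -
  define p where "p = card I - 1"
  define T where "T = card I * M"
  define h :: "nat \<Rightarrow> real" where "h = (\<lambda>J. (1 / 2) ^ ((R - J) + (J - R)))"
  let ?B = "I \<rightarrow>\<^sub>E {..M}"
  have fin: "finite ?B" using assms by (intro finite_PiE) auto
  have T: "sum b I \<le> T" if "b \<in> ?B" for b
    using sum_bounded_above[of I b M] that by (auto simp: T_def)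
  have "(\<Sum>b\<in>?B. h (sum b I)) = (\<Sum>J\<le>T. \<Sum>b\<in>{b \<in> ?B. sum b I = J}. h (sum b I))"
    by (rule sum.group[symmetric]) (use fin T in auto)
  also have "\<dots> = (\<Sum>J\<le>T. real (card {b \<in> ?B. sum b I = J}) * h J)"
    by (intro sum.cong) auto
  also have "\<dots> \<le> (\<Sum>J\<le>T. real (R + 1) ^ p * (real (J - R + 1) ^ p * h J))"
  proof (rule sum_mono)
    fix J
    have "real (card {b \<in> ?B. sum b I = J}) \<le> real ((J + 1) ^ p)"
      unfolding p_def using card_fixed_sum_le[OF assms, of M J] by (rule of_nat_mono)
    also have "\<dots> \<le> real (((R + 1) * (J - R + 1)) ^ p)"
    proof -
      have "J + 1 \<le> (R + 1) * (J - R + 1)"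
      proof (cases "J \<le> R")
        case False
        then obtain d where "J = R + d" by (metis le_Suc_ex nat_le_linear)
        then show ?thesis by simp
      qed simp
      then show ?thesis by (intro of_nat_mono power_mono) auto
    qed
    also have "\<dots> = real (R + 1) ^ p * real (J - R + 1) ^ p"
      by (simp only: power_mult_distrib of_nat_mult of_nat_power)
    finally show "real (card {b \<in> ?B. sum b I = J}) * h J \<le> real (R + 1) ^ p * (real (J - R + 1) ^ p * h J)"
      by (simp add: h_def mult_right_mono flip: mult.assoc del: of_nat_add of_nat_Suc)
  qed
  also have "\<dots> = real (R + 1) ^ p * (\<Sum>J\<le>T. real (J - R + 1) ^ p * h J)"
    by (simp only: sum_distrib_left)
  also have "(\<Sum>J\<le>T. real (J - R + 1) ^ p * h J) \<le> (\<Sum>J\<le>T + R. real (J - R + 1) ^ p * h J)"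
    by (rule sum_mono2) (auto simp: h_def)
  also have "\<dots> = (\<Sum>J<R. real (J - R + 1) ^ p * h J) + (\<Sum>J=R..T + R. real (J - R + 1) ^ p * h J)"
  proof -
    have "{..T + R} = {..<R} \<union> {R..T + R}" by auto
    then show ?thesis by (simp add: sum.union_disjoint ivl_disj_int)
  qed
  also have "(\<Sum>J<R. real (J - R + 1) ^ p * h J) \<le> 2"
  proof -
    have "(\<Sum>J<R. real (J - R + 1) ^ p * h J) = (\<Sum>J<R. (1 / 2) ^ (R - J))"
      by (intro sum.cong) (auto simp: h_def)
    also have "\<dots> = (\<Sum>J<R. (1 / 2) ^ Suc J)"
      by (rule sum.reindex_bij_witness[of _ "\<lambda>j. R - 1 - j" "\<lambda>j. R - 1 - j"]) (auto simp: Suc_diff_Suc)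
    also have "\<dots> \<le> (\<Sum>J<R. (1 / 2) ^ J)" by (rule sum_mono) simp
    also have "\<dots> \<le> (\<Sum>J. (1 / 2) ^ J)" by (rule sum_le_suminf) auto
    also have "\<dots> = (2 :: real)" by (subst suminf_geometric) auto
    finally show ?thesis .
  qed
  also have "(\<Sum>J=R..T + R. real (J - R + 1) ^ p * h J) = (\<Sum>k\<le>T. real (k + 1) ^ p * (1 / 2) ^ k)"
    by (rule sum.reindex_bij_witness[of _ "\<lambda>k. k + R" "\<lambda>J. J - R"]) (auto simp: h_def)
  also have "\<dots> \<le> (\<Sum>k. real (k + 1) ^ p * (1 / 2) ^ k)"
    by (rule sum_le_suminf[OF summable_poly_geometric]) auto
  finally show ?thesis
    by (simp add: h_def p_def level_const_def mult.commute mult_left_mono del: of_nat_add of_nat_Suc)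
qed

text \<open>Serves to enlarge a box that is too small for exact counting to one of critical
  volume.\<close>

lemma ex_smaller_with_sum:
  fixes b :: "'a \<Rightarrow> nat"
  assumes "finite I" "T \<le> sum b I"
  shows "\<exists>b'. (\<forall>i. b' i \<le> b i) \<and> sum b' I = T"
  using assms
proof (induction I arbitrary: T)
  case empty
  then show ?case by auto
next
  case (insert i I)
  have "T - b i \<le> sum b I" using insert by simp
  then obtain b' where b': "\<forall>j. b' j \<le> b j" "sum b' I = T - b i" using insert.IH by blast
  let ?b = "b'(i := min T (b i))"
  have "sum ?b I = sum b' I" using insert.hyps by (intro sum.cong) auto
  then have "sum ?b (insert i I) = T" using insert.hyps b' by simp
  moreover have "\<forall>j. ?b j \<le> b j" using b' by auto
  ultimately show ?case by blast
qed

lemma sum_power2_orthogonal: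
  fixes g :: "'b \<Rightarrow> 'k \<Rightarrow> real"
  assumes "finite B" "\<And>b b'. b \<in> B \<Longrightarrow> b' \<in> B \<Longrightarrow> b \<noteq> b' \<Longrightarrow> (\<Sum>k\<in>K. g b k * g b' k) = 0"
  shows "(\<Sum>k\<in>K. (\<Sum>b\<in>B. g b k)\<^sup>2) = (\<Sum>b\<in>B. \<Sum>k\<in>K. (g b k)\<^sup>2)"
proof -
  have "(\<Sum>k\<in>K. (\<Sum>b\<in>B. g b k)\<^sup>2) = (\<Sum>k\<in>K. \<Sum>b\<in>B. \<Sum>b'\<in>B. g b k * g b' k)"
    by (simp add: power2_eq_square sum_product)
  also have "\<dots> = (\<Sum>b\<in>B. \<Sum>k\<in>K. \<Sum>b'\<in>B. g b k * g b' k)" by (rule sum.swap)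
  also have "\<dots> = (\<Sum>b\<in>B. \<Sum>b'\<in>B. \<Sum>k\<in>K. g b k * g b' k)"
    by (rule sum.cong[OF refl], rule sum.swap)
  also have "\<dots> = (\<Sum>b\<in>B. \<Sum>k\<in>K. (g b k)\<^sup>2)"
  proof (rule sum.cong[OF refl])
    fix b assume b: "b \<in> B"
    have "(\<Sum>b'\<in>B. \<Sum>k\<in>K. g b k * g b' k) = (\<Sum>b'\<in>{b}. \<Sum>k\<in>K. g b k * g b' k)"
      using assms b by (intro sum.mono_neutral_right) auto
    then show "(\<Sum>b'\<in>B. \<Sum>k\<in>K. g b k * g b' k) = (\<Sum>k\<in>K. (g b k)\<^sup>2)"
      by (simp add: power2_eq_square)
  qed
  finally show ?thesis .
qed

text \<open>Unnormalised error of the points in integrating a product function. Allowing arbitrary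
  factors makes it multilinear, so that Haar and Walsh expansions can be inserted coordinate by
  coordinate.\<close>

definition discrepancy :: "nat \<Rightarrow> nat \<Rightarrow> 'i set \<Rightarrow> ('i \<Rightarrow> nat \<Rightarrow> nat) \<Rightarrow> ('i \<Rightarrow> nat \<Rightarrow> real) \<Rightarrow> real" where
  "discrepancy m M I x f =
     (\<Sum>n<2 ^ m. \<Prod>i\<in>I. f i (x i n)) - 2 ^ m * (\<Prod>i\<in>I. (\<Sum>y<2 ^ M. f i y) / 2 ^ M)"

lemma discrepancy_sum:
  assumes "finite I" "\<And>i. i \<in> I \<Longrightarrow> finite (C i)"
  shows "discrepancy m M I x (\<lambda>i y. \<Sum>c\<in>C i. g i c y) = (\<Sum>c\<in>Pi\<^sub>E I C. discrepancy m M I x (\<lambda>i. g i (c i)))"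
proof -
  have "(\<Sum>n<2 ^ m. \<Prod>i\<in>I. \<Sum>c\<in>C i. g i c (x i n)) = (\<Sum>c\<in>Pi\<^sub>E I C. \<Sum>n<2 ^ m. \<Prod>i\<in>I. g i (c i) (x i n))"
    by (subst sum.swap) (simp add: prod_sum_PiE assms)
  moreover have "(\<Prod>i\<in>I. (\<Sum>y<2 ^ M. \<Sum>c\<in>C i. g i c y) / 2 ^ M)
      = (\<Sum>c\<in>Pi\<^sub>E I C. \<Prod>i\<in>I. (\<Sum>y<2 ^ M. g i (c i) y) / 2 ^ M)"
  proof -
    have "(\<Sum>y<2 ^ M. \<Sum>c\<in>C i. g i c y) / 2 ^ M = (\<Sum>c\<in>C i. (\<Sum>y<2 ^ M. g i c y) / 2 ^ M)" for i
      by (subst sum.swap) (simp add: sum_divide_distrib)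
    then show ?thesis by (simp add: prod_sum_PiE assms)
  qed
  ultimately show ?thesis
    unfolding discrepancy_def by (simp add: sum_subtractf sum_distrib_left)
qed

lemma discrepancy_scale:
  "discrepancy m M I x (\<lambda>i y. a i * f i y) = (\<Prod>i\<in>I. a i) * discrepancy m M I x f"
proof -
  have "(\<Sum>y<2 ^ M. a i * f i y) / 2 ^ M = a i * ((\<Sum>y<2 ^ M. f i y) / 2 ^ M)" for i
    by (simp add: sum_distrib_left sum_divide_distrib)
  then have "(\<Prod>i\<in>I. (\<Sum>y<2 ^ M. a i * f i y) / 2 ^ M)
      = prod a I * (\<Prod>i\<in>I. (\<Sum>y<2 ^ M. f i y) / 2 ^ M)"
    by (simp only: prod.distrib)
  moreover have "(\<Sum>n<2 ^ m. \<Prod>i\<in>I. a i * f i (x i n)) = prod a I * (\<Sum>n<2 ^ m. \<Prod>i\<in>I. f i (x i n))"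
    by (simp add: prod.distrib sum_distrib_left)
  ultimately show ?thesis
    unfolding discrepancy_def by (simp only: right_diff_distrib mult_ac)
qed

lemma discrepancy_cong:
  assumes "\<And>i n. i \<in> I \<Longrightarrow> n < 2 ^ m \<Longrightarrow> x i n < 2 ^ M"
    and "\<And>i y. i \<in> I \<Longrightarrow> y < 2 ^ M \<Longrightarrow> f i y = g i y"
  shows "discrepancy m M I x f = discrepancy m M I x g"
  using assms unfolding discrepancy_def by (auto intro!: arg_cong2[of _ _ _ _ minus] sum.cong prod.cong)

text \<open>In this form a product of two discrepancies is a double sum of products over the coordinates, so
  that orthogonality in one coordinate suffices.\<close>

lemma discrepancy_eq_signed_sum:
  assumes "finite I"
  shows "discrepancy m M I x f = (\<Sum>z\<in>{..<2 ^ m} <+> (I \<rightarrow>\<^sub>E {..<2 ^ M}).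
     (case z of Inl _ \<Rightarrow> 1 | Inr _ \<Rightarrow> - (2 ^ m / (2 ^ M) ^ card I)) *
     (\<Prod>i\<in>I. f i (case z of Inl n \<Rightarrow> x i n | Inr y \<Rightarrow> y i)))"
proof -
  have "(\<Prod>i\<in>I. (\<Sum>y<2 ^ M. f i y) / 2 ^ M) = (\<Sum>y\<in>I \<rightarrow>\<^sub>E {..<2 ^ M}. \<Prod>i\<in>I. f i (y i)) / (2 ^ M) ^ card I"
    using assms by (simp add: prod_dividef prod_sum_PiE)
  then show ?thesis
    using assms by (simp add: discrepancy_def sum.Plus finite_PiE o_def sum_distrib_left sum_negf
        sum_divide_distrib)
qed

lemma discrepancy_haar_orthogonal:
  assumes I: "finite I" and b: "b \<in> I \<rightarrow>\<^sub>E {..M}" "b' \<in> I \<rightarrow>\<^sub>E {..M}" "b \<noteq> b'"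
  shows "(\<Sum>k\<in>I \<rightarrow>\<^sub>E {..<2 ^ M}. discrepancy m M I x (\<lambda>i y. haar M (b i) y (k i)) *
    discrepancy m M I x (\<lambda>i y. haar M (b' i) y (k i))) = 0"
proof -
  define Z where "Z = {..<(2::nat) ^ m} <+> (I \<rightarrow>\<^sub>E {..<(2::nat) ^ M})"
  define w :: "nat + ('a \<Rightarrow> nat) \<Rightarrow> real"
    where "w = (\<lambda>z. case z of Inl _ \<Rightarrow> 1 | Inr _ \<Rightarrow> - (2 ^ m / (2 ^ M) ^ card I))"
  define X where "X = (\<lambda>z i. case z of Inl n \<Rightarrow> x i n | Inr y \<Rightarrow> y i)"
  have eq: "discrepancy m M I x f = (\<Sum>z\<in>Z. w z * (\<Prod>i\<in>I. f i (X z i)))" for f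
    unfolding Z_def w_def X_def using I by (rule discrepancy_eq_signed_sum)
  have "(\<Sum>k\<in>I \<rightarrow>\<^sub>E {..<2 ^ M}. discrepancy m M I x (\<lambda>i y. haar M (b i) y (k i)) *
      discrepancy m M I x (\<lambda>i y. haar M (b' i) y (k i)))
    = (\<Sum>k\<in>I \<rightarrow>\<^sub>E {..<2 ^ M}. \<Sum>z\<in>Z. \<Sum>z'\<in>Z. w z * w z' *
        (\<Prod>i\<in>I. haar M (b i) (X z i) (k i) * haar M (b' i) (X z' i) (k i)))"
    unfolding eq sum_product by (simp add: prod.distrib mult_ac)
  also have "\<dots> = (\<Sum>z\<in>Z. \<Sum>z'\<in>Z. \<Sum>k\<in>I \<rightarrow>\<^sub>E {..<2 ^ M}. w z * w z' *
        (\<Prod>i\<in>I. haar M (b i) (X z i) (k i) * haar M (b' i) (X z' i) (k i)))"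
    by (subst sum.swap, rule sum.cong[OF refl], rule sum.swap)
  also have "\<dots> = 0"
  proof (rule sum.neutral, rule ballI, rule sum.neutral, rule ballI)
    fix z z'
    obtain i where i: "i \<in> I" "b i \<noteq> b' i" using b by (metis PiE_ext)
    then have "(\<Sum>k<2 ^ M. haar M (b i) (X z i) k * haar M (b' i) (X z' i) k) = 0"
      using b by (intro haar_orthogonal) auto
    then have "(\<Prod>i\<in>I. \<Sum>k<2 ^ M. haar M (b i) (X z i) k * haar M (b' i) (X z' i) k) = 0"
      using I i by (meson prod_zero)
    then show "(\<Sum>k\<in>I \<rightarrow>\<^sub>E {..<2 ^ M}. w z * w z' *
        (\<Prod>i\<in>I. haar M (b i) (X z i) (k i) * haar M (b' i) (X z' i) (k i))) = 0"
      using I by (simp add: prod_sum_PiE flip: sum_distrib_left)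
  qed
  finally show ?thesis .
qed

text \<open>The numbers \<open>x i n\<close> are numerators over \<open>2 ^ M\<close>, and
  \<open>t\<close> is the quality parameter. \<open>dual\<close> says which characters annihilate
  the net: in coordinate i a prefix of length \<open>b i\<close> is charged in full, but one extra
  digit at distance \<open>c i\<close> only \<open>c i / 3\<close> rounded up.\<close>

locale walsh_net =
  fixes m M t :: nat and I :: "'i set" and x :: "'i \<Rightarrow> nat \<Rightarrow> nat"
  assumes fin: "finite I" and nonempty: "I \<noteq> {}"
    and less: "\<And>i n. i \<in> I \<Longrightarrow> n < 2 ^ m \<Longrightarrow> x i n < 2 ^ M"
    and dual: "\<And>b c F. sum b I + (\<Sum>i\<in>I. (c i + 2) div 3) + t \<le> m \<Longrightarrow>
      (\<And>i. i \<in> I \<Longrightarrow> F i \<subseteq> {1..M} \<inter> ({1..b i} \<union> {b i + c i})) \<Longrightarrow> \<exists>i\<in>I. F i \<noteq> {} \<Longrightarrow>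
      (\<Sum>n<2 ^ m. \<Prod>i\<in>I. walsh M (F i) (x i n)) = 0"
begin

abbreviation "disc \<equiv> discrepancy m M I x"

abbreviation "grid \<equiv> I \<rightarrow>\<^sub>E {..<(2::nat) ^ M}"

abbreviation "levels \<equiv> I \<rightarrow>\<^sub>E {..M}"

lemma disc_walsh:
  assumes "sum b I + (\<Sum>i\<in>I. (c i + 2) div 3) + t \<le> m"
    and F: "\<And>i. i \<in> I \<Longrightarrow> F i \<subseteq> {1..M} \<inter> ({1..b i} \<union> {b i + c i})"
  shows "disc (\<lambda>i. walsh M (F i)) = 0"
proof (cases "\<exists>i\<in>I. F i \<noteq> {}")
  case True
  then obtain i where i: "i \<in> I" "F i \<noteq> {}" by blast
  then have "(\<Sum>y<2 ^ M. walsh M (F i) y) = 0" using F[OF i(1)] by (intro sum_walsh) auto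
  then have "(\<Prod>i\<in>I. (\<Sum>y<2 ^ M. walsh M (F i) y) / 2 ^ M) = 0"
    using i fin by (intro prod_zero) auto
  then show ?thesis using dual[OF assms(1) F True] by (simp add: discrepancy_def)
next
  case False
  then show ?thesis by (simp add: discrepancy_def)
qed

text \<open>Multiplying by the Walsh expansion of the prefix indicator changes \<open>F i\<close>
  only within \<open>{1..b i}\<close>, so \<open>disc_walsh\<close> kills every term.\<close>

lemma disc_prefix_walsh:
  assumes "sum b I + (\<Sum>i\<in>I. (c i + 2) div 3) + t \<le> m"
    and F: "\<And>i. i \<in> I \<Longrightarrow> F i \<subseteq> {1..M} \<inter> ({1..b i} \<union> {b i + c i})"
    and a: "\<And>i. i \<in> I \<Longrightarrow> a i \<le> b i \<and> a i \<le> M" and k: "\<And>i. i \<in> I \<Longrightarrow> k i < 2 ^ M"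
  shows "disc (\<lambda>i y. same_prefix M (a i) y (k i) * walsh M (F i) y) = 0"
proof -
  have "disc (\<lambda>i y. same_prefix M (a i) y (k i) * walsh M (F i) y)
     = disc (\<lambda>i y. \<Sum>H\<in>Pow {1..a i}. (walsh M H (k i) / 2 ^ a i) * walsh M ((H - F i) \<union> (F i - H)) y)"
  proof (rule discrepancy_cong[OF less])
    fix i and y :: nat assume i: "i \<in> I" and y: "y < 2 ^ M"
    have "finite (F i)" using F[OF i] by (meson finite_Int finite_atLeastAtMost finite_subset)
    then have "walsh M H y * walsh M (F i) y = walsh M ((H - F i) \<union> (F i - H)) y" if "H \<subseteq> {1..a i}" for H
      using that finite_subset[of H "{1..a i}"] by (intro walsh_mult) auto
    note mult = this
    have "same_prefix M (a i) y (k i) * walsh M (F i) y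
      = (\<Sum>H\<in>Pow {1..a i}. walsh M H y * (walsh M H (k i) / 2 ^ a i) * walsh M (F i) y)"
      using a k i y by (simp only: same_prefix_walsh sum_distrib_right)
    also have "\<dots> = (\<Sum>H\<in>Pow {1..a i}. (walsh M H (k i) / 2 ^ a i) * (walsh M H y * walsh M (F i) y))"
      by (simp only: mult_ac)
    also have "\<dots> = (\<Sum>H\<in>Pow {1..a i}. (walsh M H (k i) / 2 ^ a i) * walsh M ((H - F i) \<union> (F i - H)) y)"
      by (intro sum.cong refl) (simp add: mult)
    finally show "same_prefix M (a i) y (k i) * walsh M (F i) y
      = (\<Sum>H\<in>Pow {1..a i}. (walsh M H (k i) / 2 ^ a i) * walsh M ((H - F i) \<union> (F i - H)) y)" .
  qed
  also have "\<dots> = (\<Sum>H\<in>Pi\<^sub>E I (\<lambda>i. Pow {1..a i}). (\<Prod>i\<in>I. walsh M (H i) (k i) / 2 ^ a i) *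
      disc (\<lambda>i. walsh M ((H i - F i) \<union> (F i - H i))))"
    by (subst discrepancy_sum) (simp_all only: fin discrepancy_scale finite_Pow_iff finite_atLeastAtMost)
  also have "\<dots> = 0"
  proof (intro sum.neutral ballI)
    fix H assume H: "H \<in> Pi\<^sub>E I (\<lambda>i. Pow {1..a i})"
    have "disc (\<lambda>i. walsh M ((H i - F i) \<union> (F i - H i))) = 0"
    proof (rule disc_walsh[OF assms(1)])
      fix i assume i: "i \<in> I"
      have "H i \<subseteq> {1..a i}" using H i by auto
      then have "H i \<subseteq> {1..M} \<inter> ({1..b i} \<union> {b i + c i})" using a[OF i] by fastforce
      then show "(H i - F i) \<union> (F i - H i) \<subseteq> {1..M} \<inter> ({1..b i} \<union> {b i + c i})" using F[OF i] by blast
    qed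
    then show "(\<Prod>i\<in>I. walsh M (H i) (k i) / 2 ^ a i) *
      disc (\<lambda>i. walsh M ((H i - F i) \<union> (F i - H i))) = 0" by simp
  qed
  finally show ?thesis .
qed

definition box_points :: "('i \<Rightarrow> nat) \<Rightarrow> ('i \<Rightarrow> nat) \<Rightarrow> real" where
  "box_points a k = (\<Sum>n<2 ^ m. \<Prod>i\<in>I. same_prefix M (a i) (x i n) (k i))"

lemma box_points_nonneg: "box_points a k \<ge> 0"
  unfolding box_points_def by (intro sum_nonneg prod_nonneg) simp

text \<open>This is the net property in its usual form, obtained from
  \<open>disc_prefix_walsh\<close> with all offsets 0 and all digit sets empty.\<close>

lemma box_points_exact:
  assumes "sum b I + t \<le> m" "\<And>i. i \<in> I \<Longrightarrow> a i \<le> b i \<and> a i \<le> M" "\<And>i. i \<in> I \<Longrightarrow> k i < 2 ^ M"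
  shows "box_points a k = 2 ^ m * (\<Prod>i\<in>I. 1 / 2 ^ a i)"
proof -
  have "disc (\<lambda>i y. same_prefix M (a i) y (k i) * walsh M {} y) = 0"
    by (rule disc_prefix_walsh[of b "\<lambda>_. 0"]) (use assms in auto)
  moreover have "(\<Prod>i\<in>I. (\<Sum>y<2 ^ M. same_prefix M (a i) y (k i)) / 2 ^ M) = (\<Prod>i\<in>I. 1 / 2 ^ a i)"
    using assms by (intro prod.cong) (auto simp: sum_same_prefix)
  ultimately show ?thesis by (simp add: discrepancy_def box_points_def)
qed

lemma abs_disc_le:
  assumes "\<And>i y. i \<in> I \<Longrightarrow> y < 2 ^ M \<Longrightarrow> \<bar>f i y\<bar> \<le> same_prefix M (a i) y (k i)"
    and "\<And>i. i \<in> I \<Longrightarrow> a i \<le> M" "\<And>i. i \<in> I \<Longrightarrow> k i < 2 ^ M"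
  shows "\<bar>disc f\<bar> \<le> box_points a k + 2 ^ m * (\<Prod>i\<in>I. 1 / 2 ^ a i)"
proof -
  have "\<bar>\<Sum>n<2 ^ m. \<Prod>i\<in>I. f i (x i n)\<bar> \<le> (\<Sum>n<2 ^ m. \<bar>\<Prod>i\<in>I. f i (x i n)\<bar>)" by (rule sum_abs)
  also have "\<dots> \<le> box_points a k"
    unfolding box_points_def abs_prod using assms less by (intro sum_mono prod_mono) auto
  finally have 1: "\<bar>\<Sum>n<2 ^ m. \<Prod>i\<in>I. f i (x i n)\<bar> \<le> box_points a k" .
  have "\<bar>(\<Sum>y<2 ^ M. f i y) / 2 ^ M\<bar> \<le> 1 / 2 ^ a i" if i: "i \<in> I" for i
  proof -
    have "\<bar>\<Sum>y<2 ^ M. f i y\<bar> \<le> (\<Sum>y<2 ^ M. \<bar>f i y\<bar>)" by (rule sum_abs)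
    also have "\<dots> \<le> (\<Sum>y<2 ^ M. same_prefix M (a i) y (k i))" using assms i by (intro sum_mono) auto
    also have "\<dots> = 2 ^ M / 2 ^ a i" using assms i by (simp add: sum_same_prefix)
    finally show ?thesis by (simp add: abs_divide field_simps)
  qed
  then have "\<bar>\<Prod>i\<in>I. (\<Sum>y<2 ^ M. f i y) / 2 ^ M\<bar> \<le> (\<Prod>i\<in>I. 1 / 2 ^ a i)"
    unfolding abs_prod by (intro prod_mono) auto
  then have "\<bar>2 ^ m * (\<Prod>i\<in>I. (\<Sum>y<2 ^ M. f i y) / 2 ^ M)\<bar> \<le> 2 ^ m * (\<Prod>i\<in>I. 1 / 2 ^ a i)"
    by (simp add: abs_mult)
  with 1 show ?thesis unfolding discrepancy_def by linarith
qed

text \<open>A Haar component of level b is supported on a prefix of length b - 1, which costs a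
  factor 2 per coordinate with b > 0. For b = 0 the subtraction truncates.\<close>

lemma volume_le:
  "2 ^ m * (\<Prod>i\<in>I. 1 / 2 ^ (b i - 1)) \<le> 2 ^ card I * (2 ^ m / 2 ^ sum b I :: real)"
proof -
  have "(\<Prod>i\<in>I. 1 / 2 ^ (b i - 1)) \<le> (\<Prod>i\<in>I. 2 * (1 / 2 ^ b i) :: real)"
  proof (rule prod_mono)
    fix i
    show "0 \<le> (1 / 2 ^ (b i - 1) :: real) \<and> 1 / 2 ^ (b i - 1) \<le> (2 * (1 / 2 ^ b i) :: real)"
      by (cases "b i") auto
  qed
  also have "\<dots> = 2 ^ card I / 2 ^ sum b I"
    by (simp add: prod.distrib prod_dividef power_sum)
  finally show ?thesis by (simp add: field_simps)
qed

text \<open>Small levels: only Walsh coefficients with \<open>\<Sum>i. (c i + 2) div 3\<close> exceeding the deficit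
  \<open>m - t - sum b I\<close> survive, and \<open>(1/2)^c = (3/4)^c (2/3)^c\<close> splits their decay between summability
  and smallness.\<close>

lemma haar_small:
  assumes b: "b \<in> levels" and k: "k \<in> grid" and le: "sum b I + t \<le> m"
  shows "\<bar>disc (\<lambda>i y. haar M (b i) y (k i))\<bar>
    \<le> 2 ^ (t + 1) * 18 ^ card I * (16 / 27) ^ (m - t - sum b I)"
proof -
  define s where "s = card I"
  define R where "R = m - t - sum b I"
  define a where "a = (\<lambda>i. b i - 1)"
  define Q :: real where "Q = 2 ^ m * (\<Prod>i\<in>I. 1 / 2 ^ a i)"
  have bM: "b i \<le> M" and kM: "k i < 2 ^ M" if "i \<in> I" for i using b k that by auto
  have aM: "a i \<le> b i \<and> a i \<le> M" if "i \<in> I" for i using bM[OF that] by (simp add: a_def)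
  have "\<forall>b. \<exists>cF. b \<le> M \<longrightarrow> (\<forall>c. \<bar>fst cF c\<bar> \<le> (1 / 2 :: real) ^ c) \<and>
      (\<forall>c. snd cF c \<subseteq> {1..M} \<inter> ({1..b} \<union> {b + c})) \<and>
      (\<forall>y<2 ^ M. haar_weight M b y = (\<Sum>c\<le>Suc M. fst cF c * walsh M (snd cF c) y))"
  proof
    fix b
    show "\<exists>cF. b \<le> M \<longrightarrow> (\<forall>c. \<bar>fst cF c\<bar> \<le> (1 / 2 :: real) ^ c) \<and>
      (\<forall>c. snd cF c \<subseteq> {1..M} \<inter> ({1..b} \<union> {b + c})) \<and>
      (\<forall>y<2 ^ M. haar_weight M b y = (\<Sum>c\<le>Suc M. fst cF c * walsh M (snd cF c) y))"
    proof (cases "b \<le> M")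
      case True
      from haar_weight_walsh[OF this] obtain co Fr where
        "\<And>c. \<bar>co c\<bar> \<le> (1 / 2) ^ c" "\<And>c. Fr c \<subseteq> {1..M} \<inter> ({1..b} \<union> {b + c})"
        "\<And>y. y < 2 ^ M \<Longrightarrow> haar_weight M b y = (\<Sum>c\<le>Suc M. co c * walsh M (Fr c) y)"
        by blast
      then show ?thesis by (intro exI[of _ "(co, Fr)"]) auto
    qed auto
  qed
  from choice[OF this] obtain cF where cF: "\<And>b. b \<le> M \<Longrightarrow> (\<forall>c. \<bar>fst (cF b) c\<bar> \<le> (1 / 2 :: real) ^ c) \<and>
      (\<forall>c. snd (cF b) c \<subseteq> {1..M} \<inter> ({1..b} \<union> {b + c})) \<and>
      (\<forall>y<2 ^ M. haar_weight M b y = (\<Sum>c\<le>Suc M. fst (cF b) c * walsh M (snd (cF b) c) y))"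
    by blast
  define co Fr where "co = (\<lambda>i. fst (cF (b i)))" and "Fr = (\<lambda>i. snd (cF (b i)))"
  have co: "\<bar>co i c\<bar> \<le> (1 / 2) ^ c" and Fr: "Fr i c \<subseteq> {1..M} \<inter> ({1..b i} \<union> {b i + c})"
    and hw: "y < 2 ^ M \<Longrightarrow> haar_weight M (b i) y = (\<Sum>c\<le>Suc M. co i c * walsh M (Fr i c) y)"
    if "i \<in> I" for i c y
    using cF[OF bM[OF that]] by (auto simp: co_def Fr_def)
  define N where "N = (\<lambda>c. disc (\<lambda>i y. same_prefix M (a i) y (k i) * walsh M (Fr i (c i)) y))"
  have "disc (\<lambda>i y. haar M (b i) y (k i))
      = disc (\<lambda>i y. haar_sign M (b i) (k i) * (\<Sum>c\<le>Suc M. co i c * (same_prefix M (a i) y (k i) * walsh M (Fr i c) y)))"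
  proof (rule discrepancy_cong[OF less])
    fix i and y :: nat assume "i \<in> I" "y < 2 ^ M"
    then have "haar M (b i) y (k i) = haar_sign M (b i) (k i) * (same_prefix M (a i) y (k i) *
        (\<Sum>c\<le>Suc M. co i c * walsh M (Fr i c) y))"
      unfolding haar_def a_def by (simp only: hw mult_ac)
    then show "haar M (b i) y (k i) = haar_sign M (b i) (k i) *
        (\<Sum>c\<le>Suc M. co i c * (same_prefix M (a i) y (k i) * walsh M (Fr i c) y))"
      by (simp only: sum_distrib_left mult_ac)
  qed
  also have "\<dots> = (\<Prod>i\<in>I. haar_sign M (b i) (k i)) *
      (\<Sum>c\<in>I \<rightarrow>\<^sub>E {..Suc M}. (\<Prod>i\<in>I. co i (c i)) * N c)"
    unfolding N_def discrepancy_scale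
    by (subst discrepancy_sum) (simp_all only: fin finite_atMost discrepancy_scale)
  finally have "\<bar>disc (\<lambda>i y. haar M (b i) y (k i))\<bar> = \<bar>\<Sum>c\<in>I \<rightarrow>\<^sub>E {..Suc M}. (\<Prod>i\<in>I. co i (c i)) * N c\<bar>"
    by (simp add: abs_mult abs_prod)
  also have "\<dots> \<le> (\<Sum>c\<in>I \<rightarrow>\<^sub>E {..Suc M}. \<bar>(\<Prod>i\<in>I. co i (c i)) * N c\<bar>)" by (rule sum_abs)
  also have "\<dots> \<le> (\<Sum>c\<in>I \<rightarrow>\<^sub>E {..Suc M}. 2 * Q * (9 / 4) ^ s * (8 / 27) ^ R * (\<Prod>i\<in>I. (3 / 4) ^ c i))"
  proof (rule sum_mono)
    fix c assume "c \<in> I \<rightarrow>\<^sub>E {..Suc M}"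
    have Q0: "Q \<ge> 0" by (simp add: Q_def prod_nonneg)
    have pos: "0 \<le> 2 * Q * (9 / 4) ^ s * (8 / 27) ^ R * (\<Prod>i\<in>I. (3 / 4) ^ c i)"
      using Q0 by (simp add: prod_nonneg)
    show "\<bar>(\<Prod>i\<in>I. co i (c i)) * N c\<bar> \<le> 2 * Q * (9 / 4) ^ s * (8 / 27) ^ R * (\<Prod>i\<in>I. (3 / 4) ^ c i)"
    proof (cases "sum b I + (\<Sum>i\<in>I. (c i + 2) div 3) + t \<le> m")
      case True
      then have "N c = 0" unfolding N_def using Fr aM kM by (intro disc_prefix_walsh) auto
      then show ?thesis using pos by simp
    next
      case False
      \<comment> \<open>A surviving term is bounded trivially: the box holds exactly Q points, and Q
        is also their expected number.\<close>
      have "\<bar>N c\<bar> \<le> box_points a k + 2 ^ m * (\<Prod>i\<in>I. 1 / 2 ^ a i)"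
        unfolding N_def using aM kM by (intro abs_disc_le) (auto simp: abs_mult)
      also have "box_points a k = Q"
        unfolding Q_def using le aM kM by (intro box_points_exact) auto
      finally have NQ: "\<bar>N c\<bar> \<le> 2 * Q" by (simp add: Q_def)
      have "\<bar>\<Prod>i\<in>I. co i (c i)\<bar> \<le> (\<Prod>i\<in>I. (1 / 2) ^ c i)"
        unfolding abs_prod using co by (intro prod_mono) auto
      \<comment> \<open>Since \<open>3 * ((c i + 2) div 3) \<le> c i + 2\<close>, the factor (2/3)^c
        is at most (3/2)^2 times the corresponding power of (2/3)^3.\<close>
      also have "\<dots> \<le> (\<Prod>i\<in>I. 9 / 4 * (8 / 27) ^ ((c i + 2) div 3) * (3 / 4) ^ c i)"
      proof (rule prod_mono, rule conjI)
        fix i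
        have "(2 / 3 :: real) ^ (c i + 2) \<le> (2 / 3) ^ (3 * ((c i + 2) div 3))"
          by (rule power_decreasing) auto
        also have "\<dots> = (8 / 27) ^ ((c i + 2) div 3)" by (simp add: power_mult power_divide)
        finally have "(2 / 3 :: real) ^ c i \<le> 9 / 4 * (8 / 27) ^ ((c i + 2) div 3)"
          by (simp add: power_add power2_eq_square)
        then have "(2 / 3 :: real) ^ c i * (3 / 4) ^ c i \<le> 9 / 4 * (8 / 27) ^ ((c i + 2) div 3) * (3 / 4) ^ c i"
          by (rule mult_right_mono) simp
        then show "(1 / 2 :: real) ^ c i \<le> 9 / 4 * (8 / 27) ^ ((c i + 2) div 3) * (3 / 4) ^ c i"
          by (simp flip: power_mult_distrib)
      qed simp
      also have "\<dots> = (9 / 4) ^ s * (8 / 27) ^ (\<Sum>i\<in>I. (c i + 2) div 3) * (\<Prod>i\<in>I. (3 / 4) ^ c i)"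
        by (simp only: prod.distrib s_def power_sum prod_constant)
      also have "\<dots> \<le> (9 / 4) ^ s * (8 / 27) ^ R * (\<Prod>i\<in>I. (3 / 4) ^ c i)"
      proof (intro mult_right_mono mult_left_mono power_decreasing)
        show "R \<le> (\<Sum>i\<in>I. (c i + 2) div 3)" using False le by (simp add: R_def)
      qed (auto intro: prod_nonneg)
      finally have "\<bar>\<Prod>i\<in>I. co i (c i)\<bar> \<le> (9 / 4) ^ s * (8 / 27) ^ R * (\<Prod>i\<in>I. (3 / 4) ^ c i)" .
      then have "\<bar>\<Prod>i\<in>I. co i (c i)\<bar> * \<bar>N c\<bar> \<le> ((9 / 4) ^ s * (8 / 27) ^ R * (\<Prod>i\<in>I. (3 / 4) ^ c i)) * (2 * Q)"
        using NQ by (rule mult_mono) (auto intro!: mult_nonneg_nonneg prod_nonneg)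
      then show ?thesis by (simp add: abs_mult mult_ac)
    qed
  qed
  also have "\<dots> = 2 * Q * (9 / 4) ^ s * (8 / 27) ^ R * (\<Sum>c\<in>I \<rightarrow>\<^sub>E {..Suc M}. \<Prod>i\<in>I. (3 / 4) ^ c i)"
    by (simp only: sum_distrib_left)
  \<comment> \<open>Here 2^s comes from \<open>volume_le\<close> and 4^s from the geometric series
    in 3/4. Collecting gives 18 = 2 * 9/4 * 4 per coordinate and 16/27 = 2 * 8/27 per unit of
    deficit.\<close>
  also have "\<dots> \<le> 2 * (2 ^ s * (2 ^ t * 2 ^ R)) * (9 / 4) ^ s * (8 / 27) ^ R * 4 ^ s"
  proof (intro mult_mono)
    have "(2 ^ m / 2 ^ sum b I :: real) = 2 ^ t * 2 ^ R"
      using le by (simp add: R_def field_simps flip: power_add)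
    then show "Q \<le> 2 ^ s * (2 ^ t * 2 ^ R)"
      using volume_le[of b] by (simp add: Q_def a_def s_def)
    have "(\<Sum>c\<le>Suc M. (3 / 4 :: real) ^ c) \<le> (\<Sum>c. (3 / 4) ^ c)"
      by (rule sum_le_suminf) auto
    also have "\<dots> = 4" by (subst suminf_geometric) auto
    finally have "(\<Prod>i\<in>I. \<Sum>c\<le>Suc M. (3 / 4 :: real) ^ c) \<le> (\<Prod>i\<in>I. 4)"
      by (intro prod_mono conjI sum_nonneg) auto
    then show "(\<Sum>c\<in>I \<rightarrow>\<^sub>E {..Suc M}. \<Prod>i\<in>I. (3 / 4 :: real) ^ c i) \<le> 4 ^ s"
      using fin by (subst (asm) prod_sum_PiE) (simp_all add: s_def)
  qed (auto simp: Q_def intro!: sum_nonneg prod_nonneg mult_nonneg_nonneg)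
  also have "\<dots> = 2 ^ (t + 1) * (2 * (9 / 4) * 4) ^ s * (2 * (8 / 27)) ^ R"
    by (simp only: power_mult_distrib power_add) simp
  finally show ?thesis by (simp add: s_def R_def)
qed


text \<open>Double counting: each point is counted by the grid points that share its prefixes, and
  their number is the same for every point.\<close>

lemma sum_box_points:
  assumes "\<And>i. i \<in> I \<Longrightarrow> a i \<le> M"
  shows "(\<Sum>k\<in>grid. box_points a k) = (2 ^ M) ^ card I * (2 ^ m * (\<Prod>i\<in>I. 1 / 2 ^ a i))"
proof -
  have "(\<Sum>k\<in>grid. box_points a k) = (\<Sum>n<2 ^ m. \<Prod>i\<in>I. \<Sum>k<2 ^ M. same_prefix M (a i) (x i n) k)"
    unfolding box_points_def by (subst sum.swap) (simp add: prod_sum_PiE fin)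
  also have "\<dots> = (\<Sum>n<(2::nat) ^ m. \<Prod>i\<in>I. 2 ^ M * (1 / 2 ^ a i))"
  proof (intro sum.cong prod.cong refl)
    fix n i assume "n \<in> {..<(2::nat) ^ m}" "i \<in> I"
    then have "(\<Sum>k<2 ^ M. same_prefix M (a i) k (x i n)) = 2 ^ M / 2 ^ a i"
      using assms less by (intro sum_same_prefix) auto
    then show "(\<Sum>k<2 ^ M. same_prefix M (a i) (x i n) k) = 2 ^ M * (1 / 2 ^ a i)"
      by (subst same_prefix_commute) simp
  qed
  also have "\<dots> = 2 ^ m * ((2 ^ M) ^ card I * (\<Prod>i\<in>I. 1 / 2 ^ a i))"
    by (simp only: prod.distrib prod_constant sum_constant card_lessThan) simp
  finally show ?thesis by (simp only: mult_ac)
qed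

text \<open>A box too small for exact counting lies in one with \<open>sum b' I = m - t\<close>,
  which is still counted exactly. For t > m the trivial bound by all \<open>2 ^ m\<close> points is
  enough.\<close>

lemma box_points_le:
  assumes b: "b \<in> levels" and k: "k \<in> grid" and ge: "m \<le> sum b I + t"
  shows "box_points (\<lambda>i. b i - 1) k \<le> 2 ^ (t + card I)"
proof (cases "t \<le> m")
  case True
  have "m - t \<le> sum b I" using ge by simp
  from ex_smaller_with_sum[OF fin this] obtain b' where b': "\<forall>i. b' i \<le> b i" "sum b' I = m - t"
    by blast
  have "box_points (\<lambda>i. b i - 1) k \<le> box_points (\<lambda>i. b' i - 1) k"
    unfolding box_points_def using b' by (intro sum_mono prod_mono conjI same_prefix_mono diff_le_mono) auto
  also have "\<dots> = 2 ^ m * (\<Prod>i\<in>I. 1 / 2 ^ (b' i - 1))"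
  proof (rule box_points_exact[of b'])
    fix i assume i: "i \<in> I"
    have "b' i \<le> M" using b' b i by (meson PiE_mem atMost_iff le_trans)
    then show "b' i - 1 \<le> b' i \<and> b' i - 1 \<le> M" by simp
    show "k i < 2 ^ M" using k i by auto
  qed (use b' True in auto)
  also have "\<dots> \<le> 2 ^ card I * (2 ^ m / 2 ^ sum b' I)" by (rule volume_le)
  also have "\<dots> = 2 ^ (t + card I)"
    using b' True by (simp add: power_add power_diff)
  finally show ?thesis .
next
  case False
  have "box_points (\<lambda>i. b i - 1) k \<le> (\<Sum>n<(2::nat) ^ m. 1)"
    unfolding box_points_def by (intro sum_mono prod_le_1) (auto simp: same_prefix_def)
  also have "\<dots> \<le> (2 ^ (t + card I) :: real)" using False by simp
  finally show ?thesis .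
qed

text \<open>On large levels a pointwise bound gives only a constant, which cannot be summed over the
  levels. Instead one factor of \<open>(box_points a k)\<^sup>2\<close> is bounded by the constant T
  and the other is averaged over the grid, which yields the decaying volume Q.\<close>

lemma haar_level_bound:
  assumes b: "b \<in> levels"
  shows "(\<Sum>k\<in>grid. (disc (\<lambda>i y. haar M (b i) y (k i)))\<^sup>2)
    \<le> (2 ^ M) ^ card I * (4 ^ (t + 1) * 324 ^ card I * (1 / 2) ^ ((m - t - sum b I) + (sum b I - (m - t))))"
proof (cases "sum b I + t \<le> m")
  case True
  define R where "R = m - t - sum b I"
  have sq: "(c ^ n)\<^sup>2 = (c\<^sup>2) ^ n" for c :: real and n by (simp add: mult.commute flip: power_mult)
  have "(\<Sum>k\<in>grid. (disc (\<lambda>i y. haar M (b i) y (k i)))\<^sup>2)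
    \<le> (\<Sum>k\<in>grid. 4 ^ (t + 1) * 324 ^ card I * (1 / 2) ^ R)"
  proof (rule sum_mono)
    fix k assume "k \<in> grid"
    then have "\<bar>disc (\<lambda>i y. haar M (b i) y (k i))\<bar>\<^sup>2 \<le> (2 ^ (t + 1) * 18 ^ card I * (16 / 27) ^ R)\<^sup>2"
      using haar_small[OF b _ True] by (intro power_mono) (auto simp: R_def)
    also have "\<dots> = 4 ^ (t + 1) * 324 ^ card I * (256 / 729) ^ R"
      unfolding power_mult_distrib sq by (simp add: power2_eq_square)
    \<comment> \<open>256/729 = (16/27)^2 is below 1/2, the base that small levels share with the
      large ones.\<close>
    also have "\<dots> \<le> 4 ^ (t + 1) * 324 ^ card I * (1 / 2) ^ R"
      by (intro mult_left_mono power_mono) auto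
    finally show "(disc (\<lambda>i y. haar M (b i) y (k i)))\<^sup>2 \<le> 4 ^ (t + 1) * 324 ^ card I * (1 / 2) ^ R" by simp
  qed
  also have "\<dots> = (2 ^ M) ^ card I * (4 ^ (t + 1) * 324 ^ card I * (1 / 2) ^ R)"
    using fin by (simp add: card_PiE)
  finally show ?thesis using True by (simp add: R_def)
next
  case False
  define E where "E = sum b I + t - m"
  define a where "a = (\<lambda>i. b i - 1)"
  define Q :: real where "Q = 2 ^ m * (\<Prod>i\<in>I. 1 / 2 ^ a i)"
  define T :: real where "T = 2 ^ (t + card I)"
  have Q0: "Q \<ge> 0" by (simp add: Q_def prod_nonneg)
  have bM: "b i \<le> M" if "i \<in> I" for i using b that by auto
  then have aM: "a i \<le> M" if "i \<in> I" for i using that by (force simp: a_def)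
  have QT: "Q \<le> T * (1 / 2) ^ E"
  proof -
    have "Q \<le> 2 ^ card I * (2 ^ m / 2 ^ sum b I)" unfolding Q_def a_def by (rule volume_le)
    also have "(2 ^ m / 2 ^ sum b I :: real) = 2 ^ t * (1 / 2) ^ E"
      using False by (simp add: E_def power_divide field_simps flip: power_add)
    finally show ?thesis by (simp add: T_def power_add mult_ac)
  qed
  have E1: "(1 / 2 :: real) ^ E \<le> 1" by (simp add: power_le_one)
  have T1: "T \<ge> 0" by (simp add: T_def)
  have "(\<Sum>k\<in>grid. (disc (\<lambda>i y. haar M (b i) y (k i)))\<^sup>2) \<le> (\<Sum>k\<in>grid. 2 * T * box_points a k + 2 * Q\<^sup>2)"
  proof (rule sum_mono)
    fix k assume k: "k \<in> grid"
    have "\<bar>disc (\<lambda>i y. haar M (b i) y (k i))\<bar> \<le> box_points a k + Q"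
      unfolding Q_def
    proof (rule abs_disc_le)
      fix i and y :: nat assume "i \<in> I" "y < 2 ^ M"
      then show "\<bar>haar M (b i) y (k i)\<bar> \<le> same_prefix M (a i) y (k i)"
        using haar_weight_bounds[of y M "b i"]
        by (simp add: haar_def abs_mult a_def mult_left_le)
    qed (use aM k in auto)
    then have "\<bar>disc (\<lambda>i y. haar M (b i) y (k i))\<bar>\<^sup>2 \<le> (box_points a k + Q)\<^sup>2"
      by (rule power_mono) simp
    also have "\<dots> \<le> 2 * (box_points a k)\<^sup>2 + 2 * Q\<^sup>2"
      using sum_squares_bound[of "box_points a k" Q] by (simp add: power2_sum)
    also have "(box_points a k)\<^sup>2 \<le> T * box_points a k"
      unfolding power2_eq_square T_def a_def
      using box_points_le[OF b k] False by (intro mult_right_mono box_points_nonneg) auto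
    finally show "(disc (\<lambda>i y. haar M (b i) y (k i)))\<^sup>2 \<le> 2 * T * box_points a k + 2 * Q\<^sup>2" by simp
  qed
  also have "\<dots> = 2 * T * ((2 ^ M) ^ card I * Q) + (2 ^ M) ^ card I * (2 * Q\<^sup>2)"
    using sum_box_points[of a] aM fin by (simp add: sum.distrib card_PiE Q_def flip: sum_distrib_left)
  also have "\<dots> = (2 ^ M) ^ card I * (2 * T * Q + 2 * (Q * Q))" by (simp add: algebra_simps power2_eq_square)
  also have "\<dots> \<le> (2 ^ M) ^ card I * (2 * T * (T * (1 / 2) ^ E) + 2 * (T * (T * (1 / 2) ^ E)))"
  proof -
    have "Q \<le> T" using QT E1 T1 by (meson mult_left_le order_trans)
    then have "Q * Q \<le> T * (T * (1 / 2) ^ E)" using QT Q0 T1 by (intro mult_mono) auto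
    moreover have "T * Q \<le> T * (T * (1 / 2) ^ E)" using QT T1 by (rule mult_left_mono)
    ultimately show ?thesis by (intro mult_left_mono) auto
  qed
  also have "\<dots> = (2 ^ M) ^ card I * (4 * (T * T) * (1 / 2) ^ E)" by (simp add: algebra_simps)
  also have "T * T = 4 ^ t * 4 ^ card I"
    unfolding T_def power_mult_distrib[symmetric] by (simp add: power_add)
  \<comment> \<open>For t > m the truncated \<open>m - t\<close> makes the exponent on the right
    smaller than E, so the estimate persists.\<close>
  also have "(2 ^ M) ^ card I * (4 * (4 ^ t * 4 ^ card I) * (1 / 2) ^ E)
     \<le> (2 ^ M) ^ card I * (4 * (4 ^ t * 324 ^ card I) * (1 / 2 :: real) ^ ((m - t - sum b I) + (sum b I - (m - t))))"
    using False by (intro mult_left_mono mult_mono power_mono power_decreasing) (auto simp: E_def)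
  finally show ?thesis by (simp add: mult_ac)
qed

text \<open>By orthogonality the squares of the Haar components add up, and
  \<open>sum_levels_le\<close> is applied with R = m - t.\<close>

theorem mean_square_discrepancy:
  "(\<Sum>k\<in>grid. (disc (\<lambda>i y. of_bool (y \<le> k i)))\<^sup>2)
    \<le> (2 ^ M) ^ card I * (4 ^ (t + 1) * 324 ^ card I * level_const (card I) * real (m + 1) ^ (card I - 1))"
proof -
  have "(\<Sum>k\<in>grid. (disc (\<lambda>i y. of_bool (y \<le> k i)))\<^sup>2)
      = (\<Sum>k\<in>grid. (\<Sum>b\<in>levels. disc (\<lambda>i y. haar M (b i) y (k i)))\<^sup>2)"
  proof (rule sum.cong[OF refl])
    fix k assume k: "k \<in> grid"
    have "disc (\<lambda>i y. of_bool (y \<le> k i)) = disc (\<lambda>i y. \<Sum>b\<le>M. haar M b y (k i))"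
    proof (rule discrepancy_cong[OF less])
      fix i and y :: nat assume "i \<in> I" "y < 2 ^ M"
      moreover from this have "k i < 2 ^ M" using k by auto
      ultimately show "of_bool (y \<le> k i) = (\<Sum>b\<le>M. haar M b y (k i))" by (simp add: sum_haar)
    qed
    then show "(disc (\<lambda>i y. of_bool (y \<le> k i)))\<^sup>2 = (\<Sum>b\<in>levels. disc (\<lambda>i y. haar M (b i) y (k i)))\<^sup>2"
      using fin by (simp add: discrepancy_sum)
  qed
  also have "\<dots> = (\<Sum>b\<in>levels. \<Sum>k\<in>grid. (disc (\<lambda>i y. haar M (b i) y (k i)))\<^sup>2)"
    by (rule sum_power2_orthogonal) (use fin in \<open>auto intro: finite_PiE discrepancy_haar_orthogonal\<close>)
  also have "\<dots> \<le> (\<Sum>b\<in>levels. (2 ^ M) ^ card I * (4 ^ (t + 1) * 324 ^ card I *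
      (1 / 2) ^ ((m - t - sum b I) + (sum b I - (m - t)))))"
    by (intro sum_mono haar_level_bound)
  also have "\<dots> = (2 ^ M) ^ card I * (4 ^ (t + 1) * 324 ^ card I *
      (\<Sum>b\<in>levels. (1 / 2) ^ ((m - t - sum b I) + (sum b I - (m - t)))))"
    by (simp only: sum_distrib_left)
  also have "\<dots> \<le> (2 ^ M) ^ card I * (4 ^ (t + 1) * 324 ^ card I *
      (level_const (card I) * real (m - t + 1) ^ (card I - 1)))"
    by (intro mult_left_mono sum_levels_le fin nonempty) auto
  also have "\<dots> \<le> (2 ^ M) ^ card I * (4 ^ (t + 1) * 324 ^ card I *
      (level_const (card I) * real (m + 1) ^ (card I - 1)))"
  proof -
    have "level_const (card I) \<ge> 0"
      unfolding level_const_def by (intro add_nonneg_nonneg suminf_nonneg summable_poly_geometric) auto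
    then show ?thesis by (intro mult_left_mono power_mono) auto
  qed
  finally show ?thesis by (simp add: mult_ac)
qed

end

section \<open>The interlaced net\<close>

lemma of_nat_bit: "(of_nat n :: bit) = of_bool (odd n)"
  by (induction n) auto

text \<open>Digits are indexed from 1 with the most significant first, so
  \<open>bits_val f m / 2 ^ m\<close> is a binary fraction with digits \<open>f 1\<close>, ...,
  \<open>f m\<close>, and dividing by a power of 2 shortens the prefix.\<close>

fun bits_val :: "(nat \<Rightarrow> bit) \<Rightarrow> nat \<Rightarrow> nat" where
  "bits_val f 0 = 0"
| "bits_val f (Suc m) = 2 * bits_val f m + of_bit (f (Suc m))"

lemma bits_val_less: "bits_val f m < 2 ^ m"
  by (induction m) (auto simp: of_bool_def)

lemma bits_val_div: "a \<le> m \<Longrightarrow> bits_val f m div 2 ^ (m - a) = bits_val f a"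
proof (induction m)
  case (Suc m)
  show ?case
  proof (cases "a = Suc m")
    case False
    then have "Suc m - a = Suc (m - a)" using Suc.prems by simp
    then have "bits_val f (Suc m) div 2 ^ (Suc m - a) = bits_val f (Suc m) div 2 div 2 ^ (m - a)"
      by (simp only: power_Suc div_mult2_eq)
    also have "bits_val f (Suc m) div 2 = bits_val f m" by (simp add: of_bool_def)
    finally show ?thesis using Suc False by simp
  qed simp
qed simp

lemma odd_bits_val: "a \<ge> 1 \<Longrightarrow> odd (bits_val f a) \<longleftrightarrow> odd (f a)"
  by (cases a) auto

lemma odd_bits_val_div: "1 \<le> a \<Longrightarrow> a \<le> m \<Longrightarrow> odd (bits_val f m div 2 ^ (m - a)) \<longleftrightarrow> odd (f a)"
  by (simp add: bits_val_div odd_bits_val)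

lemma bits_val_extend:
  assumes "\<And>k. k > m \<Longrightarrow> f k = 0"
  shows "bits_val f (m + d) = 2 ^ d * bits_val f m"
  by (induction d) (auto simp: assms)

lemma bits_val_sum: "real (bits_val f m) / 2 ^ m = (\<Sum>i<m. of_bit (f (Suc i)) / 2 ^ Suc i)"
proof (induction m)
  case (Suc m)
  have "real (bits_val f (Suc m)) / 2 ^ Suc m = real (bits_val f m) / 2 ^ m + of_bit (f (Suc m)) / 2 ^ Suc m"
    by (simp add: field_simps)
  then show ?case using Suc by simp
qed simp

lemma bits_val_suminf:
  assumes "\<And>k. k > m \<Longrightarrow> f k = 0"
  shows "(\<Sum>i. of_bit (f (Suc i)) / 2 ^ Suc i) = real (bits_val f m) / 2 ^ m"
  unfolding bits_val_sum by (rule suminf_finite) (auto simp: assms)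

lemma dyadic_digit_bits_val:
  assumes "\<And>k. k > m \<Longrightarrow> f k = 0" "a \<ge> 1"
  shows "dyadic_digit (real (bits_val f m) / 2 ^ m) a = of_bit (f a)"
proof -
  \<comment> \<open>Padding with \<open>a\<close> zeros brings position \<open>a\<close> inside the
    expansion even if a > m.\<close>
  define M where "M = m + a"
  have "real (bits_val f m) / 2 ^ m = real (bits_val f M) / 2 ^ M"
    using bits_val_extend[of m f a] assms(1) by (simp add: M_def power_add)
  then have "2 ^ a * (real (bits_val f m) / 2 ^ m) = real (bits_val f M) / real (2 ^ (M - a))"
    by (simp add: M_def power_add)
  then have "\<lfloor>2 ^ a * (real (bits_val f m) / 2 ^ m)\<rfloor> = int (bits_val f M div 2 ^ (M - a))"
    by (simp only: floor_divide_of_nat_eq)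
  also have "bits_val f M div 2 ^ (M - a) = bits_val f a" by (rule bits_val_div) (simp add: M_def)
  finally show ?thesis using odd_bits_val[OF assms(2), of f]
    by (simp add: dyadic_digit_def mod_2_eq_odd)
qed

lemma bits_val_of_nat:
  assumes "n < 2 ^ m"
  shows "bits_val (\<lambda>k. of_nat (n div 2 ^ (m - k))) m = n"
proof -
  have "bits_val (\<lambda>k. of_nat (n div 2 ^ (m - k))) a = n div 2 ^ (m - a)" if "a \<le> m" for a
    using that
  proof (induction a)
    case (Suc a)
    have "m - a = Suc (m - Suc a)" using Suc.prems by simp
    then have "n div 2 ^ (m - a) = n div 2 ^ (m - Suc a) div 2"
      by (simp only: power_Suc2 div_mult2_eq)
    moreover have "2 * (x div 2) + of_bit (of_nat x) = x" for x :: nat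
      by (simp add: of_nat_bit of_bool_odd_eq_mod_2)
    ultimately show ?case using Suc by simp
  qed (use assms in simp)
  from this[of m] show ?thesis by simp
qed

lemma bits_val_cong: "(\<And>k. 1 \<le> k \<Longrightarrow> k \<le> m \<Longrightarrow> f k = g k) \<Longrightarrow> bits_val f m = bits_val g m"
  by (induction m) auto

lemma bits_val_3: "real (bits_val f (3 * m)) / 2 ^ (3 * m) =
  (\<Sum>a<m. \<Sum>r=1..3. of_bit (f (3 * a + r)) / 2 ^ (r + 3 * a))"
proof (induction m)
  case (Suc m)
  have *: "3 * Suc m = Suc (Suc (Suc (3 * m)))" by simp
  have "real (bits_val f (3 * Suc m)) / 2 ^ (3 * Suc m) = real (bits_val f (3 * m)) / 2 ^ (3 * m)
      + (\<Sum>r=1..3. of_bit (f (3 * m + r)) / 2 ^ (r + 3 * m))"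
    unfolding * by (simp add: numeral_3_eq_3 field_simps power_add)
  then show ?case using Suc by simp
qed simp

text \<open>Component 1 is \<open>n / 2 ^ m\<close>, whose digits are those of \<open>n\<close> in reverse order: an antidiagonal matrix.\<close>

definition net_row :: "(nat \<Rightarrow> bit poly) \<Rightarrow> nat \<Rightarrow> nat \<Rightarrow> nat \<Rightarrow> nat \<Rightarrow> bit" where
  "net_row q m j k l =
     (if j = 1 then of_bool (k + l = m + 1) else sobol_matrix (sobol_poly q (j - 1)) k l)"

definition net_digit :: "(nat \<Rightarrow> bit poly) \<Rightarrow> nat \<Rightarrow> nat \<Rightarrow> nat \<Rightarrow> nat \<Rightarrow> bit" where
  "net_digit q m n j k = (\<Sum>l=1..m. net_row q m j k l * of_nat (n div 2 ^ (l - 1)))"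

text \<open>Inverts u = 3 (k - 1) + r: interlaced digit u is digit k of the r-th component belonging
  to coordinate i.\<close>

definition interlaced_digit :: "(nat \<Rightarrow> bit poly) \<Rightarrow> nat \<Rightarrow> nat \<Rightarrow> nat \<Rightarrow> nat \<Rightarrow> bit" where
  "interlaced_digit q m i n u = net_digit q m n (3 * (i - 1) + (u - 1) mod 3 + 1) ((u - 1) div 3 + 1)"

definition interlaced_val :: "(nat \<Rightarrow> bit poly) \<Rightarrow> nat \<Rightarrow> nat \<Rightarrow> nat \<Rightarrow> nat" where
  "interlaced_val q m i n = bits_val (interlaced_digit q m i n) (3 * m)"

section \<open>Linear independence of the matrix rows of the net\<close>

lemma sobol_poly_irreducible:
  assumes "primitive_listing q" "j \<ge> 1"
  shows "irreducible (sobol_poly q j)"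
proof (cases "j = 1")
  case True
  have "irreducible [:0, 1 :: bit:]" by (rule irreducible_linear_field_poly) simp
  then show ?thesis using True by (simp add: sobol_poly_def)
next
  case False
  then have "q (j - 1) \<in> q ` {1..}" using assms by (intro imageI) auto
  then show ?thesis using assms False
    by (auto simp: sobol_poly_def primitive_listing_def bij_betw_def primitive_poly_def)
qed

text \<open>A primitive polynomial does not divide x, so the additional polynomial x is absent from
  the listing.\<close>

lemma sobol_poly_inj:
  assumes "primitive_listing q"
  shows "inj_on (sobol_poly q) {1..}"
proof (rule inj_onI)
  have prim: "primitive_poly (q i)" if "i \<ge> 1" for i
    using assms that by (auto simp: primitive_listing_def bij_betw_def)
  then have ne: "q i \<noteq> [:0, 1:]" if "i \<ge> 1" for i
    using that by (metis dvd_refl primitive_poly_def)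
  have inj: "inj_on q {1..}" using assms by (simp add: primitive_listing_def bij_betw_def)
  fix i j assume ij: "i \<in> {1..}" "j \<in> {1..}" "sobol_poly q i = sobol_poly q j"
  have one: "j = 1" if "sobol_poly q 1 = sobol_poly q j" "j \<ge> 1" for j
  proof (rule ccontr)
    assume "j \<noteq> 1"
    then have "j - 1 \<ge> 1" using that by simp
    then show False using ne[of "j - 1"] that \<open>j \<noteq> 1\<close> by (simp add: sobol_poly_def)
  qed
  show "i = j"
  proof (cases "i = 1 \<or> j = 1")
    case True
    then show ?thesis using one[of i] one[of j] ij by auto
  next
    case False
    then have "i - 1 = j - 1" using ij by (intro inj_onD[OF inj]) (auto simp: sobol_poly_def)
    then show ?thesis using False ij by auto
  qed
qed

lemma sobol_poly_degree: "primitive_listing q \<Longrightarrow> j \<ge> 1 \<Longrightarrow> degree (sobol_poly q j) \<ge> 1"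
  by (rule irreducible_bit_poly_degree[OF sobol_poly_irreducible])

text \<open>If a Sobol' component takes part, its combined rows are nonzero in some column l <= m -
  d 1, where the antidiagonal rows k <= d 1 all vanish. Otherwise only antidiagonal rows remain, and
  these are distinct unit vectors.\<close>

lemma net_row_independent:
  assumes q: "primitive_listing q" and J: "finite J" "J \<subseteq> {1..}"
    and K: "\<And>j. j \<in> J \<Longrightarrow> K j \<subseteq> {1..d j}" and ne: "\<exists>j\<in>J. K j \<noteq> {}"
    and le: "sum d J + (\<Sum>j\<in>J-{1}. degree (sobol_poly q (j - 1)) - 1) \<le> m"
  shows "\<exists>l\<in>{1..m}. (\<Sum>j\<in>J. \<Sum>k\<in>K j. net_row q m j k l) \<noteq> 0"
proof (cases "\<exists>j\<in>J-{1}. K j \<noteq> {}")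
  case True
  define p where "p = (\<lambda>j. sobol_poly q (j - 1))"
  obtain j0 where j0: "j0 \<in> J - {1}" "K j0 \<noteq> {}" using True by blast
  have "\<exists>l\<in>{1..(\<Sum>j\<in>J-{1}. d j + degree (p j) - 1)}.
      (\<Sum>j\<in>J-{1}. \<Sum>k\<in>K j. sobol_matrix (p j) k l) \<noteq> 0"
  proof (rule sobol_rows_independent)
    show "inj_on p (J - {1})"
    proof (rule inj_onI)
      fix i j assume ij: "i \<in> J - {1}" "j \<in> J - {1}" "p i = p j"
      then have "i \<ge> 2" "j \<ge> 2" using J by fastforce+
      then have "i - 1 = j - 1"
        using ij by (intro inj_onD[OF sobol_poly_inj[OF q]]) (auto simp: p_def)
      then show "i = j" using \<open>i \<ge> 2\<close> \<open>j \<ge> 2\<close> by simp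
    qed
    show "irreducible (p j)" if "j \<in> J - {1}" for j
    proof -
      have "j \<ge> 2" using that J by fastforce
      then show ?thesis using sobol_poly_irreducible[OF q, of "j - 1"] by (simp add: p_def)
    qed
  qed (use J K j0 in auto)
  then obtain l where l: "1 \<le> l" "l \<le> (\<Sum>j\<in>J-{1}. d j + degree (p j) - 1)"
    and nz: "(\<Sum>j\<in>J-{1}. \<Sum>k\<in>K j. sobol_matrix (p j) k l) \<noteq> 0" by auto
  have "(\<Sum>j\<in>J-{1}. d j + degree (p j) - 1) = sum d (J - {1}) + (\<Sum>j\<in>J-{1}. degree (p j) - 1)"
  proof -
    have "degree (p j) \<ge> 1" if "j \<in> J - {1}" for j
    proof -
      have "j \<ge> 2" using that J by fastforce
      then show ?thesis using sobol_poly_degree[OF q, of "j - 1"] by (simp add: p_def)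
    qed
    then show ?thesis by (simp flip: sum.distrib)
  qed
  note l' = l(2)[unfolded this]
  have rest: "(\<Sum>j\<in>J-{1}. \<Sum>k\<in>K j. net_row q m j k l) = (\<Sum>j\<in>J-{1}. \<Sum>k\<in>K j. sobol_matrix (p j) k l)"
    by (intro sum.cong) (auto simp: net_row_def p_def)
  have "(\<Sum>j\<in>J. \<Sum>k\<in>K j. net_row q m j k l) \<noteq> 0 \<and> l \<le> m"
  proof (cases "1 \<in> J")
    case True
    have J1: "sum d J = d 1 + sum d (J - {1})" using J True by (simp add: sum.remove)
    then have lm: "l + d 1 \<le> m" using l' le by (simp add: p_def)
    have "(\<Sum>k\<in>K 1. net_row q m 1 k l) = 0"
    proof (rule sum.neutral, rule ballI)
      fix k assume "k \<in> K 1"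
      then have "k \<le> d 1" using K[OF True] by auto
      then show "net_row q m 1 k l = 0" using lm by (simp add: net_row_def)
    qed
    then have "(\<Sum>j\<in>J. \<Sum>k\<in>K j. net_row q m j k l) = (\<Sum>j\<in>J-{1}. \<Sum>k\<in>K j. net_row q m j k l)"
      using sum.remove[OF J(1) True, of "\<lambda>j. \<Sum>k\<in>K j. net_row q m j k l"] by simp
    then show ?thesis using nz rest lm by simp
  next
    case False
    then have "J - {1} = J" by blast
    then show ?thesis using nz rest l' le by (simp add: p_def)
  qed
  then show ?thesis using l by auto
next
  case False
  then obtain k where k: "1 \<in> J" "k \<in> K 1" using ne by blast
  then have "k \<in> {1..d 1}" using K by blast
  moreover have "d 1 \<le> sum d J" using J k by (intro member_le_sum) auto
  ultimately have km: "1 \<le> k" "k \<le> m" using le by auto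
  define l where "l = m + 1 - k"
  have "(\<Sum>j\<in>J. \<Sum>k\<in>K j. net_row q m j k l) = (\<Sum>k\<in>K 1. net_row q m 1 k l)"
    using sum.remove[OF J(1) k(1), of "\<lambda>j. \<Sum>k\<in>K j. net_row q m j k l"] False by simp
  also have "\<dots> = (\<Sum>k'\<in>K 1. if k' = k then 1 else 0)"
    using km by (intro sum.cong) (auto simp: net_row_def l_def)
  also have "\<dots> = 1" using k K[OF k(1)] finite_subset[of "K 1" "{1..d 1}"] by simp
  finally show ?thesis using km by (intro bexI[of _ l]) (auto simp: l_def)
qed

section \<open>The additive character of F_2 and character sums over the net\<close>

definition bit_sign :: "bit \<Rightarrow> real" where "bit_sign b = (if odd b then - 1 else 1)"

lemma bit_sign_0 [simp]: "bit_sign 0 = 1"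
  by (simp add: bit_sign_def)

lemma bit_sign_add: "bit_sign (a + b) = bit_sign a * bit_sign b"
  by (auto simp: bit_sign_def)

lemma bit_sign_sum: "bit_sign (sum f S) = (\<Prod>x\<in>S. bit_sign (f x))"
  by (induction S rule: infinite_finite_induct) (simp_all add: bit_sign_add)

lemma sum_lessThan_add: "(\<Sum>n<a + b. f n) = (\<Sum>n<a. f n) + (\<Sum>n<b. f (a + n))" for f :: "nat \<Rightarrow> 'a::comm_monoid_add"
  by (induction b) (auto simp: add.assoc)

text \<open>The binary digits of n vary independently, so the sum factorises with one factor per
  column. It vanishes as soon as some \<open>\<rho> l\<close> is 1.\<close>

lemma sum_bit_sign:
  "(\<Sum>n<2 ^ m. \<Prod>l=1..m. bit_sign (\<rho> l * of_nat (n div 2 ^ (l - 1)))) = (\<Prod>l=1..m. 1 + bit_sign (\<rho> l))"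
proof (induction m)
  case (Suc m)
  define g where "g = (\<lambda>n. \<Prod>l=1..m. bit_sign (\<rho> l * of_nat (n div 2 ^ (l - 1))))"
  have shift: "g (2 ^ m + n) = g n" for n
    unfolding g_def
  proof (rule prod.cong[OF refl])
    fix l assume l: "l \<in> {1..m}"
    have "(2::nat) ^ m = 2 ^ (l - 1) * (2 * 2 ^ (m - l))"
      using l by (simp flip: power_Suc power_add)
    then have "(2 ^ m + n) div 2 ^ (l - 1) = 2 * 2 ^ (m - l) + n div 2 ^ (l - 1)" by simp
    then show "bit_sign (\<rho> l * of_nat ((2 ^ m + n) div 2 ^ (l - 1))) = bit_sign (\<rho> l * of_nat (n div 2 ^ (l - 1)))"
      by simp
  qed
  have "(\<Sum>n<2 ^ Suc m. \<Prod>l=1..Suc m. bit_sign (\<rho> l * of_nat (n div 2 ^ (l - 1))))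
      = (\<Sum>n<2 ^ m + 2 ^ m. g n * bit_sign (\<rho> (Suc m) * of_nat (n div 2 ^ m)))"
    by (simp add: g_def mult_2)
  also have "\<dots> = (\<Sum>n<2 ^ m. g n) + (\<Sum>n<2 ^ m. g n * bit_sign (\<rho> (Suc m)))"
    unfolding sum_lessThan_add by (intro arg_cong2[of _ _ _ _ plus] sum.cong) (auto simp: shift bit_sign_def)
  also have "\<dots> = (\<Sum>n<2 ^ m. g n) * (1 + bit_sign (\<rho> (Suc m)))"
    by (simp add: distrib_left sum_distrib_right)
  finally show ?case using Suc by (simp add: g_def)
qed simp

lemma psi_interlaced_val:
  assumes "1 \<le> u" "u \<le> 3 * m"
  shows "psi (3 * m) u (interlaced_val q m i n) = bit_sign (interlaced_digit q m i n u)"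
  using odd_bits_val_div[OF assms] by (simp add: psi_def interlaced_val_def bit_sign_def)

lemma sum_group3:
  "(\<Sum>j=1..3 * s. f ((j - 1) div 3 + 1) ((j - 1) mod 3 + 1)) = (\<Sum>i=1..s. \<Sum>r=1..3. f i r)"
  for f :: "nat \<Rightarrow> nat \<Rightarrow> 'a::comm_monoid_add"
proof (induction s)
  case (Suc s)
  define g where "g = (\<lambda>j. f ((j - 1) div 3 + 1) ((j - 1) mod 3 + 1))"
  have gS: "g (Suc j) = f (j div 3 + 1) (j mod 3 + 1)" for j by (simp only: g_def diff_Suc_1)
  have "3 * s div 3 + 1 = Suc s" "Suc (3 * s) div 3 + 1 = Suc s" "Suc (Suc (3 * s)) div 3 + 1 = Suc s"
    "3 * s mod 3 + 1 = 1" "Suc (3 * s) mod 3 + 1 = 2" "Suc (Suc (3 * s)) mod 3 + 1 = 3"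
    by presburger+
  then have g: "g (Suc (3 * s)) = f (Suc s) 1" "g (Suc (Suc (3 * s))) = f (Suc s) 2"
    "g (Suc (Suc (Suc (3 * s)))) = f (Suc s) 3"
    by (simp_all only: gS)
  have S3: "3 * Suc s = Suc (Suc (Suc (3 * s)))" by simp
  have "(\<Sum>j=1..3 * Suc s. g j) = (\<Sum>j=1..3 * s. g j) + (f (Suc s) 1 + (f (Suc s) 2 + f (Suc s) 3))"
    unfolding S3 by (simp add: g add.assoc)
  moreover have "{1..3::nat} = {1, 2, 3}" by auto
  then have "(\<Sum>r=1..3. f (Suc s) r) = f (Suc s) 1 + (f (Suc s) 2 + f (Suc s) 3)" by simp
  ultimately show ?case using Suc by (simp add: g_def)
qed simp

text \<open>The summands count how many of the first b interlaced digits belong to each of the three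
  components.\<close>

lemma sum_thirds: "(b + 2) div 3 + (b + 1) div 3 + b div 3 = (b :: nat)"
proof (induction b)
  case (Suc b)
  have "(Suc b + 2) div 3 = b div 3 + 1" by simp
  then show ?case using Suc by simp
qed simp

text \<open>A character of the interlaced points selects rows of the 3s matrices. The first
  \<open>b i\<close> digits of coordinate i reach depths in its three components that add up to
  \<open>b i\<close>, and the extra digit deepens one of them by at most \<open>c i / 3\<close>
  rounded up. So the rows fit into the budget of \<open>net_row_independent\<close>, and their sum
  is nonzero in some column.\<close>

lemma interlaced_dual:
  assumes q: "primitive_listing q"
    and t: "(\<Sum>j\<in>{1..3 * s}-{1}. degree (sobol_poly q (j - 1)) - 1) \<le> t"
    and le: "sum b {1..s} + (\<Sum>i=1..s. (c i + 2) div 3) + t \<le> m"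
    and F: "\<And>i. i \<in> {1..s} \<Longrightarrow> F i \<subseteq> {1..3 * m} \<inter> ({1..b i} \<union> {b i + c i})"
    and ne: "\<exists>i\<in>{1..s}. F i \<noteq> {}"
  shows "(\<Sum>n<2 ^ m. \<Prod>i\<in>{1..s}. walsh (3 * m) (F i) (interlaced_val q m i n)) = 0"
proof -
  define J where "J = {1..3 * s}"
  define K where "K = (\<lambda>j. {k. 1 \<le> k \<and> 3 * (k - 1) + (j - 1) mod 3 + 1 \<in> F ((j - 1) div 3 + 1)})"
  \<comment> \<open>Component r owns \<open>(b i + 3 - r) div 3\<close> of the first
    \<open>b i\<close> digits. Only the owner of digit \<open>b i + c i\<close> can reach
    deeper.\<close>
  define e where "e = (\<lambda>i r. (b i + 3 - r) div 3 + (if r = (b i + c i - 1) mod 3 + 1 then (c i + 2) div 3 else 0))"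
  define d where "d = (\<lambda>j. e ((j - 1) div 3 + 1) ((j - 1) mod 3 + 1))"
  have finF: "finite (F i)" if "i \<in> {1..s}" for i
    using F[OF that] by (meson finite_Int finite_atLeastAtMost finite_subset)
  have K: "K j \<subseteq> {1..d j}" if "j \<in> J" for j
  proof
    fix k assume k: "k \<in> K j"
    define i r where "i = (j - 1) div 3 + 1" and "r = (j - 1) mod 3 + 1"
    define u where "u = 3 * (k - 1) + r"
    have r: "1 \<le> r" "r \<le> 3" by (auto simp: r_def)
    have i: "i \<in> {1..s}" using that by (auto simp: J_def i_def)
    have k1: "1 \<le> k" and "u \<in> F i" using k by (auto simp: K_def u_def i_def r_def)
    then have u: "u \<le> b i \<or> u = b i + c i" using F[OF i] by auto
    have "k \<le> e i r"
    proof (cases "u \<le> b i")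
      case True
      then have "3 * k \<le> b i + 3 - r" using k1 r by (simp add: u_def)
      then have "k \<le> (b i + 3 - r) div 3" by simp
      then show ?thesis by (simp add: e_def)
    next
      case False
      then have u: "u = b i + c i" using u by simp
      then have "(b i + c i - 1) mod 3 = (3 * (k - 1) + (r - 1)) mod 3" using r by (simp add: u_def flip: u)
      also have "\<dots> = r - 1" using r by (subst mod_mult_self4) simp
      finally have rr: "r = (b i + c i - 1) mod 3 + 1" using r by simp
      have "3 * k + r = b i + c i + 3" using u k1 by (simp add: u_def)
      moreover have "c i \<le> 3 * ((c i + 2) div 3)" by presburger
      ultimately have "3 * (k - (c i + 2) div 3) \<le> b i + 3 - r" using r by linarith
      then have "k - (c i + 2) div 3 \<le> (b i + 3 - r) div 3" by simp
      then have "k \<le> (b i + 3 - r) div 3 + (c i + 2) div 3" by linarith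
      then show ?thesis using rr by (simp add: e_def)
    qed
    then show "k \<in> {1..d j}" using k1 by (simp add: d_def i_def r_def)
  qed
  have reindex: "(\<Sum>i\<in>{1..s}. \<Sum>u\<in>F i. g (3 * (i - 1) + (u - 1) mod 3 + 1) ((u - 1) div 3 + 1))
      = (\<Sum>j\<in>J. \<Sum>k\<in>K j. g j k)" for g :: "nat \<Rightarrow> nat \<Rightarrow> bit"
  proof -
    have "(\<Sum>i\<in>{1..s}. \<Sum>u\<in>F i. g (3 * (i - 1) + (u - 1) mod 3 + 1) ((u - 1) div 3 + 1))
      = (\<Sum>(i, u)\<in>Sigma {1..s} F. g (3 * (i - 1) + (u - 1) mod 3 + 1) ((u - 1) div 3 + 1))"
      using finF by (intro sum.Sigma) auto
    also have "\<dots> = (\<Sum>(j, k)\<in>Sigma J K. g j k)"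
    proof (rule sum.reindex_bij_witness[of _ "\<lambda>(j, k). ((j - 1) div 3 + 1, 3 * (k - 1) + (j - 1) mod 3 + 1)"
          "\<lambda>(i, u). (3 * (i - 1) + (u - 1) mod 3 + 1, (u - 1) div 3 + 1)"])
      fix a assume "a \<in> Sigma {1..s} F"
      then obtain i u where a: "a = (i, u)" "1 \<le> i" "i \<le> s" "u \<in> F i" by auto
      then have u: "1 \<le> u" using F[of i] by auto
      have 1: "(3 * (i - 1) + (u - 1) mod 3) div 3 = i - 1" "(3 * (i - 1) + (u - 1) mod 3) mod 3 = (u - 1) mod 3"
        by auto
      have 2: "3 * ((u - 1) div 3) + (u - 1) mod 3 + 1 = u" using u by simp
      show "(case case a of (i, u) \<Rightarrow> (3 * (i - 1) + (u - 1) mod 3 + 1, (u - 1) div 3 + 1) of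
          (j, k) \<Rightarrow> ((j - 1) div 3 + 1, 3 * (k - 1) + (j - 1) mod 3 + 1)) = a"
        using a 1 2 by simp
      have "3 * (i - 1) + (u - 1) mod 3 + 1 \<le> 3 * s"
      proof -
        have "(u - 1) mod 3 \<le> 2" by simp
        then show ?thesis using a by linarith
      qed
      then show "(case a of (i, u) \<Rightarrow> (3 * (i - 1) + (u - 1) mod 3 + 1, (u - 1) div 3 + 1)) \<in> Sigma J K"
        using a 1 2 by (simp add: J_def K_def)
    next
      fix a assume "a \<in> Sigma J K"
      then obtain j k where a: "a = (j, k)" "1 \<le> j" "j \<le> 3 * s" "1 \<le> k"
        "3 * (k - 1) + (j - 1) mod 3 + 1 \<in> F ((j - 1) div 3 + 1)" by (auto simp: J_def K_def)
      have 1: "(3 * (k - 1) + (j - 1) mod 3) div 3 = k - 1" "(3 * (k - 1) + (j - 1) mod 3) mod 3 = (j - 1) mod 3"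
        by auto
      have 2: "3 * ((j - 1) div 3) + (j - 1) mod 3 + 1 = j" using a by simp
      show "(case case a of (j, k) \<Rightarrow> ((j - 1) div 3 + 1, 3 * (k - 1) + (j - 1) mod 3 + 1) of
          (i, u) \<Rightarrow> (3 * (i - 1) + (u - 1) mod 3 + 1, (u - 1) div 3 + 1)) = a"
        using a 1 2 by simp
      show "(case a of (j, k) \<Rightarrow> ((j - 1) div 3 + 1, 3 * (k - 1) + (j - 1) mod 3 + 1)) \<in> Sigma {1..s} F"
        using a by auto
    qed auto
    also have "\<dots> = (\<Sum>j\<in>J. \<Sum>k\<in>K j. g j k)"
      using finite_subset[OF K] by (intro sum.Sigma[symmetric]) (auto simp: J_def)
    finally show ?thesis .
  qed
  have ne': "\<exists>j\<in>J. K j \<noteq> {}"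
  proof -
    obtain i u where iu: "i \<in> {1..s}" "u \<in> F i" using ne by blast
    define j where "j = 3 * (i - 1) + (u - 1) mod 3 + 1"
    have "1 \<le> u" using iu F by fastforce
    then have "(u - 1) div 3 + 1 \<in> K j" using iu by (simp add: K_def j_def)
    moreover have "(u - 1) mod 3 \<le> 2" by simp
    then have "j \<in> J" using iu(1) unfolding J_def j_def atLeastAtMost_iff by linarith
    ultimately show ?thesis by blast
  qed
  have "sum d J = (\<Sum>i=1..s. \<Sum>r=1..3. e i r)" unfolding d_def J_def by (rule sum_group3)
  also have "\<dots> = (\<Sum>i=1..s. b i + (c i + 2) div 3)"
  proof (rule sum.cong[OF refl])
    fix i
    define x where "x = (b i + c i - 1) mod 3"
    have "x < 3" by (simp add: x_def)
    then have x: "x = 0 \<or> x = 1 \<or> x = 2" by linarith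
    have "(\<Sum>r=1..3. e i r) = e i 1 + (e i 2 + e i 3)" by (simp add: numeral_3_eq_3 numeral_2_eq_2)
    also have "\<dots> = (b i + 2) div 3 + (b i + 1) div 3 + b i div 3 + (c i + 2) div 3"
      using x unfolding e_def x_def[symmetric] by (elim disjE) simp_all
    also have "\<dots> = b i + (c i + 2) div 3" by (simp only: sum_thirds)
    finally show "(\<Sum>r=1..3. e i r) = b i + (c i + 2) div 3" .
  qed
  finally have "sum d J + (\<Sum>j\<in>J-{1}. degree (sobol_poly q (j - 1)) - 1) \<le> m"
    using le t by (simp add: sum.distrib J_def)
  from net_row_independent[OF q _ _ K ne' this] obtain l0
    where l0: "l0 \<in> {1..m}" "(\<Sum>j\<in>J. \<Sum>k\<in>K j. net_row q m j k l0) \<noteq> 0"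
    by (auto simp: J_def)
  \<comment> \<open>The sum of all selected rows, which is nonzero in column \<open>l0\<close>; the
    character depends on n through it alone.\<close>
  define \<rho> where "\<rho> = (\<lambda>l. \<Sum>j\<in>J. \<Sum>k\<in>K j. net_row q m j k l)"
  have "(\<Prod>i\<in>{1..s}. walsh (3 * m) (F i) (interlaced_val q m i n))
      = (\<Prod>l=1..m. bit_sign (\<rho> l * of_nat (n div 2 ^ (l - 1))))" for n
  proof -
    have "(\<Prod>i\<in>{1..s}. walsh (3 * m) (F i) (interlaced_val q m i n))
      = (\<Prod>i\<in>{1..s}. \<Prod>u\<in>F i. bit_sign (interlaced_digit q m i n u))"
      unfolding walsh_def
      by (intro prod.cong refl psi_interlaced_val) (use F in fastforce)+
    also have "\<dots> = bit_sign (\<Sum>i\<in>{1..s}. \<Sum>u\<in>F i. interlaced_digit q m i n u)"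
      by (simp add: bit_sign_sum)
    also have "(\<Sum>i\<in>{1..s}. \<Sum>u\<in>F i. interlaced_digit q m i n u) = (\<Sum>j\<in>J. \<Sum>k\<in>K j. net_digit q m n j k)"
      unfolding interlaced_digit_def by (rule reindex)
    also have "\<dots> = (\<Sum>j\<in>J. \<Sum>l=1..m. \<Sum>k\<in>K j. net_row q m j k l * of_nat (n div 2 ^ (l - 1)))"
      unfolding net_digit_def by (rule sum.cong[OF refl], rule sum.swap)
    also have "\<dots> = (\<Sum>l=1..m. \<Sum>j\<in>J. \<Sum>k\<in>K j. net_row q m j k l * of_nat (n div 2 ^ (l - 1)))"
      by (rule sum.swap)
    also have "\<dots> = (\<Sum>l=1..m. \<rho> l * of_nat (n div 2 ^ (l - 1)))"
      by (simp add: \<rho>_def sum_distrib_right)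
    finally show ?thesis by (simp add: bit_sign_sum)
  qed
  then have "(\<Sum>n<2 ^ m. \<Prod>i\<in>{1..s}. walsh (3 * m) (F i) (interlaced_val q m i n))
      = (\<Prod>l=1..m. 1 + bit_sign (\<rho> l))"
    by (simp only: sum_bit_sign)
  also have "\<dots> = 0"
  proof (rule prod_zero)
    show "\<exists>l\<in>{1..m}. 1 + bit_sign (\<rho> l) = 0"
      using l0 by (intro bexI[of _ l0]) (auto simp: \<rho>_def bit_sign_def)
  qed simp
  finally show ?thesis .
qed

text \<open>Triangularity leaves row k > m without entries in the first m columns, and the
  antidiagonal has no such row. So every component terminates after m digits.\<close>

lemma net_digit_beyond:
  assumes "primitive_listing q" "k > m" "j \<ge> 1"
  shows "net_digit q m n j k = 0"
  unfolding net_digit_def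
proof (rule sum.neutral, rule ballI)
  fix l assume l: "l \<in> {1..m}"
  have "sobol_matrix (sobol_poly q (j - 1)) k l = 0" if "j \<noteq> 1"
    using that assms l sobol_poly_degree[OF assms(1), of "j - 1"]
    by (intro sobol_matrix_upper_triangular) auto
  then show "net_row q m j k l * of_nat (n div 2 ^ (l - 1)) = 0"
    using l assms by (simp add: net_row_def)
qed

lemma sobol_point_eq:
  assumes q: "primitive_listing q" and n: "n < 2 ^ m" and j: "j \<in> {1..3 * s}"
  shows "sobol_point q s m n j = real (bits_val (net_digit q m n j) m) / 2 ^ m"
proof (cases "j = 1")
  case True
  have "bits_val (net_digit q m n j) m = bits_val (\<lambda>k. of_nat (n div 2 ^ (m - k))) m"
  proof (rule bits_val_cong)
    fix k assume k: "1 \<le> k" "k \<le> m"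
    have "net_digit q m n j k = (\<Sum>l=1..m. if l = m + 1 - k then of_nat (n div 2 ^ (l - 1)) else 0)"
      unfolding net_digit_def using k True by (intro sum.cong) (auto simp: net_row_def)
    also have "\<dots> = of_nat (n div 2 ^ (m + 1 - k - 1))" using k by (subst sum.delta) auto
    finally show "net_digit q m n j k = of_nat (n div 2 ^ (m - k))" by simp
  qed
  then show ?thesis using True j by (simp add: sobol_point_def bits_val_of_nat[OF n])
next
  case False
  define C where "C = sobol_matrix (sobol_poly q (j - 1))"
  have zero: "n div 2 ^ (l - 1) = 0" if "m < l" for l
  proof -
    have "(2::nat) ^ m \<le> 2 ^ (l - 1)" using that by (intro power_increasing) auto
    then have "n < 2 ^ (l - 1)" using n by linarith
    then show ?thesis by simp
  qed
  have zero': "n div 2 ^ (l - 1) = 0" if "n < l" for l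
  proof -
    have "n < 2 ^ n" by (rule less_exp)
    also have "(2::nat) ^ n \<le> 2 ^ (l - 1)" using that by (intro power_increasing) auto
    finally show ?thesis by simp
  qed
  \<comment> \<open>\<open>digital_digit\<close> sums over n columns and \<open>net_digit\<close>
    over m. Beyond either bound n has no digits, so both agree with the sum over n + m
    columns.\<close>
  have dd: "digital_digit C n = net_digit q m n j"
  proof
    fix k
    have "digital_digit C n k = (\<Sum>l=1..n + m. C k l * of_nat (n div 2 ^ (l - 1)))"
      unfolding digital_digit_def by (rule sum.mono_neutral_left) (use zero' in auto)
    also have "\<dots> = (\<Sum>l=1..m. C k l * of_nat (n div 2 ^ (l - 1)))"
      by (rule sum.mono_neutral_right) (use zero in auto)
    also have "\<dots> = net_digit q m n j k" using False by (simp add: net_digit_def net_row_def C_def)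
    finally show "digital_digit C n k = net_digit q m n j k" .
  qed
  have "digital_coord C n = real (bits_val (net_digit q m n j) m) / 2 ^ m"
    unfolding digital_coord_def dd by (rule bits_val_suminf) (use j in \<open>auto intro: net_digit_beyond[OF q]\<close>)
  then show ?thesis using False j by (simp add: sobol_point_def C_def)
qed

lemma div_mod_3:
  fixes a r :: nat
  assumes "r \<in> {1..3}"
  shows "(3 * a + r - 1) div 3 = a" "(3 * a + r - 1) mod 3 = r - 1"
proof -
  have eq: "3 * a + r - 1 = r - 1 + 3 * a" and "r - 1 < 3" using assms by auto
  then show "(3 * a + r - 1) div 3 = a" "(3 * a + r - 1) mod 3 = r - 1" unfolding eq by simp_all
qed

lemma interlace3_vec_sobol_point:
  assumes q: "primitive_listing q" and n: "n < 2 ^ m" and i: "i \<in> {1..s}"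
  shows "interlace3_vec s (sobol_point q s m n) i = real (interlaced_val q m i n) / 2 ^ (3 * m)"
proof -
  define f where "f = interlaced_digit q m i n"
  have dig: "dyadic_digit (sobol_point q s m n (3 * (i - 1) + r)) (Suc a) = of_bit (f (3 * a + r))"
    if r: "r \<in> {1..3}" for r a
  proof -
    have j: "3 * (i - 1) + r \<in> {1..3 * s}" using i r by auto
    have "3 * (i - 1) + (3 * a + r - 1) mod 3 + 1 = 3 * (i - 1) + r" "(3 * a + r - 1) div 3 + 1 = Suc a"
      using r by (simp_all only: div_mod_3) auto
    then have "f (3 * a + r) = net_digit q m n (3 * (i - 1) + r) (Suc a)"
      by (simp only: f_def interlaced_digit_def)
    then show ?thesis unfolding sobol_point_eq[OF q n j]
      by (subst dyadic_digit_bits_val) (use j in \<open>auto intro: net_digit_beyond[OF q]\<close>)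
  qed
  have "interlace3 (\<lambda>r. sobol_point q s m n (3 * (i - 1) + r))
      = (\<Sum>a. \<Sum>r=1..3. of_bit (f (3 * a + r)) / 2 ^ (r + 3 * a))"
  proof -
    have "(\<Sum>r=1..3. of_int (dyadic_digit (sobol_point q s m n (3 * (i - 1) + r)) (Suc a)) / 2 ^ (r + 3 * a))
        = (\<Sum>r=1..3. of_bit (f (3 * a + r)) / (2 ^ (r + 3 * a) :: real))" for a
      by (intro sum.cong refl) (simp only: dig of_int_of_bool)
    then show ?thesis unfolding interlace3_def by (simp only:)
  qed
  also have "\<dots> = (\<Sum>a<m. \<Sum>r=1..3. of_bit (f (3 * a + r)) / 2 ^ (r + 3 * a))"
  proof (rule suminf_finite)
    fix a assume "a \<notin> {..<m}"
    have "f (3 * a + r) = 0" if r: "r \<in> {1..3}" for r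
    proof -
      have "(3 * a + r - 1) div 3 + 1 = Suc a" using r by (simp only: div_mod_3)
      then show ?thesis using \<open>a \<notin> {..<m}\<close>
        unfolding f_def interlaced_digit_def by (intro net_digit_beyond[OF q]) auto
    qed
    then show "(\<Sum>r=1..3. of_bit (f (3 * a + r)) / 2 ^ (r + 3 * a)) = (0::real)" by simp
  qed simp
  also have "\<dots> = real (interlaced_val q m i n) / 2 ^ (3 * m)"
    unfolding interlaced_val_def f_def by (rule bits_val_3[symmetric])
  finally show ?thesis using i by (simp add: interlace3_vec_def)
qed

text \<open>Modulo x + 1 the only nonzero residue class is 1 = x^0, and divisibility by x + 1 is a
  root at 1.\<close>

lemma primitive_poly_X_plus_1: "primitive_poly [:1, 1:]"
  unfolding primitive_poly_def
proof (intro conjI allI impI)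
  have dvd: "[:1, 1:] dvd p \<longleftrightarrow> poly p 1 = 0" for p :: "bit poly"
    using poly_eq_0_iff_dvd[of p 1] by (simp add: uminus_bit_def)
  show "irreducible [:1, 1 :: bit:]" by (rule irreducible_linear_field_poly) simp
  show "\<not> [:1, 1:] dvd [:0, 1 :: bit:]" by (simp add: dvd)
  fix g :: "bit poly" assume "\<not> [:1, 1:] dvd g"
  then have "poly g 1 = 1" by (simp add: dvd)
  then have "[:1, 1:] dvd g - [:0, 1:] ^ 0" by (simp add: dvd)
  then show "\<exists>n. [:1, 1:] dvd g - [:0, 1:] ^ n" by blast
qed

text \<open>Otherwise the i polynomials \<open>q' 1\<close>, ..., \<open>q' i\<close> all have
  degree below that of \<open>q i\<close>, so they would have to occur among the first i - 1 entries
  of q. This makes the quality parameter the same for all listings.\<close>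

lemma primitive_listing_degree_le:
  assumes q: "primitive_listing q" and q': "primitive_listing q'" and i: "i \<ge> 1"
  shows "degree (q i) \<le> degree (q' i)"
proof (rule ccontr)
  assume less: "\<not> degree (q i) \<le> degree (q' i)"
  have "q' ` {1..i} \<subseteq> q ` {1..<i}"
  proof
    fix g assume "g \<in> q' ` {1..i}"
    then obtain k where k: "k \<in> {1..i}" "g = q' k" by blast
    then have "degree g \<le> degree (q' i)"
      using q' by (auto simp: primitive_listing_def intro: mono_onD)
    then have dg: "degree g < degree (q i)" using less by simp
    have "q' k \<in> q' ` {1..}" using k by auto
    also have "q' ` {1..} = q ` {1..}" using q q' by (simp add: primitive_listing_def bij_betw_def)
    finally have "g \<in> q ` {1..}" using k by simp
    then obtain l where l: "l \<ge> 1" "g = q l" by auto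
    have "l < i"
    proof (rule ccontr)
      assume "\<not> l < i"
      then have "degree (q i) \<le> degree (q l)"
        using q i l by (auto simp: primitive_listing_def intro: mono_onD)
      then show False using dg l by simp
    qed
    then show "g \<in> q ` {1..<i}" using l by auto
  qed
  then have "card (q' ` {1..i}) \<le> card (q ` {1..<i})" by (intro card_mono) auto
  also have "\<dots> \<le> i - 1" using card_image_le[of "{1..<i}" q] by simp
  also have "card (q' ` {1..i}) = i"
    using q' by (subst card_image) (auto simp: primitive_listing_def bij_betw_def intro: inj_on_subset)
  finally show False using i by simp
qed

lemma sobol_poly_degree_eq:
  assumes "primitive_listing q" "primitive_listing q'" "j \<ge> 1"
  shows "degree (sobol_poly q j) = degree (sobol_poly q' j)"
proof (cases "j = 1")
  case False
  then have "j - 1 \<ge> 1" using assms(3) by simp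
  then show ?thesis
    using False primitive_listing_degree_le[OF assms(1,2)] primitive_listing_degree_le[OF assms(2,1)]
    by (simp add: sobol_poly_def le_antisym)
qed (simp add: sobol_poly_def)

lemma sobol_poly_degree_1_2:
  assumes "primitive_listing q"
  shows "degree (sobol_poly q 1) = 1" "degree (sobol_poly q 2) = 1"
proof -
  show "degree (sobol_poly q 1) = 1" by (simp add: sobol_poly_def)
  have "[:1, 1:] \<in> q ` {1..}"
    using assms primitive_poly_X_plus_1 by (simp add: primitive_listing_def bij_betw_def)
  then obtain k where k: "k \<ge> 1" "q k = [:1, 1:]" by (metis atLeast_iff imageE)
  then have "degree (q 1) \<le> degree (q k)"
    using assms mono_onD[of "{1..}" "\<lambda>j. degree (q j)" 1 k] by (simp add: primitive_listing_def)
  then show "degree (sobol_poly q 2) = 1"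
    using k sobol_poly_degree[OF assms, of 2] by (simp add: sobol_poly_def)
qed

lemma walsh_net_interlaced:
  assumes "primitive_listing q" "s \<ge> 1"
    and "(\<Sum>j\<in>{1..3 * s}-{1}. degree (sobol_poly q (j - 1)) - 1) \<le> t"
  shows "walsh_net m (3 * m) t {1..s} (interlaced_val q m)"
proof
  show "{1..s} \<noteq> {}" using assms by simp
  show "interlaced_val q m i n < 2 ^ (3 * m)" for i n
    unfolding interlaced_val_def by (rule bits_val_less)
  show "(\<Sum>n<2 ^ m. \<Prod>i\<in>{1..s}. walsh (3 * m) (F i) (interlaced_val q m i n)) = 0"
    if "sum b {1..s} + (\<Sum>i=1..s. (c i + 2) div 3) + t \<le> m"
      "\<And>i. i \<in> {1..s} \<Longrightarrow> F i \<subseteq> {1..3 * m} \<inter> ({1..b i} \<union> {b i + c i})" "\<exists>i\<in>{1..s}. F i \<noteq> {}"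
    for b c F
    using assms(1,3) that by (rule interlaced_dual)
qed simp

text \<open>The first coordinate interlaces only the antidiagonal matrix and the matrices of \<open>x\<close> and \<open>x + 1\<close>;
  the degrees being 1, these form a net with quality parameter 0.\<close>

lemma bij_betw_prefix:
  assumes q: "primitive_listing q"
  shows "bij_betw (\<lambda>n. interlaced_val q m 1 n div 2 ^ (2 * m)) {..<2 ^ m} {..<2 ^ m}"
proof -
  define h where "h = (\<lambda>n. interlaced_val q m 1 n div 2 ^ (2 * m))"
  have J: "{1..3 * 1} - {1 :: nat} = {2, 3}" by auto
  interpret W: walsh_net m "3 * m" 0 "{1..1}" "interlaced_val q m"
    by (rule walsh_net_interlaced[OF q])
      (use sobol_poly_degree_1_2[OF q] in \<open>simp_all only: J, simp_all\<close>)
  have M: "(2::nat) ^ (3 * m) = 2 ^ m * 2 ^ (2 * m)" by (simp flip: power_add)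
  have h_less: "h n < 2 ^ m" for n
  proof -
    have "interlaced_val q m 1 n < 2 ^ m * 2 ^ (2 * m)"
      unfolding interlaced_val_def M[symmetric] by (rule bits_val_less)
    then show ?thesis unfolding h_def by (rule less_mult_imp_div_less)
  qed
  \<comment> \<open>A prefix of length m is a box of volume 2^-m, which contains exactly one of the
    2^m points because t = 0.\<close>
  have one: "card {n \<in> {..<2 ^ m}. h n = v} = 1" if v: "v < 2 ^ m" for v
  proof -
    define k where "k = (\<lambda>_::nat. v * 2 ^ (2 * m))"
    have k: "k i < 2 ^ (3 * m)" for i using v unfolding M k_def by simp
    have "W.box_points (\<lambda>_. m) k = 2 ^ m * (\<Prod>i\<in>{1..1::nat}. 1 / 2 ^ m)"
      by (rule W.box_points_exact[of "\<lambda>_. m"]) (use k in auto)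
    moreover have "W.box_points (\<lambda>_. m) k = (\<Sum>n<2 ^ m. of_bool (h n = v))"
      unfolding W.box_points_def by (simp add: same_prefix_def h_def k_def)
    ultimately have "(\<Sum>n<(2::nat) ^ m. of_bool (h n = v)) = (1 :: real)" by simp
    then have "real (card {n \<in> {..<2 ^ m}. h n = v}) = 1"
      by (simp add: of_bool_def sum.If_cases Int_def)
    then show ?thesis by simp
  qed
  have "inj_on h {..<2 ^ m}"
  proof (rule inj_onI)
    fix n n' assume n: "n \<in> {..<(2::nat) ^ m}" "n' \<in> {..<(2::nat) ^ m}" "h n = h n'"
    define S where "S = {k \<in> {..<2 ^ m}. h k = h n}"
    have "card S = 1" unfolding S_def by (rule one[OF h_less])
    then obtain a where "S = {a}" by (rule card_1_singletonE)
    moreover have "n \<in> S" "n' \<in> S" using n by (simp_all add: S_def)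
    ultimately show "n = n'" by (metis singletonD)
  qed
  moreover have "h ` {..<2 ^ m} \<subseteq> {..<2 ^ m}" using h_less by auto
  ultimately have "bij_betw h {..<2 ^ m} {..<2 ^ m}"
    by (simp add: bij_betw_def endo_inj_surj)
  then show ?thesis by (simp add: h_def)
qed

section \<open>The truncated and stretched net\<close>

definition scaled_point :: "(nat \<Rightarrow> bit poly) \<Rightarrow> nat \<Rightarrow> nat \<Rightarrow> nat \<Rightarrow> nat \<Rightarrow> nat \<Rightarrow> real" where
  "scaled_point q s m N n = (\<lambda>j\<in>{1..s}.
     (if j = 1 then 2 ^ m / real N else 1) * (real (interlaced_val q m j n) / 2 ^ (3 * m)))"

text \<open>The first coordinate lies below N / 2^m iff its leading m digits form a number below N.
  By \<open>bij_betw_prefix\<close> this selects exactly N indices when N <= 2^m, and the first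
  coordinate alone separates the points.\<close>

lemma point_set_eq:
  fixes s m N :: nat
  assumes q: "primitive_listing q" and s: "s \<ge> 1" and N: "N \<ge> 1"
  defines "A \<equiv> {n \<in> {..<2 ^ m}. interlaced_val q m 1 n div 2 ^ (2 * m) < N}"
  shows "point_set q s m N = scaled_point q s m N ` A" "inj_on (scaled_point q s m N) A"
    "point_set q s m N \<subseteq> {1..s} \<rightarrow>\<^sub>E {0..<1}" "N \<le> 2 ^ m \<Longrightarrow> card A = N"
proof -
  define X where "X = (\<lambda>n. interlace3_vec s (sobol_point q s m n))"
  have ext: "X n \<in> extensional {1..s}" for n by (simp add: X_def interlace3_vec_def)
  have X: "X n i = real (interlaced_val q m i n) / 2 ^ (3 * m)" if "n < 2 ^ m" "i \<in> {1..s}" for n i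
    unfolding X_def using q that by (rule interlace3_vec_sobol_point)
  have less: "interlaced_val q m i n < 2 ^ (3 * m)" for i n
    unfolding interlaced_val_def by (rule bits_val_less)
  have less': "real (interlaced_val q m i n) < 2 ^ (3 * m)" for i n
    using less[of i n] by (metis of_nat_less_numeral_power_cancel_iff)
  have M: "(2::real) ^ (3 * m) = 2 ^ m * 2 ^ (2 * m)" by (simp flip: power_add)
  have hN: "real (interlaced_val q m 1 n) / 2 ^ (3 * m) < real N / 2 ^ m \<longleftrightarrow>
      interlaced_val q m 1 n div 2 ^ (2 * m) < N" for n
  proof -
    have "real (interlaced_val q m 1 n) / 2 ^ (3 * m) < real N / 2 ^ m \<longleftrightarrow>
      real (interlaced_val q m 1 n) < real (N * 2 ^ (2 * m))"
      unfolding M by (simp add: field_simps)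
    also have "\<dots> \<longleftrightarrow> interlaced_val q m 1 n < N * 2 ^ (2 * m)" by (simp only: of_nat_less_iff)
    also have "\<dots> \<longleftrightarrow> interlaced_val q m 1 n div 2 ^ (2 * m) < N"
      by (simp add: div_less_iff_less_mult)
    finally show ?thesis .
  qed
  have tn: "truncated_net q s m N = X ` A"
  proof -
    have "X n \<in> (\<Pi>\<^sub>E j\<in>{1..s}. if j = 1 then {0..<real N / 2 ^ m} else {0..<1}) \<longleftrightarrow>
        interlaced_val q m 1 n div 2 ^ (2 * m) < N" if n: "n < 2 ^ m" for n
      using ext[of n] s hN[of n] less' by (auto simp: PiE_iff X[OF n])
    then show ?thesis
      unfolding truncated_net_def interlaced_net_def A_def by (auto simp: X_def)
  qed
  have upd: "(X n)(1 := 2 ^ m / real N * X n 1) = scaled_point q s m N n" if "n \<in> A" for n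
  proof
    fix j
    have n: "n < 2 ^ m" using that by (simp add: A_def)
    show "((X n)(1 := 2 ^ m / real N * X n 1)) j = scaled_point q s m N n j"
      using s X[OF n] ext[of n] by (auto simp: scaled_point_def extensional_def)
  qed
  show eq: "point_set q s m N = scaled_point q s m N ` A"
    unfolding point_set_def tn image_image using upd by simp
  show "inj_on (scaled_point q s m N) A"
  proof (rule inj_onI)
    fix n n' assume n: "n \<in> A" "n' \<in> A" "scaled_point q s m N n = scaled_point q s m N n'"
    from fun_cong[OF n(3), of 1] have "interlaced_val q m 1 n = interlaced_val q m 1 n'"
      using s N by (simp add: scaled_point_def)
    then show "n = n'"
      using inj_onD[OF bij_betw_imp_inj_on[OF bij_betw_prefix[OF q, of m]], of n n'] n(1,2)
      by (simp add: A_def)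
  qed
  show "point_set q s m N \<subseteq> {1..s} \<rightarrow>\<^sub>E {0..<1}"
  proof
    fix y assume "y \<in> point_set q s m N"
    then obtain n where n: "n \<in> A" "y = scaled_point q s m N n" unfolding eq by blast
    have "real (interlaced_val q m 1 n) / 2 ^ (3 * m) < real N / 2 ^ m"
      using n hN by (simp add: A_def)
    then have "2 ^ m * real (interlaced_val q m 1 n) / real N < 2 ^ (3 * m)"
      using N by (simp add: field_simps)
    then show "y \<in> {1..s} \<rightarrow>\<^sub>E {0..<1}"
      using less' by (auto simp: n scaled_point_def)
  qed
  show "card A = N" if "N \<le> 2 ^ m"
  proof -
    let ?h = "\<lambda>n. interlaced_val q m 1 n div 2 ^ (2 * m)"
    have bij: "bij_betw ?h {..<2 ^ m} {..<2 ^ m}" using q by (rule bij_betw_prefix)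
    have "?h ` A = {..<N}"
    proof (intro equalityI subsetI)
      fix v assume "v \<in> {..<N}"
      then have "v \<in> ?h ` {..<2 ^ m}" using bij that by (auto simp: bij_betw_def)
      then show "v \<in> ?h ` A" using \<open>v \<in> {..<N}\<close> by (auto simp: A_def)
    qed (auto simp: A_def)
    moreover have "inj_on ?h A"
      using bij_betw_imp_inj_on[OF bij] by (rule inj_on_subset) (auto simp: A_def)
    ultimately show ?thesis using card_image[of ?h A] by simp
  qed
qed

section \<open>From the grid to the unit cube\<close>

lemma card_eq_sum_of_bool: "finite A \<Longrightarrow> real (card {x \<in> A. P x}) = (\<Sum>x\<in>A. of_bool (P x))"
  by (simp add: of_bool_def sum.If_cases Int_def)

lemma disc_box:
  assumes "finite I" "\<And>i. i \<in> I \<Longrightarrow> k i < 2 ^ M"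
  shows "discrepancy m M I x (\<lambda>i y. of_bool (y \<le> k i)) =
    real (card {n \<in> {..<2 ^ m}. \<forall>i\<in>I. x i n \<le> k i}) - 2 ^ m * (\<Prod>i\<in>I. (real (k i) + 1) / 2 ^ M)"
proof -
  have "(\<Sum>y<2 ^ M. of_bool (y \<le> k i)) = real (k i) + 1" if "i \<in> I" for i
  proof -
    have "(\<Sum>y<2 ^ M. of_bool (y \<le> k i)) = real (card {y \<in> {..<2 ^ M}. y \<le> k i})"
      by (rule card_eq_sum_of_bool[symmetric]) simp
    also have "{y \<in> {..<2 ^ M}. y \<le> k i} = {..k i}" using assms(2)[OF that] by auto
    finally show ?thesis by simp
  qed
  then have "(\<Prod>i\<in>I. (\<Sum>y<2 ^ M. of_bool (y \<le> k i)) / 2 ^ M) = (\<Prod>i\<in>I. (real (k i) + 1) / 2 ^ M)"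
    by simp
  moreover have "(\<Prod>i\<in>I. of_bool (x i n \<le> k i)) = (of_bool (\<forall>i\<in>I. x i n \<le> k i) :: real)" for n
    using assms(1) by (auto simp: of_bool_def)
  ultimately show ?thesis
    by (simp only: discrepancy_def card_eq_sum_of_bool[OF finite_lessThan])
qed

text \<open>Cells are open on the left and closed on the right because a grid point is counted iff
  it is strictly below t, so that the count is constant on each cell.\<close>

lemma emeasure_lborel_box:
  fixes w :: "nat \<Rightarrow> real"
  assumes "finite I" "\<And>i. i \<in> I \<Longrightarrow> w i \<ge> 0"
  shows "emeasure (\<Pi>\<^sub>M i\<in>I. lborel) (\<Pi>\<^sub>E i\<in>I. {w i * real (k i)<..w i * (real (k i) + 1)})
    = ennreal (\<Prod>i\<in>I. w i)"
proof -
  interpret product_sigma_finite "\<lambda>_::nat. lborel :: real measure" by standard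
  have "emeasure (\<Pi>\<^sub>M i\<in>I. lborel) (\<Pi>\<^sub>E i\<in>I. {w i * real (k i)<..w i * (real (k i) + 1)})
      = (\<Prod>i\<in>I. emeasure lborel {w i * real (k i)<..w i * (real (k i) + 1)})"
    by (rule emeasure_PiM[OF assms(1)]) auto
  also have "\<dots> = (\<Prod>i\<in>I. ennreal (w i))"
    using assms(2) by (intro prod.cong refl) (simp add: mult_left_mono algebra_simps)
  also have "\<dots> = ennreal (\<Prod>i\<in>I. w i)" using assms(2) by (rule prod_ennreal)
  finally show ?thesis .
qed


lemma abs_prod_diff_le:
  fixes u v :: "'a \<Rightarrow> real"
  assumes "\<And>i. i \<in> I \<Longrightarrow> 0 \<le> u i \<and> u i \<le> 1" "\<And>i. i \<in> I \<Longrightarrow> 0 \<le> v i \<and> v i \<le> 1"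
    and "\<And>i. i \<in> I \<Longrightarrow> \<bar>u i - v i\<bar> \<le> e"
  shows "\<bar>(\<Prod>i\<in>I. u i) - (\<Prod>i\<in>I. v i)\<bar> \<le> real (card I) * e"
proof -
  have "norm ((\<Prod>i\<in>I. u i) - (\<Prod>i\<in>I. v i)) \<le> (\<Sum>i\<in>I. norm (u i - v i))"
    using assms(1,2) by (intro norm_prod_diff) auto
  also have "\<dots> \<le> real (card I) * e"
    using sum_bounded_above[of I "\<lambda>i. norm (u i - v i)" e] assms(3) by simp
  finally show ?thesis by simp
qed

text \<open>All points lie on the grid of mesh \<open>2 ^ (- 3 * m)\<close>, stretched by \<open>2 ^ m / N\<close> in the first coordinate,
  so the counting function is constant on its cells; \<open>w\<close> holds their side lengths.\<close>

lemma local_discrepancy_cell: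
  fixes s m N :: nat and k :: "nat \<Rightarrow> nat"
  assumes q: "primitive_listing q" and s: "s \<ge> 1" and N: "N \<ge> 1" "N \<le> 2 ^ m"
  defines "w \<equiv> \<lambda>j::nat. (if j = 1 then 2 ^ m / real N else 1) / (2::real) ^ (3 * m)"
  assumes k: "\<And>j. j \<in> {1..s} \<Longrightarrow> k j < 2 ^ (3 * m)"
    and t: "\<And>j. j \<in> {1..s} \<Longrightarrow> w j * real (k j) < t j \<and> t j \<le> w j * (real (k j) + 1) \<and> t j \<le> 1"
  shows "\<bar>real (box_count s (point_set q s m N) t) / real N - (\<Prod>j=1..s. t j)\<bar>\<^sup>2
    \<le> (2 * (discrepancy m (3 * m) {1..s} (interlaced_val q m) (\<lambda>i y. of_bool (y \<le> k i)))\<^sup>2 + 2 * (real s)\<^sup>2) / (real N)\<^sup>2"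
proof -
  let ?x = "interlaced_val q m"
  define A where "A = {n \<in> {..<2 ^ m}. ?x 1 n div 2 ^ (2 * m) < N}"
  define D where "D = discrepancy m (3 * m) {1..s} ?x (\<lambda>i y. of_bool (y \<le> k i))"
  \<comment> \<open>\<open>u\<close> undoes the stretching, so that N times the volume at
    \<open>t\<close> is \<open>2 ^ m\<close> times the volume at \<open>u\<close>.\<close>
  define u where "u = (\<lambda>j. if j = 1 then real N / 2 ^ m * t j else t j)"
  have w0: "w j > 0" for j using N by (simp add: w_def)
  have M: "(2::nat) ^ (3 * m) = 2 ^ m * 2 ^ (2 * m)" by (simp flip: power_add)
  have pt: "scaled_point q s m N n j = w j * real (?x j n)" if "j \<in> {1..s}" for n j
    using that by (simp add: scaled_point_def w_def)
  have below: "w j * real x < t j \<longleftrightarrow> x \<le> k j" if j: "j \<in> {1..s}" for j x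
  proof
    assume "x \<le> k j"
    then have "w j * real x \<le> w j * real (k j)" using w0[of j] by (intro mult_left_mono) auto
    then show "w j * real x < t j" using t[OF j] by linarith
  next
    assume "w j * real x < t j"
    then have "w j * real x < w j * (real (k j) + 1)" using t[OF j] by linarith
    then have "real x < real (k j) + 1" using w0[of j] by simp
    then show "x \<le> k j" by linarith
  qed
  have "box_count s (point_set q s m N) t = card (scaled_point q s m N ` {n \<in> A. \<forall>j\<in>{1..s}. ?x j n \<le> k j})"
  proof -
    have "{p \<in> point_set q s m N. \<forall>j\<in>{1..s}. 0 \<le> p j \<and> p j < t j}
        = scaled_point q s m N ` {n \<in> A. \<forall>j\<in>{1..s}. ?x j n \<le> k j}"
      unfolding point_set_eq(1)[OF q s N(1)] A_def[symmetric]
      using w0 by (auto simp: pt below less_imp_le)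
    then show ?thesis by (simp add: box_count_def)
  qed
  also have "\<dots> = card {n \<in> A. \<forall>j\<in>{1..s}. ?x j n \<le> k j}"
    using point_set_eq(2)[OF q s N(1), of m] unfolding A_def[symmetric]
    by (intro card_image) (auto intro: inj_on_subset)
  \<comment> \<open>Since \<open>t 1 \<le> 1\<close>, a point counted by the box has stretched first
    coordinate below 1, so the truncation removes none of them.\<close>
  also have "{n \<in> A. \<forall>j\<in>{1..s}. ?x j n \<le> k j} = {n \<in> {..<2 ^ m}. \<forall>j\<in>{1..s}. ?x j n \<le> k j}"
  proof -
    have "?x 1 n div 2 ^ (2 * m) < N" if "?x 1 n \<le> k 1" for n
    proof -
      have "w 1 * real (?x 1 n) < 1" using below[of 1 "?x 1 n"] t[of 1] s that by auto
      then have "real (?x 1 n) * 2 ^ m < real N * 2 ^ (3 * m)" using N by (simp add: w_def field_simps)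
      then have "real (?x 1 n * 2 ^ m) < real (N * 2 ^ (3 * m))" by simp
      then have "?x 1 n * 2 ^ m < N * 2 ^ (3 * m)" by (simp only: of_nat_less_iff)
      then have "?x 1 n < N * 2 ^ (2 * m)" unfolding M by simp
      then show ?thesis by (simp add: div_less_iff_less_mult)
    qed
    then show ?thesis using s by (auto simp: A_def)
  qed
  finally have count: "real (box_count s (point_set q s m N) t)
      = D + 2 ^ m * (\<Prod>i\<in>{1..s}. (real (k i) + 1) / 2 ^ (3 * m))"
    unfolding D_def by (subst disc_box) (use k in auto)
  have prod_u: "2 ^ m * (\<Prod>j\<in>{1..s}. u j) = real N * (\<Prod>j\<in>{1..s}. t j)"
  proof -
    have one: "1 \<in> {1..s}" using s by simp
    have "(\<Prod>j\<in>{1..s}-{1}. u j) = (\<Prod>j\<in>{1..s}-{1}. t j)" by (intro prod.cong) (auto simp: u_def)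
    then show ?thesis
      unfolding prod.remove[OF finite_atLeastAtMost one] by (simp add: u_def)
  qed
  have u: "real (k j) / 2 ^ (3 * m) < u j \<and> u j \<le> (real (k j) + 1) / 2 ^ (3 * m) \<and> u j \<le> 1"
    if j: "j \<in> {1..s}" for j
  proof (cases "j = 1")
    case True
    have "real N / 2 ^ m * t j \<le> 1 * 1"
    proof (rule mult_mono)
      have "real N \<le> 2 ^ m" using N(2) by (metis of_nat_le_iff of_nat_numeral of_nat_power)
      then show "real N / 2 ^ m \<le> 1" by simp
      have "0 \<le> w j * real (k j)" using w0[of j] by simp
      then show "0 \<le> t j" using t[OF j] by linarith
    qed (use t[OF j] in auto)
    then show ?thesis using t[OF j] N True by (simp add: u_def w_def field_simps)
  next
    case False
    then show ?thesis using t[OF j] by (simp add: u_def w_def)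
  qed
  \<comment> \<open>The upper grid corner differs from \<open>u\<close> by at most 2^(-3m) per
    coordinate, so even after multiplication by 2^m the total error is at most s.\<close>
  have "\<bar>(\<Prod>i\<in>{1..s}. (real (k i) + 1) / 2 ^ (3 * m)) - (\<Prod>j\<in>{1..s}. u j)\<bar> \<le> real (card {1..s}) * (1 / 2 ^ (3 * m))"
  proof (rule abs_prod_diff_le)
    fix i assume i: "i \<in> {1..s}"
    have "real (k i) + 1 \<le> 2 ^ (3 * m)"
      using k[OF i] by (metis Suc_eq_plus1 Suc_leI of_nat_1 of_nat_add of_nat_le_iff of_nat_numeral of_nat_power)
    then show "0 \<le> (real (k i) + 1) / 2 ^ (3 * m) \<and> (real (k i) + 1) / 2 ^ (3 * m) \<le> 1" by simp
    have "0 \<le> real (k i) / 2 ^ (3 * m)" by simp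
    then show "0 \<le> u i \<and> u i \<le> 1" using u[OF i] by linarith
    show "\<bar>(real (k i) + 1) / 2 ^ (3 * m) - u i\<bar> \<le> 1 / 2 ^ (3 * m)"
      using u[OF i] by (simp add: add_divide_distrib)
  qed
  then have "2 ^ m * \<bar>(\<Prod>i\<in>{1..s}. (real (k i) + 1) / 2 ^ (3 * m)) - (\<Prod>j\<in>{1..s}. u j)\<bar> \<le> 2 ^ m * (real s * (1 / 2 ^ (3 * m)))"
    by (intro mult_left_mono) auto
  also have "\<dots> \<le> real s"
  proof -
    have "(2::real) ^ m \<le> 2 ^ (3 * m)" by (rule power_increasing) auto
    then have "2 ^ m / 2 ^ (3 * m) \<le> (1::real)" by simp
    then have "real s * (2 ^ m / 2 ^ (3 * m)) \<le> real s * 1" by (intro mult_left_mono) auto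
    then show ?thesis by (simp add: mult_ac)
  qed
  finally have err: "\<bar>2 ^ m * (\<Prod>i\<in>{1..s}. (real (k i) + 1) / 2 ^ (3 * m)) - 2 ^ m * (\<Prod>j\<in>{1..s}. u j)\<bar> \<le> real s"
    by (simp add: abs_mult flip: right_diff_distrib)
  define e where "e = 2 ^ m * (\<Prod>i\<in>{1..s}. (real (k i) + 1) / 2 ^ (3 * m)) - 2 ^ m * (\<Prod>j\<in>{1..s}. u j)"
  have "real (box_count s (point_set q s m N) t) / real N - (\<Prod>j=1..s. t j) = (D + e) / real N"
    using N(1) unfolding count e_def prod_u by (simp add: field_simps)
  then have "\<bar>real (box_count s (point_set q s m N) t) / real N - (\<Prod>j=1..s. t j)\<bar>\<^sup>2 = (D + e)\<^sup>2 / (real N)\<^sup>2"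
    by (simp add: power_divide)
  also have "\<dots> \<le> (2 * D\<^sup>2 + 2 * (real s)\<^sup>2) / (real N)\<^sup>2"
  proof (intro divide_right_mono)
    have "e\<^sup>2 \<le> (real s)\<^sup>2" using err by (simp add: e_def abs_le_square_iff[symmetric])
    then show "(D + e)\<^sup>2 \<le> 2 * D\<^sup>2 + 2 * (real s)\<^sup>2"
      using sum_squares_bound[of D e] by (simp add: power2_sum)
  qed simp
  finally show ?thesis by (simp add: D_def)
qed

text \<open>The integrand is dominated by the step function of the cell bounds, and every cell has
  the same volume. In the first coordinate the cells reach up to 2^m / N, beyond the cube if N <
  2^m.\<close>

lemma L2_discrepancy_le_grid:
  fixes s m N :: nat
  assumes q: "primitive_listing q" and s: "s \<ge> 1" and N: "N \<ge> 1" "N \<le> 2 ^ m"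
  shows "(L2_discrepancy s N (point_set q s m N))\<^sup>2 \<le> (2 ^ m / real N) / (2 ^ (3 * m)) ^ s *
    (\<Sum>k\<in>{1..s} \<rightarrow>\<^sub>E {..<2 ^ (3 * m)}.
      (2 * (discrepancy m (3 * m) {1..s} (interlaced_val q m) (\<lambda>i y. of_bool (y \<le> k i)))\<^sup>2 + 2 * (real s)\<^sup>2) / (real N)\<^sup>2)"
proof -
  define w where "w = (\<lambda>j::nat. (if j = 1 then 2 ^ m / real N else 1) / (2::real) ^ (3 * m))"
  define G where "G = {1..s} \<rightarrow>\<^sub>E {..<(2::nat) ^ (3 * m)}"
  define c where "c = (\<lambda>k. (2 * (discrepancy m (3 * m) {1..s} (interlaced_val q m) (\<lambda>i y. of_bool (y \<le> k i)))\<^sup>2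
      + 2 * (real s)\<^sup>2) / (real N)\<^sup>2)"
  define cell where "cell = (\<lambda>k. \<Pi>\<^sub>E i\<in>{1..s}. {w i * real (k i)<..w i * (real (k i) + 1)})"
  define P where "P = (\<Pi>\<^sub>M j\<in>{1..s}. (lborel :: real measure))"
  define f where "f = (\<lambda>t. \<bar>real (box_count s (point_set q s m N) t) / real N - (\<Prod>j=1..s. t j)\<bar>\<^sup>2)"
  define g where "g = (\<lambda>t. \<Sum>k\<in>G. c k * indicator (cell k) t)"
  have w0: "w j > 0" for j using N by (simp add: w_def)
  have c0: "c k \<ge> 0" for k by (simp add: c_def)
  have finG: "finite G" by (simp add: G_def finite_PiE)
  have em: "emeasure P (cell k) = ennreal (\<Prod>i\<in>{1..s}. w i)" for k
    unfolding P_def cell_def using w0 by (intro emeasure_lborel_box) (auto intro: less_imp_le)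
  have cell_sets: "cell k \<in> sets P" for k
    unfolding P_def cell_def by (intro sets_PiM_I_finite) auto
  have int_cell: "integrable P (\<lambda>t. c k * indicator (cell k) t)" for k
    using em cell_sets by (intro integrable_mult_right integrable_real_indicator) auto
  have prod_w: "(\<Prod>i\<in>{1..s}. w i) = (2 ^ m / real N) / (2 ^ (3 * m)) ^ s"
  proof -
    have one: "1 \<in> {1..s}" using s by simp
    have "(\<Prod>i\<in>{1..s}-{1}. (if i = 1 then 2 ^ m / real N else 1)) = 1" by (intro prod.neutral) auto
    then have "(\<Prod>i\<in>{1..s}. (if i = 1 then 2 ^ m / real N else 1)) = 2 ^ m / real N"
      by (subst prod.remove[OF finite_atLeastAtMost one]) simp
    then show ?thesis unfolding w_def prod_dividef by simp
  qed
  have "integral\<^sup>L P g = (\<Sum>k\<in>G. integral\<^sup>L P (\<lambda>t. c k * indicator (cell k) t))"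
    unfolding g_def using int_cell by (rule Bochner_Integration.integral_sum)
  also have "\<dots> = (\<Sum>k\<in>G. c k * (\<Prod>i\<in>{1..s}. w i))"
  proof (intro sum.cong refl)
    fix k
    have "integral\<^sup>L P (\<lambda>t. c k * indicator (cell k) t) = c k * measure P (cell k)"
      using cell_sets sets.sets_into_space[OF cell_sets[of k]] by (simp add: Int_absorb2)
    also have "measure P (cell k) = (\<Prod>i\<in>{1..s}. w i)"
      using w0 by (simp add: measure_def em prod_nonneg less_imp_le)
    finally show "integral\<^sup>L P (\<lambda>t. c k * indicator (cell k) t) = c k * (\<Prod>i\<in>{1..s}. w i)" .
  qed
  also have "\<dots> = (\<Sum>k\<in>G. c k) * (\<Prod>i\<in>{1..s}. w i)" by (rule sum_distrib_right[symmetric])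
  also have "\<dots> = (\<Prod>i\<in>{1..s}. w i) * (\<Sum>k\<in>G. c k)" by (rule mult.commute)
  finally have int_g: "integral\<^sup>L P g = (2 ^ m / real N) / (2 ^ (3 * m)) ^ s * (\<Sum>k\<in>G. c k)"
    unfolding prod_w .
  have "integral\<^sup>L P (\<lambda>t. indicator ({1..s} \<rightarrow>\<^sub>E {0..1}) t *\<^sub>R f t) \<le> integral\<^sup>L P g"
  proof (rule integral_mono')
    show "integrable P g" unfolding g_def using int_cell by (rule Bochner_Integration.integrable_sum)
    show g0: "0 \<le> g t" for t
      unfolding g_def using c0 by (intro sum_nonneg) (auto simp: indicator_def)
    show "indicator ({1..s} \<rightarrow>\<^sub>E {0..1}) t *\<^sub>R f t \<le> g t" for t
    proof (cases "t \<in> {1..s} \<rightarrow>\<^sub>E {0..1}")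
      case True
      then have t01: "0 \<le> t j \<and> t j \<le> 1" if "j \<in> {1..s}" for j using that by (auto dest: PiE_mem)
      show ?thesis
      \<comment> \<open>A point with a zero coordinate lies in no cell, but there the count and the
        volume are both 0.\<close>
      proof (cases "\<exists>j\<in>{1..s}. t j = 0")
        case True
        then obtain j where j: "j \<in> {1..s}" "t j = 0" by blast
        then have "{x \<in> point_set q s m N. \<forall>j\<in>{1..s}. 0 \<le> x j \<and> x j < t j} = {}" by force
        then have "box_count s (point_set q s m N) t = 0" unfolding box_count_def by (simp only: card.empty)
        moreover have "(\<Prod>j=1..s. t j) = 0" using j by (intro prod_zero) auto
        ultimately have "f t = 0" unfolding f_def by (simp only:) simp
        then show ?thesis using g0[of t] by simp
      next
        case False
        \<comment> \<open>The ceiling minus 1, as cells are closed on the right.\<close>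
        define k where "k = (\<lambda>j\<in>{1..s}. nat (\<lceil>t j / w j\<rceil> - 1))"
        have kt: "w j * real (k j) < t j \<and> t j \<le> w j * (real (k j) + 1) \<and> k j < 2 ^ (3 * m)"
          if j: "j \<in> {1..s}" for j
        proof -
          have "t j > 0" using False t01[OF j] j by force
          then have pos: "t j / w j > 0" using w0[of j] by simp
          then have "\<lceil>t j / w j\<rceil> \<ge> 1" by linarith
          then have kj: "real (k j) = of_int \<lceil>t j / w j\<rceil> - 1" using j by (simp add: k_def)
          have "real (k j) < t j / w j" unfolding kj by linarith
          moreover have "t j / w j \<le> real (k j) + 1" unfolding kj by linarith
          moreover have "t j / w j \<le> 2 ^ (3 * m)"
          proof -
            have "1 / w j \<le> 2 ^ (3 * m)"
            proof (cases "j = 1")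
              case True
              have "real N \<le> 2 ^ m" using N(2) by (metis of_nat_le_iff of_nat_numeral of_nat_power)
              then show ?thesis using True N by (simp add: w_def field_simps)
            qed (simp add: w_def)
            moreover have "t j / w j \<le> 1 / w j" using t01[OF j] w0[of j] by (intro divide_right_mono) auto
            ultimately show ?thesis by linarith
          qed
          ultimately have "real (k j) < 2 ^ (3 * m)" by linarith
          then have "k j < 2 ^ (3 * m)" by (metis of_nat_less_numeral_power_cancel_iff)
          then show ?thesis using \<open>real (k j) < t j / w j\<close> \<open>t j / w j \<le> real (k j) + 1\<close> w0[of j]
            by (simp add: field_simps)
        qed
        have kG: "k \<in> G" unfolding G_def using kt by (auto simp: k_def)
        have "t \<in> cell k" unfolding cell_def using True kt by (auto simp: PiE_iff)
        then have "c k = c k * indicator (cell k) t" by simp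
        also have "\<dots> \<le> g t"
          unfolding g_def using finG kG c0 by (intro member_le_sum) (auto simp: indicator_def)
        finally have "c k \<le> g t" .
        moreover have "f t \<le> c k"
          unfolding f_def c_def using kt t01
          by (intro local_discrepancy_cell[OF q s N]) (auto simp: w_def)
        ultimately show ?thesis using True by simp
      qed
    qed (use g0 in simp)
  qed
  moreover have "(L2_discrepancy s N (point_set q s m N))\<^sup>2
      = integral\<^sup>L P (\<lambda>t. indicator ({1..s} \<rightarrow>\<^sub>E {0..1}) t *\<^sub>R f t)"
    unfolding L2_discrepancy_def set_lebesgue_integral_def P_def f_def
    by (intro real_sqrt_pow2 Bochner_Integration.integral_nonneg) (auto simp: indicator_def)
  ultimately show ?thesis unfolding int_g by (simp add: G_def c_def)
qed

text \<open>\<open>C\<close> is chosen before the listing \<open>q\<close>, so it does not depend on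
  the order among polynomials of equal degree. The two inequalities determine \<open>m\<close> from
  \<open>N\<close>, and \<open>powr\<close> serves the half-integral exponent.\<close>

theorem corollary1:
  fixes s :: nat
  assumes "s \<ge> 1"
  shows "\<exists>C::real. C > 0 \<and>
    (\<forall>(q :: nat \<Rightarrow> bit poly) (N :: nat) (m :: nat).
       primitive_listing q \<longrightarrow> N \<ge> 2 \<longrightarrow> m \<ge> 1 \<longrightarrow> 2 ^ (m - 1) < N \<longrightarrow> N \<le> 2 ^ m \<longrightarrow>
       point_set q s m N \<subseteq> ({1..s} \<rightarrow>\<^sub>E {0..<1}) \<and>
       card (point_set q s m N) = N \<and>
       L2_discrepancy s N (point_set q s m N) \<le> C * ln (real N) powr ((real s - 1) / 2) / real N)"
proof (cases "\<exists>q. primitive_listing q")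
  case False
  then show ?thesis by (intro exI[of _ 1]) auto
next
  case True
  then obtain q0 where q0: "primitive_listing q0" by blast
  \<comment> \<open>By \<open>sobol_poly_degree_eq\<close> an arbitrary listing \<open>q0\<close>
    yields the quality parameter of all listings.\<close>
  define t where "t = (\<Sum>j\<in>{1..3 * s}-{1}. degree (sobol_poly q0 (j - 1)) - 1)"
  define K where "K = 4 ^ (t + 1) * 324 ^ s * level_const s"
  \<comment> \<open>The outer 2 bounds the stretching factor 2^m / N. Inside, (D + e)^2 <= 2 D^2 + 2
    e^2 with discrepancy D and rounding error |e| <= s.\<close>
  define B where "B = 2 * (2 * K + 2 * (real s)\<^sup>2)"
  \<comment> \<open>The 6 comes from m + 1 <= 6 ln N, the sum of m - 1 <= 2 ln N and 2 <= 4 ln N,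
    both of which use ln 2 >= 1/2.\<close>
  define C where "C = sqrt (B * 6 ^ (s - 1))"
  have "level_const s > 0"
    unfolding level_const_def by (intro add_pos_nonneg suminf_nonneg summable_poly_geometric) auto
  then have K0: "K > 0" by (simp add: K_def)
  then have B0: "B > 0" using K0 by (simp add: B_def add_pos_nonneg)
  have main: "point_set q s m N \<subseteq> ({1..s} \<rightarrow>\<^sub>E {0..<1}) \<and> card (point_set q s m N) = N \<and>
       L2_discrepancy s N (point_set q s m N) \<le> C * ln (real N) powr ((real s - 1) / 2) / real N"
    if q: "primitive_listing q" and N2: "N \<ge> 2" and m: "m \<ge> 1" and mN: "2 ^ (m - 1) < N" "N \<le> 2 ^ m"
    for q N m
  proof -
    have N1: "N \<ge> 1" using N2 by simp
    have "card (point_set q s m N) = N"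
      unfolding point_set_eq(1)[OF q assms N1] card_image[OF point_set_eq(2)[OF q assms N1]]
      by (rule point_set_eq(4)[OF q assms N1 mN(2)])
    moreover have "point_set q s m N \<subseteq> ({1..s} \<rightarrow>\<^sub>E {0..<1})"
      by (rule point_set_eq(3)[OF q assms N1])
    moreover have "L2_discrepancy s N (point_set q s m N) \<le> C * ln (real N) powr ((real s - 1) / 2) / real N"
    proof -
      define L where "L = ln (real N)"
      define S where "S = real (m + 1) ^ (s - 1)"
      have L0: "L > 0" using N2 by (simp add: L_def)
      have "(\<Sum>j\<in>{1..3 * s}-{1}. degree (sobol_poly q (j - 1)) - 1) = t"
        unfolding t_def
      proof (intro sum.cong refl)
        fix j assume "j \<in> {1..3 * s} - {1 :: nat}"
        then have "j - 1 \<ge> 1" by auto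
        then show "degree (sobol_poly q (j - 1)) - 1 = degree (sobol_poly q0 (j - 1)) - 1"
          using sobol_poly_degree_eq[OF q q0] by simp
      qed
      then interpret W: walsh_net m "3 * m" t "{1..s}" "interlaced_val q m"
        by (intro walsh_net_interlaced[OF q assms]) simp
      have S1: "S \<ge> 1" by (simp add: S_def)
      have grid: "real (card W.grid) = (2 ^ (3 * m)) ^ s" by (simp add: card_PiE)
      have "(\<Sum>k\<in>W.grid. 2 * (W.disc (\<lambda>i y. of_bool (y \<le> k i)))\<^sup>2 + 2 * (real s)\<^sup>2)
          = 2 * (\<Sum>k\<in>W.grid. (W.disc (\<lambda>i y. of_bool (y \<le> k i)))\<^sup>2) + real (card W.grid) * (2 * (real s)\<^sup>2)"
        by (simp add: sum.distrib sum_distrib_left)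
      also have "\<dots> \<le> 2 * ((2 ^ (3 * m)) ^ s * (K * S)) + (2 ^ (3 * m)) ^ s * (2 * (real s)\<^sup>2 * S)"
      proof (rule add_mono)
        show "2 * (\<Sum>k\<in>W.grid. (W.disc (\<lambda>i y. of_bool (y \<le> k i)))\<^sup>2) \<le> 2 * ((2 ^ (3 * m)) ^ s * (K * S))"
          using mult_left_mono[OF W.mean_square_discrepancy, of 2]
          by (simp only: K_def S_def mult.assoc card_atLeastAtMost diff_Suc_1 zero_le_numeral)
        show "real (card W.grid) * (2 * (real s)\<^sup>2) \<le> (2 ^ (3 * m)) ^ s * (2 * (real s)\<^sup>2 * S)"
          unfolding grid using S1 by (intro mult_left_mono) (auto simp: mult_le_cancel_left1)
      qed
      also have "\<dots> = (2 ^ (3 * m)) ^ s * (B / 2 * S)" by (simp add: B_def algebra_simps)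
      finally have sum: "(\<Sum>k\<in>W.grid. 2 * (W.disc (\<lambda>i y. of_bool (y \<le> k i)))\<^sup>2 + 2 * (real s)\<^sup>2)
          \<le> (2 ^ (3 * m)) ^ s * (B / 2 * S)" .
      have two: "2 ^ m / real N \<le> 2"
      proof -
        have "(2::nat) ^ m \<le> 2 * N" using m mN(1) by (cases m) auto
        then have "(2::real) ^ m \<le> 2 * real N"
          by (metis of_nat_le_iff of_nat_mult of_nat_numeral of_nat_power)
        then show ?thesis using N1 by (simp add: field_simps)
      qed
      have "(L2_discrepancy s N (point_set q s m N))\<^sup>2 \<le> (2 ^ m / real N) / (2 ^ (3 * m)) ^ s *
          (\<Sum>k\<in>W.grid. (2 * (W.disc (\<lambda>i y. of_bool (y \<le> k i)))\<^sup>2 + 2 * (real s)\<^sup>2) / (real N)\<^sup>2)"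
        by (rule L2_discrepancy_le_grid[OF q assms N1 mN(2)])
      also have "\<dots> = (2 ^ m / real N) * ((\<Sum>k\<in>W.grid. 2 * (W.disc (\<lambda>i y. of_bool (y \<le> k i)))\<^sup>2 + 2 * (real s)\<^sup>2)
          / ((2 ^ (3 * m)) ^ s * (real N)\<^sup>2))"
        by (simp flip: sum_divide_distrib)
      also have "\<dots> \<le> 2 * ((2 ^ (3 * m)) ^ s * (B / 2 * S) / ((2 ^ (3 * m)) ^ s * (real N)\<^sup>2))"
        using two sum by (intro mult_mono divide_right_mono divide_nonneg_nonneg sum_nonneg) auto
      also have "\<dots> = B * S / (real N)\<^sup>2" by simp
      also have "S \<le> (6 * L) ^ (s - 1)"
      proof -
        have "real (m - 1) * ln 2 = ln (2 ^ (m - 1))" by (simp add: ln_realpow)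
        also have "\<dots> \<le> L"
        proof -
          have "(2::real) ^ (m - 1) \<le> real N"
            using mN(1) by (metis less_imp_le of_nat_le_iff of_nat_numeral of_nat_power)
          then show ?thesis by (simp add: L_def ln_mono)
        qed
        finally have "real (m - 1) * ln 2 \<le> L" .
        moreover have l2: "ln 2 \<ge> (1 / 2 :: real)" using ln2_ge_two_thirds by simp
        then have "real (m - 1) * (1 / 2) \<le> real (m - 1) * ln 2" by (intro mult_left_mono) auto
        moreover have "ln 2 \<le> L" using N2 by (simp add: L_def)
        ultimately have "real (m + 1) \<le> 6 * L" using l2 m by (simp add: of_nat_diff)
        then show ?thesis unfolding S_def by (intro power_mono) auto
      qed
      finally have "(L2_discrepancy s N (point_set q s m N))\<^sup>2 \<le> B * (6 * L) ^ (s - 1) / (real N)\<^sup>2"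
        using B0 by (simp add: divide_right_mono mult_left_mono)
      also have "\<dots> = (C * L powr ((real s - 1) / 2) / real N)\<^sup>2"
      proof -
        have "(L powr ((real s - 1) / 2))\<^sup>2 = L powr (real s - 1)"
          by (simp add: power2_eq_square flip: powr_add)
        also have "\<dots> = L ^ (s - 1)" using L0 assms by (simp flip: powr_realpow add: of_nat_diff)
        finally show ?thesis using B0
          by (simp add: power_divide power_mult_distrib C_def)
      qed
      finally show ?thesis
        unfolding L_def[symmetric] by (rule power2_le_imp_le) (use B0 in \<open>simp add: C_def\<close>)
    qed
    ultimately show ?thesis by blast
  qed
  have "C > 0" using B0 by (simp add: C_def)
  then show ?thesis using main by (intro exI[of _ C]) blast
qed

end
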